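(* Let $(\psi^n, A^n)_{n\ge 0}$ be a solution of the semi-discrete scheme (with zero electric potential) $$\frac{\psi^n-\psi^{n-1}}{\tau}+\Big(\frac{i}{\kappa}\nabla+A^{n-1}\Big)^2\psi^n+f(|\psi^{n-1}|^2)\psi^n+S(\psi^n-\psi^{n-1})=0,$$ $$\sigma\frac{A^n-A^{n-1}}{\tau}+\operatorname{curl}\operatorname{curl}A^n+\frac1\kappa\operatorname{Im}\big(\psi^n\nabla\overline{\psi^n}\big)+A^n|\psi^n|^2=\operatorname{curl}H^n,$$ in $\Omega$ for $n=1,2,3,\dots$, with the boundary conditions stated in the context. Here $f$ is the function defined in the context, which is assumed to satisfy $f(1)=0$. Assume that the initial value $\psi^0=\psi_0$ satisfies $|\psi^0|\le 1$ in $\overline\Omega$ and that, for some positive constant $L$, $|f'(s)|\le L$ for all $s\in[0,1]$ (i.e. $|f'(|\psi|^2)|\le L$ whenever $|\psi|\le1$). Define $$E^n=\frac12\int_\Omega\Big[\Big|\Big(\frac{i}{\kappa}\nabla+A^n\Big)\psi^n\Big|^2+F(|\psi^n|^2)+|\operatorname{curl}A^n-H^n|^2\Big]dx ,\qquad n\ge0.$$ If $S\ge 2L$, then for all $n\ge1$ $$E^n-E^{n-1}\le\int_\Omega (H^n-\operatorname{curl}A^n)\cdot(H^n-H^{n-1})\,dx .$$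
   Context: $\Omega\subset\mathbb R^d$ ($d=2,3$) is a bounded domain with smooth boundary and unit outer normal $n$ (the letter $n$ is also used for the time index; a dot or cross product with $n$ in a boundary condition always refers to the normal). The constants $\kappa,\sigma,\tau>0$ are the Ginzburg–Landau parameter, a relaxation parameter and the time step, $t^n=n\tau$, and $S$ is a real stabilization constant. The unknowns are $\psi^n:\overline\Omega\to\mathbb C$ (order parameter) and $A^n:\overline\Omega\to\mathbb R^d$ (magnetic potential); $H^n=H(\cdot,t^n)$ is a given external magnetic field. The initial data are $(\psi^0,A^0)$. All functions are assumed smooth up to the boundary, so that equations and boundary conditions hold pointwise. A bar denotes complex conjugation, and $(\frac{i}{\kappa}\nabla+A)^2\psi=-\frac1{\kappa^2}\Delta\psi+\frac{i}{\kappa}(\operatorname{div}A)\psi+\frac{2i}{\kappa}A\cdot\nabla\psi+|A|^2\psi$. For $d=2$ the usual convention is used: $\operatorname{curl}A=\partial_1A_2-\partial_2A_1$ is scalar, $H$ is scalar, and $\operatorname{curl}H=(\partial_2H,-\partial_1H)$; the condition $n\times\operatorname{curl}A=n\times H$ then means $\operatorname{curl}A=H$ on $\partial\Omega$. Boundary conditions on $\partial\Omega$: $\nabla\psi^m\cdot n=0$ and $n\times\operatorname{curl}A^m=n\times H^m$ for all $m\ge1$, and $A^m\cdot n=0$ for all $m\ge0$. The nonlinearity and its potential are, for $s\ge 0$, $$f(s)=1-\int_0^{\tilde\omega}\frac{\nu_0}{4\sqrt{\xi^2+s}}\sum_{\pm}\tanh\big(\beta(\sqrt{\xi^2+s}\pm\delta)\big)\,d\xi,$$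 $$F(s)=s-\frac{\nu_0}{2\beta}\int_0^{\tilde\omega}\sum_{\pm}\ln\cosh\big(\beta(\sqrt{\xi^2+s}\pm\delta)\big)\,d\xi,$$ so that $F'=f$. Here $\tilde\omega,\beta>0$ are constants, $\delta=\delta(x)$ is a given smooth real-valued function on $\overline\Omega$ (so $f,F$ may also depend on $x$; the conditions $f(1)=0$ and $|f'|\le L$ are meant at every $x$), and the constant $\nu_0$ is determined by $\nu_0\int_0^{\tilde\omega}\frac{\tanh(\beta_0\xi)}{2\xi}\,d\xi=1$ for a given constant $\beta_0>0$. $f'$ is the derivative with respect to $s$. *)

theory Defs
  imports "HOL-Analysis.Analysis"
begin

section \<open>Smooth functions and smooth domains\<close>

definition pderiv_at :: "'d::finite \<Rightarrow> (real^'d \<Rightarrow> 'b::real_normed_vector) \<Rightarrow> real^'d \<Rightarrow> 'b" where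
  "pderiv_at j f x = frechet_derivative f (at x) (axis j 1)"

text \<open>The set \<open>U\<close> is meant to be open.\<close>

primrec Ck_on :: "nat \<Rightarrow> (real^'d::finite) set \<Rightarrow> (real^'d \<Rightarrow> 'b::real_normed_vector) \<Rightarrow> bool" where
  "Ck_on 0 U f \<longleftrightarrow> continuous_on U f"
| "Ck_on (Suc k) U f \<longleftrightarrow>
     (\<forall>x\<in>U. f differentiable (at x)) \<and> (\<forall>j. Ck_on k U (pderiv_at j f))"

definition smooth_on :: "(real^'d::finite) set \<Rightarrow> (real^'d \<Rightarrow> 'b::real_normed_vector) \<Rightarrow> bool" where
  "smooth_on U f \<longleftrightarrow> (\<forall>k. Ck_on k U f)"

text \<open>A function on the closure of \<open>\<Omega>\<close> that is smooth up to the boundary is represented by a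
  smooth extension to an open neighbourhood of the closure, so that derivatives at boundary points
  are ordinary derivatives. By continuity they depend only on the values in \<open>\<Omega>\<close> when \<open>\<Omega>\<close> is a
  smooth domain; the values away from the closure are irrelevant.\<close>

definition smooth_up_to_boundary ::
  "(real^'d::finite) set \<Rightarrow> (real^'d \<Rightarrow> 'b::real_normed_vector) \<Rightarrow> bool" where
  "smooth_up_to_boundary \<Omega> f \<longleftrightarrow> (\<exists>U. open U \<and> closure \<Omega> \<subseteq> U \<and> smooth_on U f)"

definition grad :: "(real^'d::finite \<Rightarrow> 'b::real_normed_vector) \<Rightarrow> real^'d \<Rightarrow> 'b^'d" where
  "grad f x = (\<chi> j. pderiv_at j f x)"

definition local_defining_function ::
  "(real^'d::finite) set \<Rightarrow> real^'d \<Rightarrow> (real^'d) set \<Rightarrow> (real^'d \<Rightarrow> real) \<Rightarrow> bool" where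
  "local_defining_function \<Omega> p U \<rho> \<longleftrightarrow>
     open U \<and> p \<in> U \<and> smooth_on U \<rho> \<and> (\<forall>x\<in>U. grad \<rho> x \<noteq> 0) \<and> \<Omega> \<inter> U = {x \<in> U. \<rho> x < 0}"

definition smooth_bounded_domain :: "(real^'d::finite) set \<Rightarrow> bool" where
  "smooth_bounded_domain \<Omega> \<longleftrightarrow>
     open \<Omega> \<and> connected \<Omega> \<and> \<Omega> \<noteq> {} \<and> bounded \<Omega> \<and>
     (\<forall>p\<in>frontier \<Omega>. \<exists>U \<rho>. local_defining_function \<Omega> p U \<rho>)"

text \<open>At a boundary point of a smooth domain the vector does not depend on the choice of the
  local defining function. (\<open>sgn v\<close> is \<open>v\<close> divided by its norm.)\<close>

definition outer_normal :: "(real^'d::finite) set \<Rightarrow> real^'d \<Rightarrow> real^'d" where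
  "outer_normal \<Omega> p =
     (SOME \<nu>. \<exists>U \<rho>. local_defining_function \<Omega> p U \<rho> \<and> \<nu> = sgn (grad \<rho> p))"

section \<open>Differential operators\<close>

definition laplacian :: "(real^'d::finite \<Rightarrow> complex) \<Rightarrow> real^'d \<Rightarrow> complex" where
  "laplacian f x = (\<Sum>j\<in>UNIV. pderiv_at j (pderiv_at j f) x)"

definition divergence :: "(real^'d::finite \<Rightarrow> real^'d) \<Rightarrow> real^'d \<Rightarrow> real" where
  "divergence A x = (\<Sum>j\<in>UNIV. pderiv_at j (\<lambda>y. A y $ j) x)"

text \<open>Bilinear product of a real and a complex vector.\<close>

definition rcdot :: "real^'d::finite \<Rightarrow> complex^'d \<Rightarrow> complex" where
  "rcdot v w = (\<Sum>j\<in>UNIV. complex_of_real (v $ j) * w $ j)"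

definition curl3 :: "(real^3 \<Rightarrow> real^3) \<Rightarrow> real^3 \<Rightarrow> real^3" where
  "curl3 A x = vector
     [pderiv_at 2 (\<lambda>y. A y $ 3) x - pderiv_at 3 (\<lambda>y. A y $ 2) x,
      pderiv_at 3 (\<lambda>y. A y $ 1) x - pderiv_at 1 (\<lambda>y. A y $ 3) x,
      pderiv_at 1 (\<lambda>y. A y $ 2) x - pderiv_at 2 (\<lambda>y. A y $ 1) x]"

definition curl2 :: "(real^2 \<Rightarrow> real^2) \<Rightarrow> real^2 \<Rightarrow> real" where
  "curl2 A x = pderiv_at 1 (\<lambda>y. A y $ 2) x - pderiv_at 2 (\<lambda>y. A y $ 1) x"

definition curl2_scalar :: "(real^2 \<Rightarrow> real) \<Rightarrow> real^2 \<Rightarrow> real^2" where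
  "curl2_scalar h x = vector [pderiv_at 2 h x, - pderiv_at 1 h x]"

text \<open>The operators \<open>(i/\<kappa>)\<nabla> + A\<close> and \<open>((i/\<kappa>)\<nabla> + A)\<^sup>2\<close>, the latter in expanded form.\<close>

definition mag_grad ::
  "real \<Rightarrow> (real^'d::finite \<Rightarrow> real^'d) \<Rightarrow> (real^'d \<Rightarrow> complex) \<Rightarrow> real^'d \<Rightarrow> complex^'d" where
  "mag_grad \<kappa> A \<psi> x =
     (\<chi> j. \<i> / complex_of_real \<kappa> * pderiv_at j \<psi> x + complex_of_real (A x $ j) * \<psi> x)"

definition mag_laplacian ::
  "real \<Rightarrow> (real^'d::finite \<Rightarrow> real^'d) \<Rightarrow> (real^'d \<Rightarrow> complex) \<Rightarrow> real^'d \<Rightarrow> complex" where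
  "mag_laplacian \<kappa> A \<psi> x =
     - (1 / complex_of_real (\<kappa>\<^sup>2)) * laplacian \<psi> x
     + \<i> / complex_of_real \<kappa> * complex_of_real (divergence A x) * \<psi> x
     + 2 * \<i> / complex_of_real \<kappa> * rcdot (A x) (grad \<psi> x)
     + complex_of_real ((norm (A x))\<^sup>2) * \<psi> x"

text \<open>\<open>Im (\<psi> \<nabla>\<psi>\<^sup>*)\<close>, where the star is complex conjugation.\<close>

definition im_current :: "(real^'d::finite \<Rightarrow> complex) \<Rightarrow> real^'d \<Rightarrow> real^'d" where
  "im_current \<psi> x = (\<chi> j. Im (\<psi> x * pderiv_at j (\<lambda>y. cnj (\<psi> y)) x))"

section \<open>Nonlinearity and energy\<close>

text \<open>The argument \<open>d\<close> is the value of \<open>\<delta>\<close> at the point under consideration.\<close>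

definition gl_f :: "real \<Rightarrow> real \<Rightarrow> real \<Rightarrow> real \<Rightarrow> real \<Rightarrow> real" where
  "gl_f \<omega> \<beta> \<nu>\<^sub>0 d s =
     1 - integral {0..\<omega>} (\<lambda>\<xi>. \<nu>\<^sub>0 / (4 * sqrt (\<xi>\<^sup>2 + s)) *
           (tanh (\<beta> * (sqrt (\<xi>\<^sup>2 + s) + d)) + tanh (\<beta> * (sqrt (\<xi>\<^sup>2 + s) - d))))"

definition gl_F :: "real \<Rightarrow> real \<Rightarrow> real \<Rightarrow> real \<Rightarrow> real \<Rightarrow> real" where
  "gl_F \<omega> \<beta> \<nu>\<^sub>0 d s =
     s - \<nu>\<^sub>0 / (2 * \<beta>) * integral {0..\<omega>} (\<lambda>\<xi>.
           ln (cosh (\<beta> * (sqrt (\<xi>\<^sup>2 + s) + d))) + ln (cosh (\<beta> * (sqrt (\<xi>\<^sup>2 + s) - d))))"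

text \<open>\<open>B\<close> stands for \<open>curl A\<close>, which is scalar in two and vector-valued in three dimensions;
  \<open>F\<close> may depend on the point.\<close>

definition gl_energy ::
  "real \<Rightarrow> (real^'d::finite \<Rightarrow> real \<Rightarrow> real) \<Rightarrow> (real^'d) set \<Rightarrow> (real^'d \<Rightarrow> complex) \<Rightarrow>
   (real^'d \<Rightarrow> real^'d) \<Rightarrow> (real^'d \<Rightarrow> 'h::real_normed_vector) \<Rightarrow> (real^'d \<Rightarrow> 'h) \<Rightarrow> real" where
  "gl_energy \<kappa> F \<Omega> \<psi> A B h =
     1/2 * (LINT x:\<Omega>|lborel.
       (norm (mag_grad \<kappa> A \<psi> x))\<^sup>2 + F x ((cmod (\<psi> x))\<^sup>2) + (norm (B x - h x))\<^sup>2)"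

section \<open>The semi-discrete scheme\<close>

text \<open>In the following, \<open>f\<close> may depend on the point, and \<open>H n\<close> is the applied field at time \<open>n\<tau>\<close>.
  The order parameter equation and its boundary condition, as well as \<open>A \<cdot> n = 0\<close>, do not depend
  on the dimension.\<close>

definition gl_common ::
  "real \<Rightarrow> real \<Rightarrow> real \<Rightarrow> (real^'d::finite \<Rightarrow> real \<Rightarrow> real) \<Rightarrow> (real^'d) set \<Rightarrow>
   (nat \<Rightarrow> real^'d \<Rightarrow> complex) \<Rightarrow> (nat \<Rightarrow> real^'d \<Rightarrow> real^'d) \<Rightarrow> bool" where
  "gl_common \<kappa> \<tau> S f \<Omega> \<psi> A \<longleftrightarrow>
     (\<forall>n. smooth_up_to_boundary \<Omega> (\<psi> n) \<and> smooth_up_to_boundary \<Omega> (A n)) \<and>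
     (\<forall>n\<ge>1. \<forall>x\<in>\<Omega>.
        (\<psi> n x - \<psi> (n - 1) x) / complex_of_real \<tau>
        + mag_laplacian \<kappa> (A (n - 1)) (\<psi> n) x
        + complex_of_real (f x ((cmod (\<psi> (n - 1) x))\<^sup>2)) * \<psi> n x
        + complex_of_real S * (\<psi> n x - \<psi> (n - 1) x) = 0) \<and>
     (\<forall>n\<ge>1. \<forall>x\<in>frontier \<Omega>. rcdot (outer_normal \<Omega> x) (grad (\<psi> n) x) = 0) \<and>
     (\<forall>n. \<forall>x\<in>frontier \<Omega>. A n x \<bullet> outer_normal \<Omega> x = 0)"

definition gl_scheme_2d ::
  "real \<Rightarrow> real \<Rightarrow> real \<Rightarrow> real \<Rightarrow> (real^2 \<Rightarrow> real \<Rightarrow> real) \<Rightarrow> (real^2) set \<Rightarrow>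
   (nat \<Rightarrow> real^2 \<Rightarrow> real) \<Rightarrow> (nat \<Rightarrow> real^2 \<Rightarrow> complex) \<Rightarrow> (nat \<Rightarrow> real^2 \<Rightarrow> real^2) \<Rightarrow> bool" where
  "gl_scheme_2d \<kappa> \<sigma> \<tau> S f \<Omega> H \<psi> A \<longleftrightarrow>
     gl_common \<kappa> \<tau> S f \<Omega> \<psi> A \<and>
     (\<forall>n\<ge>1. \<forall>x\<in>\<Omega>.
        (\<sigma> / \<tau>) *\<^sub>R (A n x - A (n - 1) x) + curl2_scalar (curl2 (A n)) x
        + (1 / \<kappa>) *\<^sub>R im_current (\<psi> n) x + (cmod (\<psi> n x))\<^sup>2 *\<^sub>R A n x
        = curl2_scalar (H n) x) \<and>
     (\<forall>n\<ge>1. \<forall>x\<in>frontier \<Omega>. curl2 (A n) x = H n x)"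

definition gl_scheme_3d ::
  "real \<Rightarrow> real \<Rightarrow> real \<Rightarrow> real \<Rightarrow> (real^3 \<Rightarrow> real \<Rightarrow> real) \<Rightarrow> (real^3) set \<Rightarrow>
   (nat \<Rightarrow> real^3 \<Rightarrow> real^3) \<Rightarrow> (nat \<Rightarrow> real^3 \<Rightarrow> complex) \<Rightarrow> (nat \<Rightarrow> real^3 \<Rightarrow> real^3) \<Rightarrow> bool" where
  "gl_scheme_3d \<kappa> \<sigma> \<tau> S f \<Omega> H \<psi> A \<longleftrightarrow>
     gl_common \<kappa> \<tau> S f \<Omega> \<psi> A \<and>
     (\<forall>n\<ge>1. \<forall>x\<in>\<Omega>.
        (\<sigma> / \<tau>) *\<^sub>R (A n x - A (n - 1) x) + curl3 (curl3 (A n)) x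
        + (1 / \<kappa>) *\<^sub>R im_current (\<psi> n) x + (cmod (\<psi> n x))\<^sup>2 *\<^sub>R A n x
        = curl3 (H n) x) \<and>
     (\<forall>n\<ge>1. \<forall>x\<in>frontier \<Omega>.
        cross3 (outer_normal \<Omega> x) (curl3 (A n) x) = cross3 (outer_normal \<Omega> x) (H n x))"

text \<open>\<open>\<bar>f'\<bar> \<le> L\<close> on \<open>[0,1]\<close>. The derivative is one-sided at \<open>s = 0\<close> since \<open>f\<close> is only meaningful
  for \<open>s \<ge> 0\<close>.\<close>

definition deriv_bounded_on_unit :: "real \<Rightarrow> (real \<Rightarrow> real) \<Rightarrow> bool" where
  "deriv_bounded_on_unit L f \<longleftrightarrow>
     (\<forall>s\<in>{0..1}. \<exists>f'. (f has_real_derivative f') (at s within {0..}) \<and> \<bar>f'\<bar> \<le> L)"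

end

(* The energy law follows by testing the first equation with \<psi>^n - \<psi>^(n-1) and the second with
   A^n - A^(n-1): the quadratic terms telescope up to nonnegative squares, and convexity fails only
   by F(b) - F(a) - f(a)(b - a) <= L/2 (b - a)^2, where (|\<psi>^n|^2 - |\<psi>^(n-1)|^2)^2 <=
   4 |\<psi>^n - \<psi>^(n-1)|^2 because both moduli are at most 1; the stabilization S >= 2L absorbs this.
   The bound |\<psi>^n| <= 1 is a weak maximum principle: S >= 2L and f >= -L(1 - s) make the test
   function ((|\<psi>^n|^2 - 1)_+)^2 \<psi>^n vanish.

   Every boundary term is the flux of a field V tangential to the boundary, so it suffices that such
   a field satisfies \<integral>_\<Omega> div V = 0, and no surface measure is needed: after localization,
   multiply V by a cutoff \<theta>(k \<rho>) of a local defining function \<rho>. The compactly supported field has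
   divergence with integral zero, and the extra term k \<theta>'(k \<rho>) (\<nabla>\<rho> \<bullet> V) tends to zero boundedly since
   \<nabla>\<rho> \<bullet> V = O(\<rho>). *)
theory Submission
  imports Defs
begin

section \<open>Calculus of continuously differentiable functions\<close>

text \<open>The telescoping passes through a mixed state. The first equation carries
  \<open>A^(n-1)\<close>, so testing it controls the change from (\<open>\<psi>^(n-1)\<close>,
  \<open>A^(n-1)\<close>) to (\<open>\<psi>^n\<close>, \<open>A^(n-1)\<close>); the second carries
  \<open>\<psi>^n\<close> and controls the change from there to (\<open>\<psi>^n\<close>,
  \<open>A^n\<close>). This lag is what lets each equation be handled alone. The condition f(1) = 0
  anchors the Lipschitz bound and gives f(s) >= -L(1 - s) on [0,1]. Since f' is controlled on [0,1]
  only, the bound on the moduli has to precede the energy estimate and is carried along by induction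
  on n. The energy estimates are inequalities between integrands; only Green's identity and
  integration by parts for the curl are statements about integrals. The working regularity is C^1:
  every truncation is the square of a positive part, so classical derivatives are enough and no weak
  derivatives appear. The dimension matters only for the curl, so all else is proved once over
  \<open>real^'d\<close>.\<close>

lemma pderiv_at_eq:
  assumes "(f has_derivative f') (at x)"
  shows "pderiv_at j f x = f' (axis j 1)"
  using frechet_derivative_at[OF assms] by (simp add: pderiv_at_def)

lemma has_derivative_pderiv_at:
  fixes f :: "real^'d::finite \<Rightarrow> 'b::real_normed_vector"
  assumes "f differentiable (at x)"
  shows "(f has_derivative (\<lambda>h. \<Sum>j\<in>UNIV. h $ j *\<^sub>R pderiv_at j f x)) (at x)"
proof -
  let ?D = "frechet_derivative f (at x)"
  have D: "(f has_derivative ?D) (at x)"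
    using assms frechet_derivative_works by blast
  then interpret bounded_linear ?D
    by (rule has_derivative_bounded_linear)
  have "?D h = (\<Sum>j\<in>UNIV. h $ j *\<^sub>R pderiv_at j f x)" for h
  proof -
    have "?D h = ?D (\<Sum>j\<in>UNIV. h $ j *\<^sub>R axis j 1)"
      by (simp add: basis_expansion flip: scalar_mult_eq_scaleR)
    then show ?thesis
      by (simp add: sum scaleR pderiv_at_def)
  qed
  with D show ?thesis
    by (metis (no_types, lifting) ext)
qed

lemma pderiv_at_transform_open:
  assumes "open U" "x \<in> U" "\<And>y. y \<in> U \<Longrightarrow> f y = g y"
  shows "pderiv_at j f x = pderiv_at j g x"
proof -
  have "(f has_derivative D) (at x) \<longleftrightarrow> (g has_derivative D) (at x)" for D
    using assms by (metis has_derivative_transform_within_open)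
  then show ?thesis
    by (simp add: pderiv_at_def frechet_derivative_def)
qed

lemma pderiv_at_bounded_linear:
  assumes "bounded_linear h" "f differentiable (at x)"
  shows "pderiv_at j (\<lambda>y. h (f y)) x = h (pderiv_at j f x)"
  using bounded_linear.has_derivative[OF assms(1) assms(2)[unfolded frechet_derivative_works]]
  by (simp add: pderiv_at_eq) (simp add: pderiv_at_def)

lemma pderiv_at_bounded_bilinear:
  assumes "bounded_bilinear B" "f differentiable (at x)" "g differentiable (at x)"
  shows "pderiv_at j (\<lambda>y. B (f y) (g y)) x = B (f x) (pderiv_at j g x) + B (pderiv_at j f x) (g x)"
  using bounded_bilinear.FDERIV[OF assms(1) assms(2,3)[unfolded frechet_derivative_works]]
  by (simp add: pderiv_at_eq) (simp add: pderiv_at_def)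

lemmas pderiv_at_mult = pderiv_at_bounded_bilinear[OF bounded_bilinear_mult]

lemma pderiv_at_add:
  assumes "f differentiable (at x)" "g differentiable (at x)"
  shows "pderiv_at j (\<lambda>y. f y + g y) x = pderiv_at j f x + pderiv_at j g x"
  using has_derivative_add[OF assms[unfolded frechet_derivative_works]]
  by (simp add: pderiv_at_eq) (simp add: pderiv_at_def)

lemma pderiv_at_diff:
  assumes "f differentiable (at x)" "g differentiable (at x)"
  shows "pderiv_at j (\<lambda>y. f y - g y) x = pderiv_at j f x - pderiv_at j g x"
  using has_derivative_diff[OF assms[unfolded frechet_derivative_works]]
  by (simp add: pderiv_at_eq) (simp add: pderiv_at_def)

lemma pderiv_at_sum:
  assumes "\<And>i. i \<in> I \<Longrightarrow> f i differentiable (at x)"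
  shows "pderiv_at j (\<lambda>y. \<Sum>i\<in>I. f i y) x = (\<Sum>i\<in>I. pderiv_at j (f i) x)"
proof -
  have "((\<lambda>y. \<Sum>i\<in>I. f i y) has_derivative (\<lambda>h. \<Sum>i\<in>I. frechet_derivative (f i) (at x) h)) (at x)"
    using assms by (intro has_derivative_sum) (simp add: frechet_derivative_works)
  from pderiv_at_eq[OF this] show ?thesis
    by (simp add: pderiv_at_def)
qed

lemma pderiv_at_const [simp]: "pderiv_at j (\<lambda>y. c) x = 0"
  by (simp add: pderiv_at_def)

lemma pderiv_at_chain_real:
  fixes u :: "real^'d::finite \<Rightarrow> real" and h :: "real \<Rightarrow> real"
  assumes "(h has_real_derivative h') (at (u x))" "u differentiable (at x)"
  shows "pderiv_at j (\<lambda>y. h (u y)) x = h' * pderiv_at j u x"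
  using has_derivative_compose[OF assms(2)[unfolded frechet_derivative_works]
      assms(1)[unfolded has_field_derivative_def]]
  by (simp add: pderiv_at_eq) (simp add: pderiv_at_def)

text \<open>This is \<open>Ck_on 1\<close> written out. Squared positive parts, from which all
  cutoffs and test functions below are built, are C^1 but in general not C^2, so
  \<open>smooth_on\<close> would exclude them.\<close>

definition C1_on :: "(real^'d::finite) set \<Rightarrow> (real^'d \<Rightarrow> 'b::real_normed_vector) \<Rightarrow> bool" where
  "C1_on U f \<longleftrightarrow> (\<forall>x\<in>U. f differentiable (at x)) \<and> (\<forall>j. continuous_on U (pderiv_at j f))"

lemma C1_on_differentiable: "C1_on U f \<Longrightarrow> x \<in> U \<Longrightarrow> f differentiable (at x)"
  by (simp add: C1_on_def)

lemma C1_on_pderiv_continuous: "C1_on U f \<Longrightarrow> continuous_on U (pderiv_at j f)"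
  by (simp add: C1_on_def)

lemma C1_on_continuous: "C1_on U f \<Longrightarrow> continuous_on U f"
  by (simp add: C1_on_def continuous_at_imp_continuous_on differentiable_imp_continuous_within)

lemma C1_on_subset: "C1_on U f \<Longrightarrow> V \<subseteq> U \<Longrightarrow> C1_on V f"
  unfolding C1_on_def by (meson continuous_on_subset subsetD)

lemma C1_onI:
  assumes "\<And>x. x \<in> U \<Longrightarrow> f differentiable (at x)"
    and "\<And>j x. x \<in> U \<Longrightarrow> pderiv_at j f x = g j x" "\<And>j. continuous_on U (g j)"
  shows "C1_on U f"
  using assms by (simp add: C1_on_def cong: continuous_on_cong)

lemma C1_on_const [simp]: "C1_on U (\<lambda>x. c)"
  by (rule C1_onI[where g = "\<lambda>_ _. 0"]) auto

lemma C1_on_bounded_linear: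
  assumes "bounded_linear h" "C1_on U f"
  shows "C1_on U (\<lambda>x. h (f x))"
proof (rule C1_onI)
  fix x assume x: "x \<in> U"
  show "(\<lambda>x. h (f x)) differentiable (at x)"
    using bounded_linear.has_derivative[OF assms(1)] C1_on_differentiable[OF assms(2) x]
    unfolding differentiable_def by blast
  show "pderiv_at j (\<lambda>x. h (f x)) x = h (pderiv_at j f x)" for j
    by (rule pderiv_at_bounded_linear[OF assms(1) C1_on_differentiable[OF assms(2) x]])
next
  show "continuous_on U (\<lambda>x. h (pderiv_at j f x))" for j
    by (rule bounded_linear.continuous_on[OF assms(1) C1_on_pderiv_continuous[OF assms(2)]])
qed

lemma C1_on_bounded_bilinear:
  assumes "bounded_bilinear B" "C1_on U f" "C1_on U g"
  shows "C1_on U (\<lambda>x. B (f x) (g x))"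
proof (rule C1_onI)
  fix x assume x: "x \<in> U"
  show "(\<lambda>x. B (f x) (g x)) differentiable (at x)"
    using bounded_bilinear.FDERIV[OF assms(1)] C1_on_differentiable[OF assms(2) x]
      C1_on_differentiable[OF assms(3) x]
    unfolding differentiable_def by blast
  show "pderiv_at j (\<lambda>x. B (f x) (g x)) x
      = B (f x) (pderiv_at j g x) + B (pderiv_at j f x) (g x)" for j
    by (rule pderiv_at_bounded_bilinear[OF assms(1) C1_on_differentiable[OF assms(2) x]
          C1_on_differentiable[OF assms(3) x]])
next
  show "continuous_on U (\<lambda>x. B (f x) (pderiv_at j g x) + B (pderiv_at j f x) (g x))" for j
    by (intro continuous_on_add bounded_bilinear.continuous_on[OF assms(1)]
        C1_on_pderiv_continuous C1_on_continuous assms)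
qed

lemmas C1_on_mult = C1_on_bounded_bilinear[OF bounded_bilinear_mult]

lemma C1_on_add: 
  assumes "C1_on U f" "C1_on U g" shows "C1_on U (\<lambda>x. f x + g x)"
proof (rule C1_onI[where g = "\<lambda>j x. pderiv_at j f x + pderiv_at j g x"])
qed (use assms in \<open>auto simp: C1_on_def intro!: pderiv_at_add differentiable_add continuous_on_add\<close>)

lemma C1_on_diff:
  assumes "C1_on U f" "C1_on U g" shows "C1_on U (\<lambda>x. f x - g x)"
proof (rule C1_onI[where g = "\<lambda>j x. pderiv_at j f x - pderiv_at j g x"])
qed (use assms in \<open>auto simp: C1_on_def intro!: pderiv_at_diff differentiable_diff continuous_on_diff\<close>)

lemma C1_on_sum:
  assumes "\<And>i. i \<in> I \<Longrightarrow> C1_on U (f i)" shows "C1_on U (\<lambda>x. \<Sum>i\<in>I. f i x)"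
  using assms
  by (induction I rule: infinite_finite_induct) (auto intro!: C1_on_add)

lemma C1_on_chain_real:
  fixes u :: "real^'d::finite \<Rightarrow> real" and h :: "real \<Rightarrow> real"
  assumes "C1_on U u" "\<And>x. x \<in> U \<Longrightarrow> (h has_real_derivative h' (u x)) (at (u x))"
    and "continuous_on (u ` U) h'"
  shows "C1_on U (\<lambda>x. h (u x))"
proof (rule C1_onI)
  fix x assume x: "x \<in> U"
  show "(\<lambda>x. h (u x)) differentiable (at x)"
    by (rule differentiable_chain_at[OF C1_on_differentiable[OF assms(1) x], unfolded o_def])
      (use assms(2)[OF x] in \<open>auto simp: real_differentiable_def\<close>)
  show "pderiv_at j (\<lambda>x. h (u x)) x = h' (u x) * pderiv_at j u x" for j
    by (rule pderiv_at_chain_real[OF assms(2)[OF x] C1_on_differentiable[OF assms(1) x]])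
next
  show "continuous_on U (\<lambda>x. h' (u x) * pderiv_at j u x)" for j
    by (intro continuous_on_mult C1_on_pderiv_continuous assms
        continuous_on_compose2[OF assms(3) C1_on_continuous[OF assms(1)]]) auto
qed

section \<open>Stability of the smooth class\<close>

lemma smooth_on_pderiv_at: "smooth_on U f \<Longrightarrow> smooth_on U (pderiv_at j f)"
  by (metis Ck_on.simps(2) smooth_on_def)

lemma smooth_on_C1_on: "smooth_on U f \<Longrightarrow> C1_on U f"
  unfolding smooth_on_def C1_on_def by (metis Ck_on.simps)

text \<open>Formulas for derivatives hold only at points of \<open>U\<close>, so replacing a
  derivative by its formula at higher order needs invariance under changes off \<open>U\<close>.
  Openness provides it: derivatives at points of \<open>U\<close> do not see such changes.\<close>

lemma Ck_on_cong:
  assumes "open U" "\<And>x. x \<in> U \<Longrightarrow> f x = g x"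
  shows "Ck_on k U f \<longleftrightarrow> Ck_on k U g"
  using assms(2)
proof (induction k arbitrary: f g)
  case 0
  then show ?case by (simp cong: continuous_on_cong)
next
  case (Suc k)
  have "f differentiable (at x) \<longleftrightarrow> g differentiable (at x)" if "x \<in> U" for x
    unfolding differentiable_def
    using has_derivative_transform_within_open[OF _ assms(1) that] Suc.prems by metis
  moreover have "Ck_on k U (pderiv_at j f) \<longleftrightarrow> Ck_on k U (pderiv_at j g)" for j
    by (rule Suc.IH) (use pderiv_at_transform_open[OF assms(1)] Suc.prems in blast)
  ultimately show ?case by auto
qed

lemma smooth_on_bounded_linear:
  assumes "open U" "bounded_linear h" "smooth_on U f"
  shows "smooth_on U (\<lambda>x. h (f x))"
proof -
  have "Ck_on k U (\<lambda>x. h (f x))" if "smooth_on U f" for k f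
    using that
  proof (induction k arbitrary: f)
    case 0
    then show ?case
      by (simp add: bounded_linear.continuous_on[OF assms(2)] C1_on_continuous smooth_on_C1_on)
  next
    case (Suc k)
    note C1 = smooth_on_C1_on[OF Suc.prems]
    have "Ck_on k U (pderiv_at j (\<lambda>x. h (f x))) \<longleftrightarrow> Ck_on k U (\<lambda>x. h (pderiv_at j f x))" for j
      by (rule Ck_on_cong[OF assms(1)])
        (rule pderiv_at_bounded_linear[OF assms(2) C1_on_differentiable[OF C1]])
    with C1_on_differentiable[OF C1_on_bounded_linear[OF assms(2) C1]]
      Suc.IH[OF smooth_on_pderiv_at[OF Suc.prems]]
    show ?case by simp
  qed
  with assms(3) show ?thesis by (simp add: smooth_on_def)
qed

lemma smooth_on_subset: "smooth_on U f \<Longrightarrow> V \<subseteq> U \<Longrightarrow> smooth_on V f"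
proof -
  have "Ck_on k U f \<Longrightarrow> V \<subseteq> U \<Longrightarrow> Ck_on k V f" for k and f :: "real^'a \<Rightarrow> 'b"
    by (induction k arbitrary: f) (auto intro: continuous_on_subset)
  then show "smooth_on U f \<Longrightarrow> V \<subseteq> U \<Longrightarrow> smooth_on V f" 
    by (auto simp: smooth_on_def)
qed

section \<open>The divergence theorem for tangential fields\<close>

lemma grad_nth [simp]: "grad f x $ j = pderiv_at j f x"
  by (simp add: grad_def)

lemma has_real_derivative_along_line:
  fixes f :: "real^'d::finite \<Rightarrow> real"
  assumes "f differentiable (at (x + t *\<^sub>R v))"
  shows "((\<lambda>s. f (x + s *\<^sub>R v)) has_real_derivative (grad f (x + t *\<^sub>R v) \<bullet> v)) (at t)"
proof -
  have "((\<lambda>s. x + s *\<^sub>R v) has_derivative (\<lambda>s. s *\<^sub>R v)) (at t)"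
    by (auto intro!: derivative_eq_intros)
  from has_derivative_compose[OF this has_derivative_pderiv_at[OF assms]]
  show ?thesis
    unfolding has_field_derivative_def
    by (rule has_derivative_eq_rhs)
      (auto simp: fun_eq_iff inner_vec_def sum_distrib_left sum_distrib_right mult_ac)
qed

lemma continuous_on_compact_abs_bound:
  fixes f :: "'a::topological_space \<Rightarrow> real"
  assumes "compact K" "continuous_on K f"
  shows "\<exists>B. \<forall>x\<in>K. \<bar>f x\<bar> \<le> B"
  using compact_imp_bounded[OF compact_continuous_image[OF assms(2,1)]]
  by (auto simp: bounded_iff)

text \<open>The sum of bounds for the partial derivatives bounds the operator norm of the
  derivative, and a ball is convex, so the mean value inequality applies.\<close>

lemma C1_on_Lipschitz:
  fixes f :: "real^'d::finite \<Rightarrow> real"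
  assumes "C1_on N f" "cball p r \<subseteq> N"
  obtains K where "0 \<le> K" "\<And>x y. x \<in> cball p r \<Longrightarrow> y \<in> cball p r \<Longrightarrow> \<bar>f x - f y\<bar> \<le> K * norm (x - y)"
proof -
  have "\<exists>B. \<forall>x\<in>cball p r. \<bar>pderiv_at j f x\<bar> \<le> B" for j
    by (rule continuous_on_compact_abs_bound[OF compact_cball])
      (rule continuous_on_subset[OF C1_on_pderiv_continuous[OF assms(1)] assms(2)])
  then have "\<exists>B. \<forall>j. \<forall>x\<in>cball p r. \<bar>pderiv_at j f x\<bar> \<le> B j"
    by (intro choice) blast
  then obtain B where B: "\<And>j x. x \<in> cball p r \<Longrightarrow> \<bar>pderiv_at j f x\<bar> \<le> B j"
    by blast
  show ?thesis
  proof (rule that)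
    fix x y assume xy: "x \<in> cball p r" "y \<in> cball p r"
    have B0: "0 \<le> (\<Sum>j\<in>UNIV. B j)"
      by (rule sum_nonneg) (rule order_trans[OF abs_ge_zero B[OF xy(1)]])
    have "norm (f x - f y) \<le> (\<Sum>j\<in>UNIV. B j) * norm (x - y)"
    proof (rule differentiable_bound[OF convex_cball[of p r]])
      fix z assume z: "z \<in> cball p r"
      show "(f has_derivative (\<lambda>h. \<Sum>j\<in>UNIV. h $ j *\<^sub>R pderiv_at j f z)) (at z within cball p r)"
        by (rule has_derivative_at_withinI[OF has_derivative_pderiv_at])
          (rule C1_on_differentiable[OF assms(1) subsetD[OF assms(2) z]])
      show "onorm (\<lambda>h. \<Sum>j\<in>UNIV. h $ j *\<^sub>R pderiv_at j f z) \<le> (\<Sum>j\<in>UNIV. B j)"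
      proof (rule onorm_bound[OF B0])
        fix h :: "real^'d"
        have "norm (\<Sum>j\<in>UNIV. h $ j *\<^sub>R pderiv_at j f z) \<le> (\<Sum>j\<in>UNIV. norm h * B j)"
          by (rule sum_norm_le) (auto simp: abs_mult intro!: mult_mono B z component_le_norm_cart)
        then show "norm (\<Sum>j\<in>UNIV. h $ j *\<^sub>R pderiv_at j f z) \<le> (\<Sum>j\<in>UNIV. B j) * norm h"
          by (subst mult.commute) (simp only: sum_distrib_left)
      qed
    qed (use xy in auto)
    then show "\<bar>f x - f y\<bar> \<le> (\<bar>\<Sum>j\<in>UNIV. B j\<bar>) * norm (x - y)"
      using B0 by simp
  qed simp
qed

text \<open>By translation invariance of \<open>lborel\<close> every difference quotient has
  integral zero, and dominated convergence passes this on to the derivative. No iterated integrals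
  are involved.\<close>

lemma integral_pderiv_at_eq_0:
  fixes g :: "real^'d::finite \<Rightarrow> real"
  assumes diff: "\<And>x. g differentiable (at x)"
    and bound: "\<And>x. \<bar>pderiv_at j g x\<bar> \<le> B"
    and supp: "\<And>x. x \<notin> cball p r \<Longrightarrow> g x = 0"
  shows "(LINT x|lborel. pderiv_at j g x) = 0"
proof -
  define e :: "real^'d" where "e = axis j 1"
  have e: "norm e = 1" by (simp add: e_def)
  \<comment> \<open>The increments \<open>1 / Suc k\<close> are at most 1, so every
    \<open>q k\<close> vanishes outside the ball of radius \<open>r + 1\<close>, which carries the
    dominating function.\<close>
  define q where "q k x = real (Suc k) * (g (inverse (real (Suc k)) *\<^sub>R e + x) - g x)" for k x
  have cont: "continuous_on UNIV g"
    using diff by (simp add: differentiable_imp_continuous_on differentiable_on_def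
        differentiable_at_withinI)
  then have meas [measurable]: "g \<in> borel_measurable borel"
    by (rule borel_measurable_continuous_onI)
  have int: "integrable lborel g"
  proof -
    have "integrable lborel (\<lambda>x. indicator (cball p r) x *\<^sub>R g x)"
      by (rule borel_integrable_compact) (auto intro: continuous_on_subset[OF cont])
    also have "(\<lambda>x. indicator (cball p r) x *\<^sub>R g x) = g"
      using supp by (auto simp: indicator_def fun_eq_iff)
    finally show ?thesis .
  qed
  have shift: "integrable lborel (\<lambda>x. g (c + x))" "(LINT x|lborel. g (c + x)) = (LINT x|lborel. g x)" for c
  proof -
    have m: "(+) c \<in> lborel \<rightarrow>\<^sub>M borel" by simp
    have int': "integrable (distr lborel borel ((+) c)) g"
      using int by (simp add: lborel_distr_plus)
    show "integrable lborel (\<lambda>x. g (c + x))"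
      by (rule integrable_distr[OF m int'])
    show "(LINT x|lborel. g (c + x)) = (LINT x|lborel. g x)"
      using integral_distr[OF m meas] by (simp add: lborel_distr_plus)
  qed
  have q0: "(LINT x|lborel. q k x) = 0" for k
    using shift int unfolding q_def by simp
  have line: "((\<lambda>s. g (x + s *\<^sub>R e)) has_real_derivative pderiv_at j g (x + t *\<^sub>R e)) (at t)" for x :: "real^'d" and t :: real
    using has_real_derivative_along_line[OF diff, of x e t]
    by (simp add: e_def inner_axis)
  have lim: "(\<lambda>k. q k x) \<longlonglongrightarrow> pderiv_at j g x" for x
  proof -
    have "((\<lambda>h. (g (x + h *\<^sub>R e) - g x) / h) \<longlongrightarrow> pderiv_at j g x) (at 0)"
      using line[of x 0] by (simp add: has_field_derivative_iff)
    moreover have "filterlim (\<lambda>k. inverse (real (Suc k))) (at 0) sequentially"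
      by (rule filterlim_atI[OF LIMSEQ_inverse_real_of_nat]) auto
    ultimately show ?thesis
      by (drule_tac filterlim_compose) (auto simp: q_def field_simps add.commute)
  qed
  have qb: "norm (q k x) \<le> indicator (cball p (r + 1)) x *\<^sub>R B" for k x
  proof (cases "x \<in> cball p (r + 1)")
    case True
    define h where "h = inverse (real (Suc k))"
    have h: "h > 0" by (simp add: h_def)
    obtain z where "g (x + h *\<^sub>R e) - g (x + 0 *\<^sub>R e) = (h - 0) * pderiv_at j g (x + z *\<^sub>R e)"
      using MVT2[OF h, of "\<lambda>s. g (x + s *\<^sub>R e)" "\<lambda>t. pderiv_at j g (x + t *\<^sub>R e)"] line by blast
    then have "q k x = pderiv_at j g (x + z *\<^sub>R e)"
      using h by (simp add: q_def h_def add.commute)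
    with bound True show ?thesis by simp
  next
    case False
    then have far: "dist p x > r + 1" by simp
    then have "x \<notin> cball p r" by auto
    moreover have "inverse (real (Suc k)) *\<^sub>R e + x \<notin> cball p r"
    proof
      assume "inverse (real (Suc k)) *\<^sub>R e + x \<in> cball p r"
      then have "dist p (inverse (real (Suc k)) *\<^sub>R e + x) \<le> r" by simp
      moreover have "dist (inverse (real (Suc k)) *\<^sub>R e + x) x \<le> 1"
        using e by (simp add: dist_norm field_simps)
      ultimately show False
        using far dist_triangle[of p x "inverse (real (Suc k)) *\<^sub>R e + x"] by linarith
    qed
    ultimately show ?thesis
      using False by (simp add: q_def supp)
  qed
  have "(\<lambda>k. LINT x|lborel. q k x) \<longlonglongrightarrow> (LINT x|lborel. pderiv_at j g x)"
  proof (rule integral_dominated_convergence)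
    \<comment> \<open>Continuity of the derivative is not among the assumptions; it is measurable as
      a pointwise limit of difference quotients.\<close>
    show "pderiv_at j g \<in> borel_measurable lborel"
      by (rule borel_measurable_LIMSEQ_metric[where f = q]) (unfold q_def, measurable, rule lim[unfolded q_def])
    show "integrable lborel (\<lambda>x. indicator (cball p (r + 1)) x *\<^sub>R B)"
      by (rule borel_integrable_compact) auto
    show "q k \<in> borel_measurable lborel" for k
      unfolding q_def by measurable
  qed (use lim qb in auto)
  then show ?thesis
    by (simp add: q0 LIMSEQ_const_iff)
qed

text \<open>Since \<open>g\<close> is controlled only on \<open>N\<close>, it is extended by zero to
  \<open>G\<close>. On \<open>N\<close> it vanishes off the open ball, so \<open>G\<close> agrees
  with \<open>g\<close> on all of \<open>N\<close>, a neighbourhood of the closed ball; hence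
  \<open>G\<close> is differentiable across the sphere too.\<close>

lemma integral_pderiv_at_eq_0_cball:
  fixes g :: "real^'d::finite \<Rightarrow> real"
  assumes N: "open N" "cball p r \<subseteq> N" and g: "C1_on N g"
    and supp: "\<And>x. x \<in> N \<Longrightarrow> x \<notin> ball p r \<Longrightarrow> g x = 0"
  shows "(LINT x:cball p r|lborel. pderiv_at j g x) = 0"
proof -
  define G where "G x = (if x \<in> cball p r then g x else 0)" for x
  have GN: "G x = g x" if "x \<in> N" for x
    using supp[OF that] by (auto simp: G_def)
  have out: "open (- cball p r)" by auto
  have D: "G differentiable (at x) \<and> pderiv_at i G x = (if x \<in> cball p r then pderiv_at i g x else 0)" for i x
  proof (cases "x \<in> cball p r")
    case True
    then have x: "x \<in> N" using N by auto
    have "(G has_derivative D) (at x)" if "(g has_derivative D) (at x)" for D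
      using has_derivative_transform_within_open[OF that N(1) x] GN by auto
    with C1_on_differentiable[OF g x] have "G differentiable (at x)"
      unfolding differentiable_def by blast
    with pderiv_at_transform_open[OF N(1) x, of G g] GN True show ?thesis by auto
  next
    case False
    have "(G has_derivative (\<lambda>_. 0)) (at x)"
      using has_derivative_transform_within_open[OF has_derivative_const out, of x 0 G] False
      by (auto simp: G_def)
    from pderiv_at_eq[OF this] this False show ?thesis
      unfolding differentiable_def by auto
  qed
  obtain B where "\<forall>x\<in>cball p r. \<bar>pderiv_at j g x\<bar> \<le> B"
    using continuous_on_compact_abs_bound[OF compact_cball
        continuous_on_subset[OF C1_on_pderiv_continuous[OF g] N(2)]] by blast
  then have "\<bar>pderiv_at j G x\<bar> \<le> \<bar>B\<bar>" for x
    using D[of x j] by (cases "x \<in> cball p r") force+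
  then have "(LINT x|lborel. pderiv_at j G x) = 0"
    using D by (intro integral_pderiv_at_eq_0[of G j "\<bar>B\<bar>" p r]) (auto simp: G_def)
  moreover have "pderiv_at j G = (\<lambda>x. indicator (cball p r) x *\<^sub>R pderiv_at j g x)"
    using D by (auto simp: fun_eq_iff)
  ultimately show ?thesis
    by (simp add: set_lebesgue_integral_def)
qed

section \<open>C^1 bumps and boundary cutoffs\<close>

lemma has_real_derivative_max0_power2:
  "((\<lambda>t::real. (max 0 t)\<^sup>2) has_real_derivative 2 * max 0 t) (at t)"
proof -
  consider "t > 0" | "t < 0" | "t = 0" by linarith
  then show ?thesis
  proof cases
    case 1
    have "((\<lambda>t. t\<^sup>2) has_real_derivative 2 * max 0 t) (at t)"
      using 1 by (auto intro!: derivative_eq_intros)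
    then show ?thesis
      by (rule has_field_derivative_transform_within_open[of _ _ _ "{0<..}"]) (use 1 in auto)
  next
    case 2
    have "((\<lambda>t. 0) has_real_derivative 2 * max 0 t) (at t)"
      using 2 by (auto intro!: derivative_eq_intros)
    then show ?thesis
      by (rule has_field_derivative_transform_within_open[of _ _ _ "{..<0}"]) (use 2 in auto)
  next
    case 3
    \<comment> \<open>At the kink the quotient is at most \<open>\<bar>h\<bar>\<close> in modulus:
      squaring makes the positive part differentiable there.\<close>
    have "((\<lambda>h::real. (max 0 h)\<^sup>2 / h) \<longlongrightarrow> 0) (at 0)"
      by (rule Lim_null_comparison[where g = abs])
        (auto simp: max_def power2_eq_square intro!: tendsto_rabs_zero always_eventually)
    then show ?thesis
      by (simp add: 3 has_field_derivative_iff)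
  qed
qed

lemma C1_on_max0_power2:
  assumes "C1_on U u" shows "C1_on U (\<lambda>x. (max 0 (u x))\<^sup>2 :: real)"
  by (rule C1_on_chain_real[OF assms has_real_derivative_max0_power2])
    (intro continuous_intros)

text \<open>A C^1 bump made of a quadratic polynomial. For \<open>r > 0\<close> it is positive
  exactly on the open ball, which later allows division by the sum of the bumps of a cover.\<close>

definition bump :: "real^'d::finite \<Rightarrow> real \<Rightarrow> real^'d \<Rightarrow> real" where
  "bump p r x = (max 0 (r\<^sup>2 - (x - p) \<bullet> (x - p)))\<^sup>2"

lemma C1_on_ident: "C1_on U (\<lambda>x::real^'d::finite. x)"
  by (rule C1_onI[where g = "\<lambda>j _. axis j 1"]) (auto simp: pderiv_at_eq[OF has_derivative_ident])

lemma C1_on_bump: "C1_on U (bump p r)"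
proof -
  have *: "C1_on U (\<lambda>x::real^'a. x - p)"
    by (rule C1_on_diff[OF C1_on_ident C1_on_const])
  show ?thesis
    unfolding bump_def[abs_def]
    by (rule C1_on_max0_power2[OF C1_on_diff[OF C1_on_const
            C1_on_bounded_bilinear[OF bounded_bilinear_inner * *]]])
qed

lemma bump_nonneg: "0 \<le> bump p r x"
  by (simp add: bump_def)

lemma bump_eq_0: "x \<notin> ball p r \<Longrightarrow> 0 < r \<Longrightarrow> bump p r x = 0"
  by (simp add: bump_def dist_norm norm_minus_commute power2_norm_eq_inner[symmetric])

lemma bump_pos: "x \<in> ball p r \<Longrightarrow> 0 < bump p r x"
proof -
  assume "x \<in> ball p r"
  then have "norm (x - p) < r" by (simp add: dist_norm norm_minus_commute)
  from power_strict_mono[OF this norm_ge_zero, of 2] show "0 < bump p r x"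
    by (simp add: bump_def power2_norm_eq_inner[symmetric])
qed

text \<open>With \<theta>(t) = t^2 / (1 + t^2) for t < 0 and \<theta>(t) = 0 for t >= 0, this is
  \<theta>(k s). The rational profile is chosen because \<open>s\<close> times its derivative can be
  expressed through \<open>cutoff\<close> itself.\<close>

definition cutoff :: "real \<Rightarrow> real \<Rightarrow> real" where
  "cutoff k s = 1 - inverse (1 + k\<^sup>2 * (max 0 (- s))\<^sup>2)"

definition cutoff' :: "real \<Rightarrow> real \<Rightarrow> real" where
  "cutoff' k s = - 2 * k\<^sup>2 * max 0 (- s) / (1 + k\<^sup>2 * (max 0 (- s))\<^sup>2)\<^sup>2"

lemma cutoff_nonneg_eq: "0 \<le> s \<Longrightarrow> cutoff k s = 0" "0 \<le> s \<Longrightarrow> cutoff' k s = 0"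
  by (simp_all add: cutoff_def cutoff'_def)

lemma cutoff_denom_pos: "0 < 1 + k\<^sup>2 * (max 0 (- s))\<^sup>2" for k s :: real
  by (simp add: add_pos_nonneg)

lemma cutoff_bounds: "0 \<le> cutoff k s" "cutoff k s \<le> 1"
  using cutoff_denom_pos[of k s] by (simp_all add: cutoff_def field_simps)

lemma has_real_derivative_cutoff: "(cutoff k has_real_derivative cutoff' k s) (at s)"
proof -
  have "((\<lambda>s. (max 0 (- s))\<^sup>2) has_real_derivative 2 * max 0 (- s) * (- 1)) (at s)"
    by (rule DERIV_chain2[OF has_real_derivative_max0_power2]) (auto intro!: derivative_eq_intros)
  then have "(cutoff k has_real_derivative
      0 - - (inverse (1 + k\<^sup>2 * (max 0 (- s))\<^sup>2) * (0 + k\<^sup>2 * (2 * max 0 (- s) * - 1))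
        * inverse (1 + k\<^sup>2 * (max 0 (- s))\<^sup>2))) (at s)"
    unfolding cutoff_def[abs_def] using cutoff_denom_pos[of k s]
    by (intro DERIV_diff DERIV_const DERIV_inverse' DERIV_add DERIV_cmult) auto
  then show ?thesis
    by (rule DERIV_cong) (simp add: cutoff'_def power2_eq_square divide_inverse)
qed

lemma continuous_on_cutoff': "continuous_on A (cutoff' k)"
proof -
  have "(1 + k\<^sup>2 * (max 0 (- s))\<^sup>2)\<^sup>2 \<noteq> 0" for s :: real
    using cutoff_denom_pos[of k s] by simp
  then show ?thesis
    unfolding cutoff'_def[abs_def] by (auto intro!: continuous_intros)
qed

text \<open>The scale-invariant quantity t \<theta>'(t) equals 2 \<theta>(t) (1 - \<theta>(t)), here
  at t = k s. So it is bounded independently of \<open>k\<close>, and for fixed \<open>s < 0\<close>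
  it tends to 0 as \<theta>(k s) tends to 1.\<close>

lemma cutoff'_eq:
  assumes "s < 0"
  shows "cutoff' k s * s = 2 * (cutoff k s * (1 - cutoff k s))"
proof -
  have "1 + k\<^sup>2 * s\<^sup>2 > 0" using cutoff_denom_pos[of k s] assms by simp
  then show ?thesis
    using assms by (simp add: cutoff_def cutoff'_def divide_simps power2_eq_square)
qed

lemma cutoff'_bound: "\<bar>cutoff' k s\<bar> * \<bar>s\<bar> \<le> 2"
proof (cases "s < 0")
  case True
  have "\<bar>cutoff' k s\<bar> * \<bar>s\<bar> = 2 * (cutoff k s * (1 - cutoff k s))"
    using cutoff_bounds[of k s] by (simp add: abs_mult[symmetric] cutoff'_eq[OF True])
  also have "\<dots> \<le> 2 * (1 * 1)"
    using cutoff_bounds[of k s] by (intro mult_left_mono mult_mono) auto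
  finally show ?thesis by simp
qed (simp add: cutoff_nonneg_eq)

lemma cutoff_tendsto:
  assumes "s < 0"
  shows "(\<lambda>k. cutoff (real k) s) \<longlonglongrightarrow> 1" "(\<lambda>k. cutoff' (real k) s) \<longlonglongrightarrow> 0"
proof -
  have "filterlim (\<lambda>k. s\<^sup>2 * (real k)\<^sup>2) at_top sequentially"
    using assms by (intro filterlim_tendsto_pos_mult_at_top[OF tendsto_const]
        filterlim_pow_at_top filterlim_real_sequentially) auto
  then have "filterlim (\<lambda>k. 1 + (real k)\<^sup>2 * (max 0 (- s))\<^sup>2) at_top sequentially"
    using assms by (intro filterlim_tendsto_add_at_top[OF tendsto_const]) (simp add: mult.commute)
  then have "(\<lambda>k. inverse (1 + (real k)\<^sup>2 * (max 0 (- s))\<^sup>2)) \<longlonglongrightarrow> 0"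
    by (rule tendsto_inverse_0_at_top)
  then show 1: "(\<lambda>k. cutoff (real k) s) \<longlonglongrightarrow> 1"
    unfolding cutoff_def using tendsto_diff[OF tendsto_const] by force
  have "(\<lambda>k. 2 * (cutoff (real k) s * (1 - cutoff (real k) s)) / s) \<longlonglongrightarrow> 2 * (1 * (1 - 1)) / s"
    using assms by (intro tendsto_intros 1) auto
  then show "(\<lambda>k. cutoff' (real k) s) \<longlonglongrightarrow> 0"
    using assms by (simp add: cutoff'_eq[OF assms, symmetric])
qed

text \<open>The hypothesis \<open>bound\<close> is tangency in quantitative form. It trades the
  derivative of the cutoff, which is of order \<open>k\<close>, for the scale-invariant product
  \<open>cutoff' k s * s\<close>, bounded by 2; this is where the dominating constant
  \<open>B + 2 * (B' * \<bar>C\<bar>)\<close> comes from.\<close>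

lemma integral_divergence_bump_eq_0:
  fixes W :: "real^'d::finite \<Rightarrow> real^'d"
  assumes N: "open N" "cball p r \<subseteq> N" and r: "0 < r"
    and W: "\<And>j. C1_on N (\<lambda>x. W x $ j)" and \<rho>: "C1_on N \<rho>"
    and \<Omega>: "\<Omega> \<inter> N = {x \<in> N. \<rho> x < 0}"
    and bound: "\<And>x. x \<in> cball p r \<inter> \<Omega> \<Longrightarrow> \<bar>grad \<rho> x \<bullet> W x\<bar> \<le> C * \<bar>\<rho> x\<bar>"
  shows "(LINT x:\<Omega>|lborel. divergence (\<lambda>y. bump p r y *\<^sub>R W y) x) = 0"
proof -
  define Y where "Y j y = bump p r y * W y $ j" for j y
  define D where "D x = (\<Sum>j\<in>UNIV. pderiv_at j (Y j) x)" for x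
  define P where "P k x = (\<Sum>j\<in>UNIV. pderiv_at j (\<lambda>y. cutoff (real k) (\<rho> y) * Y j y) x)" for k x
  let ?I = "indicator (cball p r) :: real^'d \<Rightarrow> real"
  have Y: "C1_on N (Y j)" for j
    unfolding Y_def by (intro C1_on_mult C1_on_bump W)
  have cut: "C1_on N (\<lambda>y. cutoff (real k) (\<rho> y))" for k
    by (rule C1_on_chain_real[OF \<rho> has_real_derivative_cutoff continuous_on_cutoff'])
  have cutY: "C1_on N (\<lambda>y. cutoff (real k) (\<rho> y) * Y j y)" for j k
    by (intro C1_on_mult cut Y)
  have int: "integrable lborel (\<lambda>x. ?I x *\<^sub>R pderiv_at j g x)" if "C1_on N g" for j and g :: "_ \<Rightarrow> real"
    by (rule borel_integrable_compact) (use continuous_on_subset[OF C1_on_pderiv_continuous[OF that] N(2)] in auto)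
  have P0: "(LINT x|lborel. ?I x *\<^sub>R P k x) = 0" for k
  proof -
    have "(LINT x|lborel. ?I x *\<^sub>R pderiv_at j (\<lambda>y. cutoff (real k) (\<rho> y) * Y j y) x) = 0" for j
      unfolding set_lebesgue_integral_def[symmetric]
      by (rule integral_pderiv_at_eq_0_cball[OF N cutY]) (simp add: Y_def bump_eq_0 r)
    then show ?thesis
      unfolding P_def scaleR_sum_right by (subst Bochner_Integration.integral_sum[OF int[OF cutY]]) simp
  qed
  have Pint: "integrable lborel (\<lambda>x. ?I x *\<^sub>R P k x)" for k
    unfolding P_def scaleR_sum_right by (intro Bochner_Integration.integrable_sum int[OF cutY])
  have P: "P k x = cutoff (real k) (\<rho> x) * D x + cutoff' (real k) (\<rho> x) * (bump p r x * (grad \<rho> x \<bullet> W x))"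
    if x: "x \<in> N" for k x
  proof -
    have "pderiv_at j (\<lambda>y. cutoff (real k) (\<rho> y) * Y j y) x
        = cutoff (real k) (\<rho> x) * pderiv_at j (Y j) x
          + cutoff' (real k) (\<rho> x) * pderiv_at j \<rho> x * Y j x" for j
      by (subst pderiv_at_mult)
        (use C1_on_differentiable[OF cut x] C1_on_differentiable[OF Y x] in
          \<open>simp_all add: pderiv_at_chain_real[OF has_real_derivative_cutoff C1_on_differentiable[OF \<rho> x]]\<close>)
    then show ?thesis
      unfolding P_def D_def
      by (simp add: sum.distrib sum_distrib_left inner_vec_def Y_def mult_ac)
  qed
  have cont: "continuous_on N D"
    unfolding D_def by (intro continuous_on_sum C1_on_pderiv_continuous Y)
  obtain B where B: "\<And>x. x \<in> cball p r \<Longrightarrow> \<bar>D x\<bar> \<le> B"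
    using continuous_on_compact_abs_bound[OF compact_cball continuous_on_subset[OF cont N(2)]] by blast
  obtain B' where B': "\<And>x. x \<in> cball p r \<Longrightarrow> \<bar>bump p r x\<bar> \<le> B'"
    using continuous_on_compact_abs_bound[OF compact_cball C1_on_continuous[OF C1_on_bump]] by blast
  have "(\<lambda>k. LINT x|lborel. ?I x *\<^sub>R P k x) \<longlonglongrightarrow> (LINT x|lborel. indicator (cball p r \<inter> \<Omega>) x *\<^sub>R D x)"
  proof (rule integral_dominated_convergence)
    have lim: "(\<lambda>k. ?I x *\<^sub>R P k x) \<longlonglongrightarrow> indicator (cball p r \<inter> \<Omega>) x *\<^sub>R D x" for x
    proof (cases "x \<in> cball p r")
      case True
      then have x: "x \<in> N" using N by auto
      show ?thesis
      proof (cases "x \<in> \<Omega>")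
        case in\<Omega>: True
        then have "\<rho> x < 0" using \<Omega> x by auto
        from cutoff_tendsto[OF this]
        have "(\<lambda>k. P k x) \<longlonglongrightarrow> 1 * D x + 0 * (bump p r x * (grad \<rho> x \<bullet> W x))"
          unfolding P[OF x] by (intro tendsto_intros)
        with True in\<Omega> show ?thesis by simp
      next
        case False
        \<comment> \<open>Off \<Omega>, frontier included, the cutoff and its derivative are exactly
          zero. Convergence therefore holds at every point, and the frontier does not have to be
          shown to be a null set.\<close>
        then have "0 \<le> \<rho> x" using \<Omega> x by force
        then show ?thesis using P[OF x] cutoff_nonneg_eq False by simp
      qed
    qed simp
    show "(\<lambda>x. indicator (cball p r \<inter> \<Omega>) x *\<^sub>R D x) \<in> borel_measurable lborel"
      by (rule borel_measurable_LIMSEQ_metric[OF _ lim]) (rule borel_measurable_integrable[OF Pint])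
    show "AE x in lborel. (\<lambda>k. ?I x *\<^sub>R P k x) \<longlonglongrightarrow> indicator (cball p r \<inter> \<Omega>) x *\<^sub>R D x"
      using lim by simp
    show "(\<lambda>x. ?I x *\<^sub>R P k x) \<in> borel_measurable lborel" for k
      by (rule borel_measurable_integrable[OF Pint])
    show "integrable lborel (\<lambda>x. ?I x *\<^sub>R (B + 2 * (B' * \<bar>C\<bar>)))"
      by (rule borel_integrable_compact) auto
    have "\<bar>P k x\<bar> \<le> B + 2 * (B' * \<bar>C\<bar>)" if x: "x \<in> cball p r" for k x
    proof -
      have B0: "0 \<le> B" "0 \<le> B'"
        using order_trans[OF abs_ge_zero B[OF x]] order_trans[OF abs_ge_zero B'[OF x]] by auto
      have "\<bar>cutoff (real k) (\<rho> x) * D x\<bar> \<le> 1 * B"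
        unfolding abs_mult using cutoff_bounds[of "real k" "\<rho> x"] B[OF x] by (intro mult_mono) auto
      moreover have "\<bar>cutoff' (real k) (\<rho> x) * (bump p r x * (grad \<rho> x \<bullet> W x))\<bar> \<le> 2 * (B' * \<bar>C\<bar>)"
      proof (cases "x \<in> \<Omega>")
        case True
        have "\<bar>bump p r x\<bar> * \<bar>grad \<rho> x \<bullet> W x\<bar> \<le> B' * (\<bar>C\<bar> * \<bar>\<rho> x\<bar>)"
        proof (rule mult_mono[OF B'[OF x]])
          show "\<bar>grad \<rho> x \<bullet> W x\<bar> \<le> \<bar>C\<bar> * \<bar>\<rho> x\<bar>"
            using order_trans[OF bound[of x] mult_right_mono[OF abs_ge_self abs_ge_zero]] x True by blast
        qed (use B0 in auto)
        then have "\<bar>cutoff' (real k) (\<rho> x)\<bar> * (\<bar>bump p r x\<bar> * \<bar>grad \<rho> x \<bullet> W x\<bar>)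
            \<le> \<bar>cutoff' (real k) (\<rho> x)\<bar> * (B' * (\<bar>C\<bar> * \<bar>\<rho> x\<bar>))"
          by (rule mult_left_mono) simp
        also have "\<dots> = (\<bar>cutoff' (real k) (\<rho> x)\<bar> * \<bar>\<rho> x\<bar>) * (B' * \<bar>C\<bar>)"
          by simp
        also have "\<dots> \<le> 2 * (B' * \<bar>C\<bar>)"
          by (rule mult_right_mono[OF cutoff'_bound]) (use B0 in auto)
        finally show ?thesis by (simp add: abs_mult)
      next
        case False
        then have "0 \<le> \<rho> x" using \<Omega> x N by force
        with B0 show ?thesis by (simp add: cutoff_nonneg_eq)
      qed
      ultimately show ?thesis
        unfolding P[OF subsetD[OF N(2) x]] by linarith
    qed
    then show "AE x in lborel. norm (?I x *\<^sub>R P k x) \<le> ?I x *\<^sub>R (B + 2 * (B' * \<bar>C\<bar>))" for k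
      by (auto simp: indicator_def)
  qed
  then have "(LINT x|lborel. indicator (cball p r \<inter> \<Omega>) x *\<^sub>R D x) = 0"
    unfolding P0 LIMSEQ_const_iff by simp
  moreover have "indicator (cball p r \<inter> \<Omega>) x *\<^sub>R D x = indicator \<Omega> x *\<^sub>R divergence (\<lambda>y. bump p r y *\<^sub>R W y) x" for x
  proof -
    have "D x = 0" if "x \<notin> cball p r"
    proof -
      have "pderiv_at j (Y j) x = pderiv_at j (\<lambda>_. 0) x" for j
        by (rule pderiv_at_transform_open[of "- cball p r"])
          (use that r in \<open>auto simp: Y_def bump_eq_0\<close>)
      then show ?thesis by (simp add: D_def)
    qed
    moreover have "D x = divergence (\<lambda>y. bump p r y *\<^sub>R W y) x"
      by (simp add: D_def Y_def[abs_def] divergence_def)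
    ultimately show ?thesis
      by (cases "x \<in> cball p r") (simp_all add: indicator_def)
  qed
  ultimately show ?thesis
    by (simp add: set_lebesgue_integral_def)
qed

section \<open>Defining functions, the boundary and its normal\<close>

lemma eventually_at_right_line_mem:
  fixes U :: "'a::real_normed_vector set"
  assumes "open U" "p \<in> U"
  shows "\<forall>\<^sub>F t in at_right 0. p + t *\<^sub>R v \<in> U"
proof (rule topological_tendstoD[OF _ assms(1)])
  show "((\<lambda>t. p + t *\<^sub>R v) \<longlongrightarrow> p) (at_right 0)"
    by (auto intro!: tendsto_eq_intros)
qed (rule assms)

lemma eventually_at_right_line_pos:
  fixes f :: "real^'d::finite \<Rightarrow> real"
  assumes "f differentiable (at p)" "f p = 0" "0 < grad f p \<bullet> v"
  shows "\<forall>\<^sub>F t in at_right 0. 0 < f (p + t *\<^sub>R v)"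
proof -
  have "((\<lambda>s. f (p + s *\<^sub>R v)) has_real_derivative (grad f p \<bullet> v)) (at 0)"
    using has_real_derivative_along_line[of f p 0 v] assms(1) by simp
  from DERIV_pos_inc_right[OF this assms(3)] assms(2) show ?thesis
    by (auto simp: eventually_at_right_field)
qed

lemma grad_uminus:
  fixes f :: "real^'d::finite \<Rightarrow> real"
  assumes "f differentiable (at p)"
  shows "grad (\<lambda>x. - f x) p = - grad f p"
  using pderiv_at_bounded_linear[OF bounded_linear_minus[OF bounded_linear_ident] assms]
  by (simp add: vec_eq_iff)

lemma open_vimage_greaterThan:
  fixes f :: "'a::topological_space \<Rightarrow> real"
  assumes "open U" "continuous_on U f"
  shows "open (f -` {c<..} \<inter> U)"
  using assms(2) unfolding continuous_on_open_vimage[OF assms(1)] by simp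

lemma local_defining_function_differentiable:
  "local_defining_function \<Omega> p U \<rho> \<Longrightarrow> x \<in> U \<Longrightarrow> \<rho> differentiable (at x)"
  by (auto simp: local_defining_function_def intro: C1_on_differentiable smooth_on_C1_on)

text \<open>The definition describes only the set where \<rho> is negative. That the zero set is the
  boundary comes from the nonvanishing gradient: from a zero of \<rho> the direction
  \<open>- grad \<rho> q\<close> enters \<Omega> at once. Conversely, points with \<rho> > 0 have a
  neighbourhood that misses \<Omega>.\<close>

lemma local_defining_function_eq_0_iff_frontier:
  fixes \<rho> :: "real^'d::finite \<Rightarrow> real"
  assumes "local_defining_function \<Omega> p U \<rho>" "open \<Omega>" and q: "q \<in> U"
  shows "\<rho> q = 0 \<longleftrightarrow> q \<in> frontier \<Omega>"
proof
  have U: "open U" and nz: "grad \<rho> q \<noteq> 0" and \<Omega>: "\<Omega> \<inter> U = {x \<in> U. \<rho> x < 0}"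
    using assms by (auto simp: local_defining_function_def)
  note diff = local_defining_function_differentiable[OF assms(1) q]
  {
    assume 0: "\<rho> q = 0"
    have "\<forall>\<^sub>F t in at_right 0. 0 < - \<rho> (q + t *\<^sub>R (- grad \<rho> q))"
      by (rule eventually_at_right_line_pos)
        (use diff nz 0 in \<open>auto simp: grad_uminus intro: differentiable_minus\<close>)
    then have "\<forall>\<^sub>F t in at_right 0. q + t *\<^sub>R (- grad \<rho> q) \<in> closure \<Omega>"
      using eventually_at_right_line_mem[OF U q, of "- grad \<rho> q"]
    proof eventually_elim
      case (elim t)
      then have "q + t *\<^sub>R (- grad \<rho> q) \<in> \<Omega> \<inter> U" unfolding \<Omega> by simp
      then show ?case using closure_subset by blast
    qed
    moreover have "((\<lambda>t. q + t *\<^sub>R (- grad \<rho> q)) \<longlongrightarrow> q) (at_right 0)"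
      by (auto intro!: tendsto_eq_intros)
    ultimately have "q \<in> closure \<Omega>"
      by (rule Lim_in_closed_set[OF closed_closure _ trivial_limit_at_right_real])
    moreover have "q \<notin> \<Omega>" using \<Omega> q 0 by force
    ultimately show "q \<in> frontier \<Omega>"
      using \<open>open \<Omega>\<close> by (simp add: frontier_def interior_open)
  }
  {
    assume q': "q \<in> frontier \<Omega>"
    then have "q \<notin> \<Omega>" "q \<in> closure \<Omega>"
      using \<open>open \<Omega>\<close> by (simp_all add: frontier_def interior_open)
    have cont: "continuous_on U \<rho>"
      using assms(1) by (auto simp: local_defining_function_def intro: C1_on_continuous smooth_on_C1_on)
    have "open (\<rho> -` {0<..} \<inter> U)"
      by (rule open_vimage_greaterThan[OF U cont])
    moreover have "(\<rho> -` {0<..} \<inter> U) \<inter> \<Omega> = {}"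
      using \<Omega> by force
    ultimately have "q \<notin> \<rho> -` {0<..} \<inter> U"
      using \<open>q \<in> closure \<Omega>\<close> open_Int_closure_eq_empty by blast
    moreover have "\<not> \<rho> q < 0"
      using \<open>q \<notin> \<Omega>\<close> q \<Omega> by blast
    ultimately show "\<rho> q = 0"
      using q by auto
  }
qed

text \<open>Two local defining functions have parallel gradients: a direction that strictly enters \<open>\<Omega>\<close>
  according to one of them cannot strictly leave it according to the other.\<close>

lemma local_defining_function_same_tangent_space:
  fixes \<rho> \<rho>' :: "real^'d::finite \<Rightarrow> real"
  assumes \<rho>: "local_defining_function \<Omega> p U \<rho>" and \<rho>': "local_defining_function \<Omega> p U' \<rho>'"
    and \<Omega>: "open \<Omega>" and p: "p \<in> frontier \<Omega>" and w: "grad \<rho>' p \<bullet> w = 0"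
  shows "grad \<rho> p \<bullet> w = 0"
proof -
  let ?a = "grad \<rho> p" and ?a' = "grad \<rho>' p"
  have U: "open U" "p \<in> U" "open U'" "p \<in> U'" and nz: "?a' \<noteq> 0"
    and eq: "\<Omega> \<inter> U = {x \<in> U. \<rho> x < 0}" "\<Omega> \<inter> U' = {x \<in> U'. \<rho>' x < 0}"
    using \<rho> \<rho>' by (auto simp: local_defining_function_def)
  have 0: "\<rho> p = 0" "\<rho>' p = 0"
    using local_defining_function_eq_0_iff_frontier \<rho> \<rho>' \<Omega> p U by blast+
  note diff = local_defining_function_differentiable[OF \<rho> U(2)]
    local_defining_function_differentiable[OF \<rho>' U(4)]
  have le: "?a \<bullet> v \<le> 0" if v: "?a' \<bullet> v < 0" for v
  proof (rule ccontr)
    assume "\<not> ?a \<bullet> v \<le> 0"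
    then have "\<forall>\<^sub>F t in at_right 0. 0 < \<rho> (p + t *\<^sub>R v)"
      using diff 0 by (intro eventually_at_right_line_pos) auto
    moreover have "\<forall>\<^sub>F t in at_right 0. 0 < - \<rho>' (p + t *\<^sub>R v)"
      by (rule eventually_at_right_line_pos)
        (use diff 0 v in \<open>auto simp: grad_uminus intro: differentiable_minus\<close>)
    ultimately have "\<forall>\<^sub>F t in at_right (0::real). False"
      using eventually_at_right_line_mem[OF U(1,2), of v] eventually_at_right_line_mem[OF U(3,4), of v]
    proof eventually_elim
      case (elim t)
      then have "p + t *\<^sub>R v \<in> \<Omega>" using eq(2) by auto
      with elim eq(1) show False by force
    qed
    then show False
      by (simp add: trivial_limit_at_right_real)
  qed
  \<comment> \<open>A tangential \<open>u\<close> is the limit of the strictly inward directions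
    \<open>u - s *\<^sub>R ?a'\<close>. The value of \<open>s\<close> keeps the error
    \<open>s * (?a \<bullet> ?a')\<close> below \<open>e\<close>. Using this for \<open>w\<close>
    and \<open>- w\<close> turns the inequality into an equality.\<close>
  have half: "?a \<bullet> u \<le> 0" if u: "?a' \<bullet> u = 0" for u
  proof (rule field_le_epsilon)
    fix e :: real assume e: "e > 0"
    define s where "s = e / (\<bar>?a \<bullet> ?a'\<bar> + 1)"
    have s: "s > 0" using e by (simp add: s_def)
    have "?a' \<bullet> (u - s *\<^sub>R ?a') < 0"
      using s u nz by (simp add: inner_diff_right)
    from le[OF this] have "?a \<bullet> u \<le> s * (?a \<bullet> ?a')"
      by (simp add: inner_diff_right)
    also have "\<dots> \<le> s * (\<bar>?a \<bullet> ?a'\<bar> + 1)"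
      using s by (intro mult_left_mono) auto
    also have "\<dots> = 0 + e" by (simp add: s_def)
    finally show "?a \<bullet> u \<le> 0 + e" .
  qed
  show ?thesis
    using half[of w] half[of "- w"] w by simp
qed

text \<open>The normal is picked by \<open>SOME\<close> and may stem from a defining function other
  than \<rho>; since all of these share one tangent space, the choice does not affect
  orthogonality.\<close>

lemma grad_orthogonal_if_tangential:
  fixes \<rho> :: "real^'d::finite \<Rightarrow> real"
  assumes \<rho>: "local_defining_function \<Omega> p U \<rho>"
    and \<Omega>: "open \<Omega>" and p: "p \<in> frontier \<Omega>" and w: "w \<bullet> outer_normal \<Omega> p = 0"
  shows "grad \<rho> p \<bullet> w = 0"
proof -
  have "\<exists>\<nu> U \<rho>. local_defining_function \<Omega> p U \<rho> \<and> \<nu> = sgn (grad \<rho> p)"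
    using \<rho> by blast
  from someI_ex[OF this] obtain U' \<rho>' where
    \<rho>': "local_defining_function \<Omega> p U' \<rho>'" "outer_normal \<Omega> p = sgn (grad \<rho>' p)"
    unfolding outer_normal_def by blast
  then have "grad \<rho>' p \<noteq> 0" by (auto simp: local_defining_function_def)
  then have "grad \<rho>' p \<bullet> w = 0"
    using w by (simp add: \<rho>'(2) sgn_div_norm inner_commute)
  from local_defining_function_same_tangent_space[OF \<rho> \<rho>'(1) \<Omega> p this] show ?thesis .
qed

text \<open>Moving from an interior point in the direction \<open>grad \<rho> p\<close>, the boundary is reached after a
  distance comparable to \<open>\<bar>\<rho>\<bar>\<close>, and there the Lipschitz function \<open>grad \<rho> \<bullet> W\<close> vanishes.\<close>

lemma tangential_field_bound:
  fixes \<rho> :: "real^'d::finite \<Rightarrow> real"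
  assumes \<rho>: "local_defining_function \<Omega> p U \<rho>" and \<Omega>: "open \<Omega>" and p: "p \<in> frontier \<Omega>"
    and V: "open V" "p \<in> V"
  shows "\<exists>r>0. cball p r \<subseteq> U \<inter> V \<and>
    (\<forall>W. (\<forall>j. C1_on V (\<lambda>x. W x $ j)) \<longrightarrow> (\<forall>x\<in>frontier \<Omega> \<inter> V. W x \<bullet> outer_normal \<Omega> x = 0) \<longrightarrow>
      (\<exists>C. \<forall>x\<in>cball p r \<inter> \<Omega>. \<bar>grad \<rho> x \<bullet> W x\<bar> \<le> C * \<bar>\<rho> x\<bar>))"
proof -
  define N where "N = U \<inter> V"
  define a where "a = grad \<rho> p"
  have U: "open U" "p \<in> U" and sm: "smooth_on U \<rho>" and a: "a \<noteq> 0"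
    and eq: "\<Omega> \<inter> U = {x \<in> U. \<rho> x < 0}"
    using \<rho> by (auto simp: local_defining_function_def a_def)
  have N: "open N" "p \<in> N" using U V by (auto simp: N_def)
  have \<rho>q: "local_defining_function \<Omega> q U \<rho>" if "q \<in> U" for q
    using \<rho> that by (simp add: local_defining_function_def)
  have \<rho>1: "C1_on N \<rho>" and \<rho>2: "C1_on N (pderiv_at j \<rho>)" for j
    using C1_on_subset[OF smooth_on_C1_on[OF sm]] C1_on_subset[OF smooth_on_C1_on[OF smooth_on_pderiv_at[OF sm]]]
    by (auto simp: N_def)
  have \<rho>p: "\<rho> p = 0"
    using local_defining_function_eq_0_iff_frontier[OF \<rho> \<Omega> U(2)] p by blast
  have cont: "continuous_on N (\<lambda>x. grad \<rho> x \<bullet> a)"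
    unfolding inner_vec_def inner_real_def grad_nth
    by (intro continuous_on_sum continuous_on_mult_right C1_on_continuous \<rho>2)
  \<comment> \<open>On a small ball the derivative of \<rho> in the direction \<open>a\<close>
    exceeds half of its value at \<open>p\<close>: a guaranteed rate of increase along
    \<open>a\<close>.\<close>
  have "open ((\<lambda>x. grad \<rho> x \<bullet> a) -` {(norm a)\<^sup>2 / 2 <..} \<inter> N)"
    by (rule open_vimage_greaterThan[OF N(1) cont])
  moreover have "p \<in> (\<lambda>x. grad \<rho> x \<bullet> a) -` {(norm a)\<^sup>2 / 2 <..} \<inter> N"
    using N(2) a by (simp add: a_def[symmetric] power2_norm_eq_inner)
  ultimately obtain r1 where r1: "r1 > 0" "cball p r1 \<subseteq> (\<lambda>x. grad \<rho> x \<bullet> a) -` {(norm a)\<^sup>2 / 2 <..} \<inter> N"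
    using open_contains_cball by blast
  \<comment> \<open>In time \<open>T\<close>, motion with velocity \<open>a\<close> covers the
    distance \<open>r1 / 2\<close>, so a start within \<open>r1 / 2\<close> of \<open>p\<close>
    stays in \<open>cball p r1\<close>. The guaranteed gain of \<rho> in that time is
    \<open>T\<close> times half the square of \<open>norm a\<close>; the radius \<open>r2\<close>
    restricts to starting points whose deficit is smaller.\<close>
  define T where "T = r1 / (2 * norm a)"
  have T: "T > 0" "T * norm a = r1 / 2" using r1 a by (simp_all add: T_def)
  have "open (\<rho> -` {- (T * (norm a)\<^sup>2 / 2) <..} \<inter> N)"
    by (rule open_vimage_greaterThan[OF N(1) C1_on_continuous[OF \<rho>1]])
  moreover have "p \<in> \<rho> -` {- (T * (norm a)\<^sup>2 / 2) <..} \<inter> N"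
    using N(2) \<rho>p T a by simp
  ultimately obtain r2 where r2: "r2 > 0" "cball p r2 \<subseteq> \<rho> -` {- (T * (norm a)\<^sup>2 / 2) <..} \<inter> N"
    using open_contains_cball by blast
  define r where "r = min r2 (r1 / 2)"
  have r: "r > 0" "cball p r \<subseteq> N" using r1 r2 by (auto simp: r_def)
  show ?thesis
  proof (rule exI[of _ r], intro conjI allI impI)
    fix W :: "real^'d \<Rightarrow> real^'d"
    assume W: "\<forall>j. C1_on V (\<lambda>x. W x $ j)" and tan: "\<forall>x\<in>frontier \<Omega> \<inter> V. W x \<bullet> outer_normal \<Omega> x = 0"
    define G where "G x = grad \<rho> x \<bullet> W x" for x
    have "C1_on N (\<lambda>x. W x $ j)" for j
      by (rule C1_on_subset[of V]) (use W in \<open>auto simp: N_def\<close>)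
    then have "C1_on N G"
      unfolding G_def inner_vec_def by (auto intro!: C1_on_sum C1_on_mult \<rho>2)
    moreover have "cball p r1 \<subseteq> N" using r1 by auto
    ultimately obtain K where K: "0 \<le> K" "\<And>x y. x \<in> cball p r1 \<Longrightarrow> y \<in> cball p r1 \<Longrightarrow> \<bar>G x - G y\<bar> \<le> K * norm (x - y)"
      using C1_on_Lipschitz by blast
    have G0: "G x = 0" if "x \<in> N" "\<rho> x = 0" for x
    proof -
      have x: "x \<in> U" "x \<in> V" using that by (auto simp: N_def)
      then have "x \<in> frontier \<Omega>"
        using local_defining_function_eq_0_iff_frontier[OF \<rho> \<Omega>] that by blast
      with grad_orthogonal_if_tangential[OF \<rho>q \<Omega>] tan x show ?thesis
        by (simp add: G_def)
    qed
    have "\<bar>G x\<bar> \<le> (2 * K / norm a) * \<bar>\<rho> x\<bar>" if x: "x \<in> cball p r" "x \<in> \<Omega>" for x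
    proof -
      \<comment> \<open>The time in which the guaranteed rate makes up for the deficit
        \<open>\<bar>\<rho> x\<bar>\<close>. The Lipschitz constant \<open>K\<close> times the
        distance \<open>t0 * norm a\<close> then gives the factor
        \<open>2 * K / norm a\<close>.\<close>
      define t0 where "t0 = 2 * \<bar>\<rho> x\<bar> / (norm a)\<^sup>2"
      have "x \<in> U" using x r by (auto simp: N_def)
      then have neg: "\<rho> x < 0" using x eq by blast
      have "x \<in> cball p r2" using x by (simp add: r_def)
      then have "\<rho> x > - (T * (norm a)\<^sup>2 / 2)" using r2 by blast
      then have t0: "0 < t0" "t0 \<le> T"
        using neg a by (auto simp: t0_def field_simps)
      have path: "x + t *\<^sub>R a \<in> cball p r1" if "0 \<le> t" "t \<le> t0" for t
      proof -
        have "norm (t *\<^sub>R a) \<le> T * norm a"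
          using that t0 by (simp add: mult_right_mono)
        then have "dist x (x + t *\<^sub>R a) \<le> r1 / 2" using T by (simp add: dist_norm)
        moreover have "dist p x \<le> r1 / 2" using x by (simp add: r_def)
        ultimately show ?thesis
          using dist_triangle[of p "x + t *\<^sub>R a" x] by simp
      qed
      have der: "((\<lambda>s. \<rho> (x + s *\<^sub>R a)) has_real_derivative grad \<rho> (x + t *\<^sub>R a) \<bullet> a) (at t)"
        if "0 \<le> t" "t \<le> t0" for t
        by (rule has_real_derivative_along_line, rule C1_on_differentiable[OF \<rho>1])
          (use path[OF that] r1 in blast)
      obtain z where z: "0 < z" "z < t0"
        "\<rho> (x + t0 *\<^sub>R a) - \<rho> (x + 0 *\<^sub>R a) = (t0 - 0) * (grad \<rho> (x + z *\<^sub>R a) \<bullet> a)"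
        using MVT2[OF t0(1), of "\<lambda>s. \<rho> (x + s *\<^sub>R a)" "\<lambda>t. grad \<rho> (x + t *\<^sub>R a) \<bullet> a"] der by blast
      have "(norm a)\<^sup>2 / 2 \<le> grad \<rho> (x + z *\<^sub>R a) \<bullet> a"
        using path[of z] z r1 by fastforce
      then have "t0 * ((norm a)\<^sup>2 / 2) \<le> \<rho> (x + t0 *\<^sub>R a) - \<rho> x"
        using z(3) t0 by (simp add: mult_left_mono)
      moreover have "t0 * ((norm a)\<^sup>2 / 2) = - \<rho> x"
        using a neg by (simp add: t0_def)
      ultimately have "0 \<le> \<rho> (x + t0 *\<^sub>R a)" by linarith
      moreover have "continuous_on {0..t0} (\<lambda>s. \<rho> (x + s *\<^sub>R a))"
        using der by (intro continuous_at_imp_continuous_on ballI DERIV_isCont) auto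
      ultimately obtain t where t: "0 \<le> t" "t \<le> t0" "\<rho> (x + t *\<^sub>R a) = 0"
        using IVT'[of "\<lambda>s. \<rho> (x + s *\<^sub>R a)" 0 0 t0] neg t0 by auto
      have "G (x + t *\<^sub>R a) = 0"
        by (rule G0) (use path[OF t(1,2)] r1 t in auto)
      then have "\<bar>G x\<bar> \<le> K * norm (t *\<^sub>R a)"
        using K(2)[OF path[of 0] path[OF t(1,2)]] t0 by simp
      also have "\<dots> \<le> K * (t0 * norm a)"
        using t K by (intro mult_left_mono) (auto intro: mult_right_mono)
      also have "\<dots> = (2 * K / norm a) * \<bar>\<rho> x\<bar>"
        using a by (simp add: t0_def power2_eq_square)
      finally show ?thesis .
    qed
    then show "\<exists>C. \<forall>x\<in>cball p r \<inter> \<Omega>. \<bar>grad \<rho> x \<bullet> W x\<bar> \<le> C * \<bar>\<rho> x\<bar>"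
      unfolding G_def by blast
  qed (use r in \<open>auto simp: N_def\<close>)
qed

section \<open>From local to global by a partition of unity\<close>

lemma set_integrable_bounded_open:
  fixes f :: "'a::euclidean_space \<Rightarrow> real"
  assumes "open \<Omega>" "bounded \<Omega>" "continuous_on (closure \<Omega>) f"
  shows "set_integrable lborel \<Omega> f"
proof (rule set_integrable_subset[OF _ _ closure_subset])
  show "set_integrable lborel (closure \<Omega>) f"
    unfolding set_integrable_def
    by (rule borel_integrable_compact) (use assms in \<open>auto simp: compact_closure\<close>)
qed (use assms in simp)

lemma continuous_on_divergence:
  assumes "\<And>j. C1_on U (\<lambda>x. V x $ j)" shows "continuous_on U (divergence V)"
  unfolding divergence_def[abs_def] by (intro continuous_on_sum C1_on_pderiv_continuous assms)

text \<open>The radius is quantified before the field. This order is essential: the partition of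
  unity is built from the radii, and the fields it is applied to are divided by the resulting sum of
  bumps, hence known only afterwards.\<close>

lemma local_divergence_eq_0:
  fixes \<Omega> :: "(real^'d::finite) set"
  assumes \<Omega>: "smooth_bounded_domain \<Omega>" and U: "open U" "closure \<Omega> \<subseteq> U" and p: "p \<in> closure \<Omega>"
  shows "\<exists>r>0. \<forall>W. (\<forall>j. C1_on U (\<lambda>x. W x $ j)) \<longrightarrow> (\<forall>x\<in>frontier \<Omega>. W x \<bullet> outer_normal \<Omega> x = 0) \<longrightarrow>
    (LINT x:\<Omega>|lborel. divergence (\<lambda>y. bump p r y *\<^sub>R W y) x) = 0"
proof -
  have op: "open \<Omega>" using \<Omega> by (simp add: smooth_bounded_domain_def)
  show ?thesis
  proof (cases "p \<in> \<Omega>")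
    case True
    then obtain r where r: "r > 0" "cball p r \<subseteq> \<Omega>"
      using op open_contains_cball by blast
    \<comment> \<open>A ball inside \<Omega> is treated with the constant function \<open>-1\<close>
      in place of \<rho>; its gradient vanishes, so the tangency bound holds with
      \<open>C = 0\<close>.\<close>
    have g: "grad (\<lambda>_. - 1 :: real) x = 0" for x :: "real^'d"
      by (simp add: vec_eq_iff)
    have "(LINT x:\<Omega>|lborel. divergence (\<lambda>y. bump p r y *\<^sub>R W y) x) = 0"
      if "\<forall>j. C1_on U (\<lambda>x. W x $ j)" for W
      by (rule integral_divergence_bump_eq_0[OF op r(2,1), where \<rho> = "\<lambda>_. -1" and C = 0])
        (use C1_on_subset[OF that[rule_format] order_trans[OF closure_subset U(2)]] in \<open>auto simp: g\<close>)
    with r show ?thesis by blast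
  next
    case False
    then have fr: "p \<in> frontier \<Omega>" using p op by (simp add: frontier_def interior_open)
    with \<Omega> obtain U' \<rho> where \<rho>: "local_defining_function \<Omega> p U' \<rho>"
      unfolding smooth_bounded_domain_def by blast
    have "p \<in> U" using p U by blast
    from tangential_field_bound[OF \<rho> op fr U(1) this] obtain r where r: "r > 0" "cball p r \<subseteq> U' \<inter> U"
      and b: "\<And>W. (\<forall>j. C1_on U (\<lambda>x. W x $ j)) \<Longrightarrow> (\<forall>x\<in>frontier \<Omega> \<inter> U. W x \<bullet> outer_normal \<Omega> x = 0) \<Longrightarrow>
      (\<exists>C. \<forall>x\<in>cball p r \<inter> \<Omega>. \<bar>grad \<rho> x \<bullet> W x\<bar> \<le> C * \<bar>\<rho> x\<bar>)"
      by blast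
    have U': "open U'" "smooth_on U' \<rho>" "\<Omega> \<inter> U' = {x \<in> U'. \<rho> x < 0}"
      using \<rho> by (auto simp: local_defining_function_def)
    have "(LINT x:\<Omega>|lborel. divergence (\<lambda>y. bump p r y *\<^sub>R W y) x) = 0"
      if W: "\<forall>j. C1_on U (\<lambda>x. W x $ j)" "\<forall>x\<in>frontier \<Omega>. W x \<bullet> outer_normal \<Omega> x = 0" for W
    proof -
      obtain C where C: "\<forall>x\<in>cball p r \<inter> \<Omega>. \<bar>grad \<rho> x \<bullet> W x\<bar> \<le> C * \<bar>\<rho> x\<bar>"
        using b[OF W(1)] W(2) by auto
      show ?thesis
      proof (rule integral_divergence_bump_eq_0[OF _ r(2,1)])
        show "open (U' \<inter> U)" using U' U by auto
        show "C1_on (U' \<inter> U) (\<lambda>x. W x $ j)" for j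
          by (rule C1_on_subset[of U]) (use W in auto)
        show "C1_on (U' \<inter> U) \<rho>"
          by (rule C1_on_subset[OF smooth_on_C1_on[OF U'(2)]]) auto
        show "\<Omega> \<inter> (U' \<inter> U) = {x \<in> U' \<inter> U. \<rho> x < 0}"
          using U'(3) by blast
        show "\<bar>grad \<rho> x \<bullet> W x\<bar> \<le> C * \<bar>\<rho> x\<bar>" if "x \<in> cball p r \<inter> \<Omega>" for x
          using C that by blast
      qed
    qed
    with r show ?thesis by blast
  qed
qed

lemma divergence_transform_open:
  assumes "open U" "x \<in> U" "\<And>y. y \<in> U \<Longrightarrow> V y = W y"
  shows "divergence V x = divergence W x"
  unfolding divergence_def
  by (intro sum.cong refl pderiv_at_transform_open[OF assms(1,2)]) (simp add: assms(3))

lemma divergence_sum: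
  assumes "\<And>i j. i \<in> I \<Longrightarrow> (\<lambda>x. V i x $ j) differentiable (at x)"
  shows "divergence (\<lambda>y. \<Sum>i\<in>I. V i y) x = (\<Sum>i\<in>I. divergence (V i) x)"
  unfolding divergence_def using assms
  by (simp add: pderiv_at_sum) (rule sum.swap)

text \<open>Compactness leaves finitely many bumps whose sum is positive on the closure. Dividing
  \<open>V\<close> by a positive C^1 function that equals this sum on \<Omega> keeps it C^1 and
  tangential, and there \<open>V\<close> is the sum of the bumps times the quotient.\<close>

theorem divergence_theorem_tangential:
  fixes \<Omega> :: "(real^'d::finite) set"
  assumes \<Omega>: "smooth_bounded_domain \<Omega>" and U: "open U" "closure \<Omega> \<subseteq> U"
    and V: "\<And>j. C1_on U (\<lambda>x. V x $ j)"
    and tan: "\<And>x. x \<in> frontier \<Omega> \<Longrightarrow> V x \<bullet> outer_normal \<Omega> x = 0"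
  shows "(LINT x:\<Omega>|lborel. divergence V x) = 0"
proof -
  have op: "open \<Omega>" and bd: "bounded \<Omega>" and ne: "\<Omega> \<noteq> {}"
    using \<Omega> by (auto simp: smooth_bounded_domain_def)
  have cpt: "compact (closure \<Omega>)" using bd by (simp add: compact_closure)
  define good where "good p \<rho> \<longleftrightarrow> 0 < \<rho> \<and> (\<forall>W. (\<forall>j. C1_on U (\<lambda>x. W x $ j)) \<longrightarrow>
      (\<forall>x\<in>frontier \<Omega>. W x \<bullet> outer_normal \<Omega> x = 0) \<longrightarrow>
      (LINT x:\<Omega>|lborel. divergence (\<lambda>y. bump p \<rho> y *\<^sub>R W y) x) = 0)" for p \<rho>
  have "\<forall>p\<in>closure \<Omega>. \<exists>\<rho>. good p \<rho>"
    using local_divergence_eq_0[OF \<Omega> U] unfolding good_def by blast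
  from bchoice[OF this] obtain r where good: "\<And>p. p \<in> closure \<Omega> \<Longrightarrow> good p (r p)"
    by blast
  have cover: "closure \<Omega> \<subseteq> (\<Union>p\<in>closure \<Omega>. ball p (r p))"
    using good by (force simp: good_def)
  obtain P where P: "P \<subseteq> closure \<Omega>" "finite P" "closure \<Omega> \<subseteq> (\<Union>p\<in>P. ball p (r p))"
    by (rule compactE_image[OF cpt open_ball cover])
  define s where "s x = (\<Sum>p\<in>P. bump p (r p) x)" for x
  have s1: "C1_on X s" for X
    unfolding s_def[abs_def] by (intro C1_on_sum C1_on_bump)
  have s0: "0 \<le> s x" for x
    unfolding s_def by (intro sum_nonneg bump_nonneg)
  have spos: "0 < s x" if x: "x \<in> closure \<Omega>" for x
  proof -
    obtain p where "p \<in> P" "x \<in> ball p (r p)" using P(3) x by blast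
    then show ?thesis
      unfolding s_def using P(2) bump_pos bump_nonneg by (intro sum_pos2[of P p]) auto
  qed
  obtain x0 where x0: "x0 \<in> closure \<Omega>" "\<And>x. x \<in> closure \<Omega> \<Longrightarrow> s x0 \<le> s x"
    using continuous_attains_inf[OF cpt _ C1_on_continuous[OF s1]] ne by fastforce
  define c where "c = s x0"
  have c: "0 < c" using spos x0 by (simp add: c_def)
  \<comment> \<open>\<open>h\<close> equals \<open>s\<close> on \<open>\<Omega>\<close> but is positive everywhere, so dividing by it stays \<open>C\<^sup>1\<close> where the bumps vanish.\<close>
  define h where "h x = s x + (max 0 (c - s x))\<^sup>2" for x
  have hpos: "0 < h x" for x
  proof (cases "s x = 0")
    case True then show ?thesis using c by (simp add: h_def)
  next
    case False then show ?thesis using s0[of x] by (simp add: h_def add_pos_nonneg)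
  qed
  have hs: "h x = s x" if "x \<in> \<Omega>" for x
    using x0(2)[of x] that closure_subset[of \<Omega>] by (auto simp: h_def c_def)
  have h1: "C1_on U h"
    unfolding h_def[abs_def] by (rule C1_on_add[OF s1 C1_on_max0_power2[OF C1_on_diff[OF C1_on_const s1]]])
  have ih1: "C1_on U (\<lambda>x. inverse (h x))"
  proof (rule C1_on_chain_real[OF h1, where h' = "\<lambda>t. - (inverse t * 1 * inverse t)"])
    show "(inverse has_real_derivative - (inverse (h x) * 1 * inverse (h x))) (at (h x))" for x
      using hpos[of x] by (intro DERIV_inverse' DERIV_ident) auto
    show "continuous_on (h ` U) (\<lambda>t. - (inverse t * 1 * inverse t))"
      using hpos by (intro continuous_intros) (auto simp: less_imp_neq[symmetric])
  qed
  define W where "W x = inverse (h x) *\<^sub>R V x" for x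
  have W1: "C1_on U (\<lambda>x. W x $ j)" for j
    unfolding W_def by (simp add: C1_on_mult ih1 V)
  have Wtan: "\<forall>x\<in>frontier \<Omega>. W x \<bullet> outer_normal \<Omega> x = 0"
    by (simp add: W_def tan)
  have bW1: "C1_on U (\<lambda>x. (bump p (r p) x *\<^sub>R W x) $ j)" for p j
    by (simp add: C1_on_mult W1 C1_on_bump)
  have div: "divergence V x = (\<Sum>p\<in>P. divergence (\<lambda>y. bump p (r p) y *\<^sub>R W y) x)" if x: "x \<in> \<Omega>" for x
  proof -
    have "divergence V x = divergence (\<lambda>y. \<Sum>p\<in>P. bump p (r p) y *\<^sub>R W y) x"
    proof (rule divergence_transform_open[OF op x])
      fix y assume y: "y \<in> \<Omega>"
      have "s y \<noteq> 0" using spos[of y] y closure_subset[of \<Omega>] by auto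
      then show "V y = (\<Sum>p\<in>P. bump p (r p) y *\<^sub>R W y)"
        by (simp add: W_def hs[OF y] s_def scaleR_sum_left[symmetric] scaleR_scaleR[symmetric] del: scaleR_scaleR)
          (simp add: scaleR_scaleR)
    qed
    also have "\<dots> = (\<Sum>p\<in>P. divergence (\<lambda>y. bump p (r p) y *\<^sub>R W y) x)"
      by (rule divergence_sum) (use x U closure_subset in \<open>blast intro: C1_on_differentiable[OF bW1]\<close>)
    finally show ?thesis .
  qed
  have int: "set_integrable lborel \<Omega> (divergence (\<lambda>y. bump p (r p) y *\<^sub>R W y))" for p
    by (intro set_integrable_bounded_open op bd continuous_on_subset[OF continuous_on_divergence U(2)] bW1)
  have "(LINT x:\<Omega>|lborel. divergence V x) = (LINT x:\<Omega>|lborel. (\<Sum>p\<in>P. divergence (\<lambda>y. bump p (r p) y *\<^sub>R W y) x))"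
    by (rule set_lebesgue_integral_cong) (use op div in auto)
  also have "\<dots> = (\<Sum>p\<in>P. LINT x:\<Omega>|lborel. divergence (\<lambda>y. bump p (r p) y *\<^sub>R W y) x)"
    using int unfolding set_lebesgue_integral_def set_integrable_def scaleR_sum_right
    by (intro Bochner_Integration.integral_sum) auto
  also have "\<dots> = 0"
  proof (intro sum.neutral ballI)
    fix p assume "p \<in> P"
    then have "good p (r p)" using good P(1) by blast
    then show "(LINT x:\<Omega>|lborel. divergence (\<lambda>y. bump p (r p) y *\<^sub>R W y) x) = 0"
      using W1 Wtan unfolding good_def by blast
  qed
  finally show ?thesis .
qed

section \<open>Green's identity for the magnetic Laplacian\<close>

text \<open>Splitting by coordinate directions lets the pointwise Green identity be verified
  separately for each \<open>j\<close>.\<close>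

lemma mag_laplacian_eq_sum:
  fixes A :: "real^'d::finite \<Rightarrow> real^'d"
  shows "mag_laplacian \<kappa> A \<psi> x = (\<Sum>j\<in>UNIV.
      - (1 / complex_of_real (\<kappa>\<^sup>2)) * pderiv_at j (pderiv_at j \<psi>) x
      + \<i> / complex_of_real \<kappa> * complex_of_real (pderiv_at j (\<lambda>y. A y $ j) x) * \<psi> x
      + 2 * \<i> / complex_of_real \<kappa> * (complex_of_real (A x $ j) * pderiv_at j \<psi> x)
      + complex_of_real ((A x $ j)\<^sup>2) * \<psi> x)"
proof -
  have "(norm (A x))\<^sup>2 = (\<Sum>j\<in>UNIV. (A x $ j)\<^sup>2)"
    unfolding power2_norm_eq_inner inner_vec_def by (simp add: power2_eq_square)
  then show ?thesis
    unfolding mag_laplacian_def laplacian_def divergence_def rcdot_def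
    by (simp add: sum.distrib sum_distrib_left sum_distrib_right sum_negf sum_divide_distrib sum_subtractf)
qed

lemma smooth_on_component: "open U \<Longrightarrow> smooth_on U A \<Longrightarrow> smooth_on U (\<lambda>x. A x $ j)"
  by (rule smooth_on_bounded_linear[OF _ bounded_linear_vec_nth])

lemma C1_on_of_real: "C1_on U f \<Longrightarrow> C1_on U (\<lambda>x. complex_of_real (f x))"
  by (rule C1_on_bounded_linear[OF bounded_linear_of_real])

lemma pderiv_at_of_real:
  "f differentiable (at x) \<Longrightarrow> pderiv_at j (\<lambda>x. complex_of_real (f x)) x = complex_of_real (pderiv_at j f x)"
  by (rule pderiv_at_bounded_linear[OF bounded_linear_of_real])

lemma C1_on_mag_grad:
  assumes "open U" "smooth_on U A" "smooth_on U \<psi>"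
  shows "C1_on U (\<lambda>x. mag_grad \<kappa> A \<psi> x $ j)"
  unfolding mag_grad_def vec_lambda_beta
  by (rule C1_on_add[OF C1_on_mult[OF C1_on_const smooth_on_C1_on[OF smooth_on_pderiv_at[OF assms(3)]]]
        C1_on_mult[OF C1_on_of_real[OF smooth_on_C1_on[OF smooth_on_component[OF assms(1,2)]]]
          smooth_on_C1_on[OF assms(3)]]])

lemma continuous_on_mag_grad:
  assumes "continuous_on U A" "C1_on U \<psi>"
  shows "continuous_on U (mag_grad \<kappa> A \<psi>)"
  unfolding mag_grad_def[abs_def]
  by (intro continuous_intros C1_on_pderiv_continuous C1_on_continuous assms)

lemma continuous_on_mag_laplacian:
  assumes "open U" "smooth_on U A" "smooth_on U \<psi>"
  shows "continuous_on U (mag_laplacian \<kappa> A \<psi>)"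
proof -
  note C = smooth_on_C1_on[OF smooth_on_component[OF assms(1,2)]] smooth_on_C1_on[OF assms(3)]
    smooth_on_C1_on[OF smooth_on_pderiv_at[OF assms(3)]]
  show ?thesis
    unfolding mag_laplacian_eq_sum[abs_def]
    by (intro continuous_on_sum continuous_on_add continuous_on_mult continuous_on_const
        continuous_on_of_real continuous_on_power C1_on_pderiv_continuous C C1_on_continuous)
qed

text \<open>Write D_j for the j-th component of (i/\<kappa>)\<nabla> + A. Multiplication by
  i/\<kappa> is skew for the real inner product on the complex numbers, so the derivative that falls
  on \<eta> gives -((i/\<kappa>) \<partial>_j \<eta>) \<bullet> D_j \<psi>. Adding and subtracting
  A_j \<eta> \<bullet> D_j \<psi> completes both terms to \<eta> \<bullet> D_j D_j \<psi> - D_j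
  \<eta> \<bullet> D_j \<psi>.\<close>

lemma green_pointwise:
  fixes A :: "real^'d::finite \<Rightarrow> real^'d"
  assumes U: "open U" "x \<in> U" and A: "smooth_on U A" and \<psi>: "smooth_on U \<psi>" and \<eta>: "C1_on U \<eta>"
    and \<kappa>: "\<kappa> \<noteq> 0"
  shows "divergence (\<lambda>x. \<chi> j. \<eta> x \<bullet> (\<i> / complex_of_real \<kappa> * mag_grad \<kappa> A \<psi> x $ j)) x
    = \<eta> x \<bullet> mag_laplacian \<kappa> A \<psi> x - mag_grad \<kappa> A \<psi> x \<bullet> mag_grad \<kappa> A \<eta> x"
proof -
  note D = C1_on_differentiable[OF _ U(2)]
  note dA = D[OF smooth_on_C1_on[OF smooth_on_component[OF U(1) A]]]
    and d\<psi> = D[OF smooth_on_C1_on[OF \<psi>]]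
    and d\<psi>' = D[OF smooth_on_C1_on[OF smooth_on_pderiv_at[OF \<psi>]]]
    and dG = D[OF C1_on_mag_grad[OF U(1) A \<psi>]]
  have G: "pderiv_at j (\<lambda>x. mag_grad \<kappa> A \<psi> x $ j) x
      = \<i> / complex_of_real \<kappa> * pderiv_at j (pderiv_at j \<psi>) x
        + (complex_of_real (A x $ j) * pderiv_at j \<psi> x
          + complex_of_real (pderiv_at j (\<lambda>y. A y $ j) x) * \<psi> x)" for j
  proof -
    define c where "c = \<i> / complex_of_real \<kappa>"
    have "(\<lambda>x. complex_of_real (A x $ j)) differentiable (at x)"
      by (rule D[OF C1_on_of_real[OF smooth_on_C1_on[OF smooth_on_component[OF U(1) A]]]])
    then show ?thesis
      unfolding mag_grad_def vec_lambda_beta c_def[symmetric]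
      by (subst pderiv_at_add) (use d\<psi> d\<psi>' dA in
        \<open>auto simp: pderiv_at_mult pderiv_at_of_real pderiv_at_bounded_linear[OF bounded_linear_mult_right]
          intro!: differentiable_mult\<close>)
  qed
  have "pderiv_at j (\<lambda>x. \<eta> x \<bullet> (\<i> / complex_of_real \<kappa> * mag_grad \<kappa> A \<psi> x $ j)) x
    = \<eta> x \<bullet> (- (1 / complex_of_real (\<kappa>\<^sup>2)) * pderiv_at j (pderiv_at j \<psi>) x
      + \<i> / complex_of_real \<kappa> * complex_of_real (pderiv_at j (\<lambda>y. A y $ j) x) * \<psi> x
      + 2 * \<i> / complex_of_real \<kappa> * (complex_of_real (A x $ j) * pderiv_at j \<psi> x)
      + complex_of_real ((A x $ j)\<^sup>2) * \<psi> x) - mag_grad \<kappa> A \<psi> x $ j \<bullet> mag_grad \<kappa> A \<eta> x $ j" for j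
  proof -
    have "pderiv_at j (\<lambda>x. \<eta> x \<bullet> (\<i> / complex_of_real \<kappa> * mag_grad \<kappa> A \<psi> x $ j)) x
      = \<eta> x \<bullet> (\<i> / complex_of_real \<kappa> * pderiv_at j (\<lambda>x. mag_grad \<kappa> A \<psi> x $ j) x)
        + pderiv_at j \<eta> x \<bullet> (\<i> / complex_of_real \<kappa> * mag_grad \<kappa> A \<psi> x $ j)"
      using D[OF \<eta>] dG[of \<kappa> j]
      by (subst pderiv_at_bounded_bilinear[OF bounded_bilinear_inner])
        (auto simp only: pderiv_at_bounded_linear[OF bounded_linear_mult_right]
          intro!: differentiable_mult differentiable_const)
    then show ?thesis
      unfolding G using \<kappa>
      by (simp add: mag_grad_def inner_complex_def power2_eq_square Re_divide_of_real Im_divide_of_real)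
        (simp add: field_simps)
  qed
  then show ?thesis
    by (simp add: divergence_def mag_laplacian_eq_sum inner_vec_def inner_sum_right sum_subtractf)
qed

text \<open>The normal component of the field is \<eta> \<bullet> (i/\<kappa>)((i/\<kappa>)
  \<partial>_n \<psi> + (A \<bullet> n) \<psi>). The two boundary conditions remove its two terms,
  so the test function \<eta> may take any boundary values.\<close>

lemma green_identity:
  fixes A :: "real^'d::finite \<Rightarrow> real^'d"
  assumes \<Omega>: "smooth_bounded_domain \<Omega>" and U: "open U" "closure \<Omega> \<subseteq> U"
    and A: "smooth_on U A" and \<psi>: "smooth_on U \<psi>" and \<eta>: "C1_on U \<eta>" and \<kappa>: "\<kappa> \<noteq> 0"
    and bc: "\<And>x. x \<in> frontier \<Omega> \<Longrightarrow> rcdot (outer_normal \<Omega> x) (grad \<psi> x) = 0"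
      "\<And>x. x \<in> frontier \<Omega> \<Longrightarrow> A x \<bullet> outer_normal \<Omega> x = 0"
  shows "(LINT x:\<Omega>|lborel. \<eta> x \<bullet> mag_laplacian \<kappa> A \<psi> x - mag_grad \<kappa> A \<psi> x \<bullet> mag_grad \<kappa> A \<eta> x) = 0"
proof -
  let ?V = "\<lambda>x. (\<chi> j. \<eta> x \<bullet> (\<i> / complex_of_real \<kappa> * mag_grad \<kappa> A \<psi> x $ j)) :: real^'d"
  have "(LINT x:\<Omega>|lborel. divergence ?V x) = 0"
  proof (rule divergence_theorem_tangential[OF \<Omega> U])
    show "C1_on U (\<lambda>x. ?V x $ j)" for j
      unfolding vec_lambda_beta
      by (rule C1_on_bounded_bilinear[OF bounded_bilinear_inner \<eta> C1_on_mult[OF C1_on_const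
              C1_on_mag_grad[OF U(1) A \<psi>]]])
    fix x assume x: "x \<in> frontier \<Omega>"
    let ?n = "outer_normal \<Omega> x"
    have "(\<Sum>j\<in>UNIV. complex_of_real (?n $ j) * mag_grad \<kappa> A \<psi> x $ j)
        = \<i> / complex_of_real \<kappa> * rcdot ?n (grad \<psi> x) + complex_of_real (A x \<bullet> ?n) * \<psi> x"
      by (simp add: mag_grad_def rcdot_def inner_vec_def sum.distrib sum_distrib_left
          sum_distrib_right algebra_simps)
    then have 0: "(\<Sum>j\<in>UNIV. complex_of_real (?n $ j) * mag_grad \<kappa> A \<psi> x $ j) = 0"
      by (simp add: bc x)
    have "?V x \<bullet> ?n = (\<Sum>j\<in>UNIV. \<eta> x \<bullet> (\<i> / complex_of_real \<kappa> * (complex_of_real (?n $ j) * mag_grad \<kappa> A \<psi> x $ j)))"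
      unfolding inner_vec_def vec_lambda_beta
      by (rule sum.cong) (simp_all add: inner_complex_def algebra_simps)
    also have "\<dots> = \<eta> x \<bullet> (\<i> / complex_of_real \<kappa> * (\<Sum>j\<in>UNIV. complex_of_real (?n $ j) * mag_grad \<kappa> A \<psi> x $ j))"
      by (simp add: inner_sum_right sum_distrib_left)
    finally show "?V x \<bullet> ?n = 0" using 0 by simp
  qed
  moreover have "open \<Omega>" "\<Omega> \<subseteq> U"
    using \<Omega> U closure_subset by (auto simp: smooth_bounded_domain_def)
  have "(LINT x:\<Omega>|lborel. divergence ?V x)
      = (LINT x:\<Omega>|lborel. \<eta> x \<bullet> mag_laplacian \<kappa> A \<psi> x - mag_grad \<kappa> A \<psi> x \<bullet> mag_grad \<kappa> A \<eta> x)"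
    using green_pointwise[OF U(1) subsetD[OF \<open>\<Omega> \<subseteq> U\<close>] A \<psi> \<eta> \<kappa>]
    by (intro set_lebesgue_integral_cong allI impI) (simp add: \<open>open \<Omega>\<close>, blast)
  ultimately show ?thesis by simp
qed

section \<open>The nonlinearity and its potential\<close>

text \<open>Restricted to the convex set \<open>{0..1}\<close>, the derivative relative to
  \<open>{0..}\<close> is one relative to the interval, so the mean value bound includes the
  endpoint 0.\<close>

lemma deriv_bounded_on_unit_Lipschitz:
  assumes "deriv_bounded_on_unit L f" "x \<in> {0..1}" "y \<in> {0..1}"
  shows "\<bar>f x - f y\<bar> \<le> L * \<bar>x - y\<bar>"
proof -
  obtain f' where f': "\<And>s. s \<in> {0..1} \<Longrightarrow> (f has_real_derivative f' s) (at s within {0..})"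
    "\<And>s. s \<in> {0..1} \<Longrightarrow> \<bar>f' s\<bar> \<le> L"
    using bchoice[OF assms(1)[unfolded deriv_bounded_on_unit_def]] by blast
  have "norm (f x - f y) \<le> L * norm (x - y)"
  proof (rule field_differentiable_bound[of "{0..1}"])
    show "(f has_real_derivative f' z) (at z within {0..1})" if "z \<in> {0..1}" for z
      by (rule DERIV_subset[OF f'(1)[OF that]]) auto
  qed (use f' assms in auto)
  then show ?thesis by simp
qed

text \<open>The function \<open>h\<close> is \<open>F\<close> minus the claimed majorant, up to a
  constant. Its derivative \<open>f t - f a - L * (t - a)\<close> is nonpositive for
  \<open>t > a\<close> and nonnegative for \<open>t < a\<close> by the Lipschitz bound, so
  \<open>h\<close> is maximal at \<open>a\<close>. Derivatives are required in the open interval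
  only, which suits a potential that is differentiated under the integral for
  \<open>s > 0\<close>.\<close>

lemma antiderivative_quadratic_bound:
  fixes F f :: "real \<Rightarrow> real"
  assumes cont: "continuous_on {0..1} F"
    and der: "\<And>s. 0 < s \<Longrightarrow> s < 1 \<Longrightarrow> (F has_real_derivative f s) (at s)"
    and lip: "\<And>x y. x \<in> {0..1} \<Longrightarrow> y \<in> {0..1} \<Longrightarrow> \<bar>f x - f y\<bar> \<le> L * \<bar>x - y\<bar>"
    and ab: "a \<in> {0..1}" "b \<in> {0..1}"
  shows "F b - F a \<le> f a * (b - a) + L / 2 * (b - a)\<^sup>2"
proof -
  define h where "h t = F t - f a * (t - a) - L / 2 * (t - a)\<^sup>2" for t
  have hc: "continuous_on {c..d} h" if "0 \<le> c" "d \<le> 1" for c d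
    unfolding h_def[abs_def]
    by (intro continuous_intros continuous_on_subset[OF cont]) (use that in auto)
  have hd: "(h has_derivative (*) (f t - f a - L * (t - a))) (at t)" if "0 < t" "t < 1" for t
    unfolding h_def[abs_def] has_field_derivative_def[symmetric]
    by (rule derivative_eq_intros der[OF that] refl | simp)+
  have "h b \<le> h a"
  proof (cases a b rule: linorder_cases)
    case less
    obtain z where z: "a < z" "z < b" "h b - h a = (f z - f a - L * (z - a)) * (b - a)"
      using mvt[OF less, of h "\<lambda>t. (*) (f t - f a - L * (t - a))"] hc hd ab
      by (metis atLeastAtMost_iff order_le_less_trans order_less_le_trans)
    moreover have "f z - f a - L * (z - a) \<le> 0"
      using lip[of z a] z ab by auto
    ultimately have "h b - h a \<le> 0"
      using less by (simp add: mult_nonpos_nonneg)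
    then show ?thesis by simp
  next
    case greater
    obtain z where z: "b < z" "z < a" "h a - h b = (f z - f a - L * (z - a)) * (a - b)"
      using mvt[OF greater, of h "\<lambda>t. (*) (f t - f a - L * (t - a))"] hc hd ab
      by (metis atLeastAtMost_iff order_le_less_trans order_less_le_trans)
    have "\<bar>f z - f a\<bar> \<le> L * (a - z)"
      using lip[of z a] z ab by (simp add: abs_if)
    moreover have "L * (z - a) = - (L * (a - z))" by (simp add: algebra_simps)
    ultimately have "0 \<le> f z - f a - L * (z - a)" by linarith
    then have "0 \<le> h a - h b"
      using greater z(3) by simp
    then show ?thesis by simp
  qed simp
  then show ?thesis by (simp add: h_def)
qed

lemma continuous_on_ln_cosh:
  fixes f :: "'a::topological_space \<Rightarrow> real"
  shows "continuous_on A f \<Longrightarrow> continuous_on A (\<lambda>x. ln (cosh (f x)))"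
  by (rule continuous_on_ln[OF continuous_on_cosh]) auto

text \<open>Joint continuity is needed because \<open>d\<close> becomes \<delta>(x): it makes the
  energy density continuous on the closure, hence integrable.\<close>

lemma continuous_on_gl_F:
  "continuous_on (UNIV \<times> {0..}) (\<lambda>(d, s). gl_F \<omega> \<beta> \<nu> d s)"
proof -
  have "continuous_on (UNIV \<times> {0..}) (\<lambda>p. integral (cbox 0 \<omega>) ((\<lambda>p \<xi>.
      ln (cosh (\<beta> * (sqrt (\<xi>\<^sup>2 + snd p) + fst p))) + ln (cosh (\<beta> * (sqrt (\<xi>\<^sup>2 + snd p) - fst p)))) p))"
    by (rule integral_continuous_on_param)
      (unfold case_prod_beta, intro continuous_on_add continuous_on_ln_cosh continuous_on_mult_left
        continuous_on_diff continuous_on_real_sqrt continuous_on_power continuous_on_fst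
        continuous_on_snd continuous_on_id)
  then have "continuous_on (UNIV \<times> {0..}) (\<lambda>p. snd p - \<nu> / (2 * \<beta>) * integral (cbox 0 \<omega>) (\<lambda>\<xi>.
      ln (cosh (\<beta> * (sqrt (\<xi>\<^sup>2 + snd p) + fst p))) + ln (cosh (\<beta> * (sqrt (\<xi>\<^sup>2 + snd p) - fst p)))))"
    by (intro continuous_intros)
  then show ?thesis
    by (simp add: gl_F_def case_prod_beta)
qed

lemma has_real_derivative_ln_cosh:
  fixes g :: "real \<Rightarrow> real"
  assumes "(g has_real_derivative D) (at s)"
  shows "((\<lambda>s. ln (cosh (g s))) has_real_derivative tanh (g s) * D) (at s)"
proof -
  have "((\<lambda>t::real. ln (cosh t)) has_real_derivative tanh t) (at t)" for t
    by (auto intro!: derivative_eq_intros simp: tanh_def divide_inverse)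
  from DERIV_chain2[OF this assms] show ?thesis .
qed

text \<open>Differentiation under the integral sign. For \<open>s > 0\<close> the root stays away
  from 0, whereas at \<open>s = 0\<close> the factor \<open>1 / sqrt\<close> in the differentiated
  integrand is singular at \<xi> = 0. The inner derivative \<beta> / (2 sqrt) cancels the 1 /
  \<beta> in front and produces the factor 1/4 of \<open>gl_f\<close>.\<close>

lemma has_real_derivative_gl_F:
  assumes "\<beta> \<noteq> 0" "0 < s"
  shows "(gl_F \<omega> \<beta> \<nu> d has_real_derivative gl_f \<omega> \<beta> \<nu> d s) (at s)"
proof -
  define G where "G s \<xi> = ln (cosh (\<beta> * (sqrt (\<xi>\<^sup>2 + s) + d))) + ln (cosh (\<beta> * (sqrt (\<xi>\<^sup>2 + s) - d)))"
    for s \<xi>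
  define g where "g s \<xi> = \<beta> / (2 * sqrt (\<xi>\<^sup>2 + s)) *
      (tanh (\<beta> * (sqrt (\<xi>\<^sup>2 + s) + d)) + tanh (\<beta> * (sqrt (\<xi>\<^sup>2 + s) - d)))" for s \<xi>
  have pos: "0 < \<xi>\<^sup>2 + s" if "0 < s" for s \<xi> :: real
    by (rule add_nonneg_pos[OF zero_le_power2 that])
  have "((\<lambda>s. integral (cbox 0 \<omega>) (G s)) has_real_derivative integral (cbox 0 \<omega>) (g s)) (at s within {0<..})"
  proof (rule leibniz_rule_field_derivative)
    fix s \<xi> :: real assume s: "s \<in> {0<..}"
    have "0 < \<xi>\<^sup>2 + s" using s by (intro pos) simp
    note DERIV_real_sqrt[OF this]
    moreover have "((\<lambda>s. \<xi>\<^sup>2 + s) has_real_derivative 0 + 1) (at s)"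
      by (rule DERIV_add[OF DERIV_const DERIV_ident])
    ultimately have "((\<lambda>s. sqrt (\<xi>\<^sup>2 + s)) has_real_derivative
        inverse (sqrt (\<xi>\<^sup>2 + s)) / 2 * (0 + 1)) (at s)"
      by (rule DERIV_chain2)
    then have r: "((\<lambda>s. sqrt (\<xi>\<^sup>2 + s)) has_real_derivative 1 / (2 * sqrt (\<xi>\<^sup>2 + s))) (at s)"
      by (rule DERIV_cong) (simp add: inverse_eq_divide)
    have "((\<lambda>s. G s \<xi>) has_real_derivative
        tanh (\<beta> * (sqrt (\<xi>\<^sup>2 + s) + d)) * (\<beta> * (1 / (2 * sqrt (\<xi>\<^sup>2 + s)) + 0))
        + tanh (\<beta> * (sqrt (\<xi>\<^sup>2 + s) - d)) * (\<beta> * (1 / (2 * sqrt (\<xi>\<^sup>2 + s)) - 0))) (at s)"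
      unfolding G_def
    proof (rule DERIV_add; rule has_real_derivative_ln_cosh)
      show "((\<lambda>s. \<beta> * (sqrt (\<xi>\<^sup>2 + s) + d)) has_real_derivative
          \<beta> * (1 / (2 * sqrt (\<xi>\<^sup>2 + s)) + 0)) (at s)"
        by (rule DERIV_cmult, rule DERIV_add[OF r DERIV_const])
      show "((\<lambda>s. \<beta> * (sqrt (\<xi>\<^sup>2 + s) - d)) has_real_derivative
          \<beta> * (1 / (2 * sqrt (\<xi>\<^sup>2 + s)) - 0)) (at s)"
        by (rule DERIV_cmult, rule DERIV_diff[OF r DERIV_const])
    qed
    then have "((\<lambda>s. G s \<xi>) has_real_derivative g s \<xi>) (at s)"
      by (rule DERIV_cong) (simp add: g_def mult.commute flip: add_divide_distrib distrib_left)
    then show "((\<lambda>s. G s \<xi>) has_real_derivative g s \<xi>) (at s within {0<..})"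
      by (rule has_field_derivative_at_within)
  next
    fix s :: real assume s: "s \<in> {0<..}"
    show "G s integrable_on cbox 0 \<omega>"
      unfolding G_def[abs_def]
      by (intro integrable_continuous continuous_on_ln_cosh continuous_intros)
  next
    have "sqrt (\<xi>\<^sup>2 + s) \<noteq> 0" "cosh t \<noteq> 0" if "0 < s" for s \<xi> t :: real
      using pos[OF that, of \<xi>] cosh_real_pos[of t] by auto
    then show "continuous_on ({0<..} \<times> cbox 0 \<omega>) (\<lambda>(s, \<xi>). g s \<xi>)"
      unfolding g_def case_prod_beta
      by (intro continuous_on_mult continuous_on_divide continuous_on_add continuous_on_diff continuous_on_tanh
        continuous_on_const continuous_on_real_sqrt continuous_on_power continuous_on_fst
        continuous_on_snd continuous_on_id) auto
  qed (use assms in auto)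
  then have "((\<lambda>s. integral {0..\<omega>} (G s)) has_real_derivative integral {0..\<omega>} (g s)) (at s)"
    using at_within_open[of s "{0<..}"] assms by (simp add: cbox_interval)
  then have "((\<lambda>s. s - \<nu> / (2 * \<beta>) * integral {0..\<omega>} (G s)) has_real_derivative
      1 - \<nu> / (2 * \<beta>) * integral {0..\<omega>} (g s)) (at s)"
    by (intro DERIV_diff DERIV_ident DERIV_cmult)
  moreover have "\<nu> / (2 * \<beta>) * integral {0..\<omega>} (g s) = integral {0..\<omega>} (\<lambda>\<xi>. \<nu> / (4 * sqrt (\<xi>\<^sup>2 + s)) *
      (tanh (\<beta> * (sqrt (\<xi>\<^sup>2 + s) + d)) + tanh (\<beta> * (sqrt (\<xi>\<^sup>2 + s) - d))))"
  proof -
    have "\<nu> / (2 * \<beta>) * (\<beta> / (2 * r) * t) = \<nu> / (4 * r) * t" for r t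
      using assms by simp
    then show ?thesis
      unfolding integral_mult_right[symmetric] g_def by presburger
  qed
  ultimately show ?thesis
    by (simp add: gl_F_def[abs_def] gl_f_def G_def[abs_def])
qed

lemma gl_F_quadratic_bound:
  assumes "\<beta> \<noteq> 0" "deriv_bounded_on_unit L (gl_f \<omega> \<beta> \<nu> d)" "a \<in> {0..1}" "b \<in> {0..1}"
  shows "gl_F \<omega> \<beta> \<nu> d b - gl_F \<omega> \<beta> \<nu> d a \<le> gl_f \<omega> \<beta> \<nu> d a * (b - a) + L / 2 * (b - a)\<^sup>2"
proof (rule antiderivative_quadratic_bound)
  show "continuous_on {0..1} (gl_F \<omega> \<beta> \<nu> d)"
    using continuous_on_compose2[OF continuous_on_gl_F[of \<omega> \<beta> \<nu>], of "{0..1}" "\<lambda>s. (d, s)"]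
    by (force intro!: continuous_on_Pair continuous_on_const continuous_on_id)
qed (use assms has_real_derivative_gl_F deriv_bounded_on_unit_Lipschitz in auto)

section \<open>Maximum principle\<close>

text \<open>If \<open>g x\<close> were negative, continuity would give
  \<open>g \<le> g x / 2\<close> on a ball inside \<Omega>; that ball has positive measure, and
  \<open>g\<close> is nonpositive elsewhere, so the integral would be negative.\<close>

lemma integral_nonneg_nonpos_imp_eq_0:
  fixes g :: "'a::euclidean_space \<Rightarrow> real"
  assumes \<Omega>: "open \<Omega>" "bounded \<Omega>" and g: "continuous_on (closure \<Omega>) g"
    and le: "\<And>x. x \<in> \<Omega> \<Longrightarrow> g x \<le> 0" and ge: "0 \<le> (LINT x:\<Omega>|lborel. g x)" and x: "x \<in> \<Omega>"
  shows "g x = 0"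
proof (rule ccontr)
  assume "g x \<noteq> 0"
  then have neg: "g x / 2 < 0" "g x < g x / 2" using le[OF x] by auto
  have "continuous_on \<Omega> g" using g closure_subset by (rule continuous_on_subset)
  then have "open (g -` {..<g x / 2} \<inter> \<Omega>)"
    using continuous_on_open_vimage[OF \<Omega>(1), of g] open_lessThan by blast
  then obtain r where r: "0 < r" "ball x r \<subseteq> g -` {..<g x / 2} \<inter> \<Omega>"
    using x neg openE[of "g -` {..<g x / 2} \<inter> \<Omega>" x] by auto
  have "(LINT y:\<Omega>|lborel. g y) \<le> (LINT y:\<Omega>|lborel. g x / 2 * indicator (ball x r) y)"
  proof (rule set_integral_mono)
    show "set_integrable lborel \<Omega> g"
      by (rule set_integrable_bounded_open[OF \<Omega> g])
    have "integrable lborel (indicator (ball x r) :: 'a \<Rightarrow> real)"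
      by (rule integrable_real_indicator) (use emeasure_bounded_finite[OF bounded_ball] in auto)
    then show "set_integrable lborel \<Omega> (\<lambda>y. g x / 2 * indicator (ball x r) y)"
      unfolding set_integrable_def using \<Omega> by (intro integrable_mult_indicator integrable_mult_right) auto
    show "g y \<le> g x / 2 * indicator (ball x r) y" if "y \<in> \<Omega>" for y
      using r(2) le[OF that] by (cases "y \<in> ball x r") auto
  qed
  also have "\<dots> = (LINT y|lborel. g x / 2 * indicator (ball x r) y)"
    unfolding set_lebesgue_integral_def
    by (rule Bochner_Integration.integral_cong) (use r(2) in \<open>auto simp: indicator_def\<close>)
  also have "\<dots> = g x / 2 * measure lborel (ball x r)"
    by simp
  also have "\<dots> < 0"
    using neg content_ball_pos[OF r(1)] by (intro mult_neg_pos) auto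
  finally show False using ge by simp
qed

lemma mag_grad_scale:
  assumes "\<phi> differentiable (at x)" "\<psi> differentiable (at x)"
  shows "mag_grad \<kappa> A (\<lambda>y. complex_of_real (\<phi> y) * \<psi> y) x $ j
    = complex_of_real (\<phi> x) * mag_grad \<kappa> A \<psi> x $ j
      + \<i> / complex_of_real \<kappa> * complex_of_real (pderiv_at j \<phi> x) * \<psi> x"
proof -
  have "(\<lambda>y. complex_of_real (\<phi> y)) differentiable (at x)"
    using bounded_linear.has_derivative[OF bounded_linear_of_real] assms(1)
    unfolding differentiable_def by blast
  then show ?thesis
    using assms by (simp add: mag_grad_def pderiv_at_mult pderiv_at_of_real algebra_simps)
qed

text \<open>Here \<open>M\<close> and \<open>a\<close> are the moduli of the new and the old value,
  \<open>p\<close> is their inner product, and \<open>p \<le> M * a\<close> is Cauchy-Schwarz. The 2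
  in \<open>2 * L\<close> bounds the factor 1 + a of 1 - a^2: it gives f >= -S(1 - a). What remains
  of the stabilization, M^2 - M a - (1 - a) M^2 = a M (M - 1), is nonnegative, and the time
  difference contributes strict positivity.\<close>

lemma modulus_growth_ineq:
  fixes M a p f S L \<tau> :: real
  assumes M: "1 < M" and a: "0 \<le> a" "a \<le> 1" and p: "p \<le> M * a" and L: "0 \<le> L" "2 * L \<le> S"
    and \<tau>: "0 < \<tau>" and f: "- L * (1 - a\<^sup>2) \<le> f"
  shows "0 < (M\<^sup>2 - p) / \<tau> + f * M\<^sup>2 + S * (M\<^sup>2 - p)"
proof -
  have "M * a < M * M" using M a by (intro mult_strict_left_mono) auto
  then have "0 < (M\<^sup>2 - p) / \<tau>" using p \<tau> by (simp add: power2_eq_square)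
  moreover have "S * (M\<^sup>2 - M * a) \<le> S * (M\<^sup>2 - p)"
    using p L by (intro mult_left_mono) auto
  moreover have "- (S * (1 - a)) \<le> f"
  proof -
    have "L * ((1 - a) * (1 + a)) \<le> (2 * L) * (1 - a)"
      using mult_left_mono[of "1 + a" 2 "L * (1 - a)"] L a by (simp add: mult_ac)
    also have "\<dots> \<le> S * (1 - a)" using L a by (intro mult_right_mono) auto
    also have "(1 - a) * (1 + a) = 1 - a\<^sup>2" by (simp add: algebra_simps power2_eq_square)
    finally show ?thesis using f by simp
  qed
  then have "- (S * (1 - a)) * M\<^sup>2 \<le> f * M\<^sup>2" by (intro mult_right_mono) auto
  moreover have "0 \<le> S * (a * (M * (M - 1)))"
    using L a M by (intro mult_nonneg_nonneg) auto
  then have "0 \<le> S * (M\<^sup>2 - M * a) + - (S * (1 - a)) * M\<^sup>2"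
    by (simp add: algebra_simps power2_eq_square)
  ultimately show ?thesis by linarith
qed

lemma order_parameter_equation_inner:
  fixes z z' m w :: complex and \<tau> f S :: real
  assumes "(z - z') / complex_of_real \<tau> + m + complex_of_real f * z + complex_of_real S * (z - z') = 0"
  shows "w \<bullet> m = - ((w \<bullet> (z - z')) / \<tau> + f * (w \<bullet> z) + S * (w \<bullet> (z - z')))"
proof -
  have "m = - ((1 / \<tau>) *\<^sub>R (z - z') + f *\<^sub>R z + S *\<^sub>R (z - z'))"
    using assms by (simp add: scaleR_conv_of_real add_eq_0_iff algebra_simps)
  then show ?thesis by (simp add: inner_diff_right)
qed

text \<open>Testing with \<open>\<phi>\<psi>\<close> for \<open>\<phi> = ((\<bar>\<psi>\<bar>\<^sup>2 - 1)\<^sub>+)\<^sup>2\<close> makes the integral of the magnetic Laplacian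
  nonnegative, while the equation makes the integrand negative wherever \<open>\<bar>\<psi>\<bar> > 1\<close>.\<close>

lemma scheme_maximum_principle:
  fixes A :: "real^'d::finite \<Rightarrow> real^'d"
  assumes \<Omega>: "smooth_bounded_domain \<Omega>" and U: "open U" "closure \<Omega> \<subseteq> U"
    and A: "smooth_on U A" and \<psi>: "smooth_on U \<psi>" and \<kappa>: "\<kappa> \<noteq> 0"
    and bc: "\<And>x. x \<in> frontier \<Omega> \<Longrightarrow> rcdot (outer_normal \<Omega> x) (grad \<psi> x) = 0"
      "\<And>x. x \<in> frontier \<Omega> \<Longrightarrow> A x \<bullet> outer_normal \<Omega> x = 0"
    and par: "0 < \<tau>" "0 \<le> L" "2 * L \<le> S"
    and \<psi>': "\<And>x. x \<in> \<Omega> \<Longrightarrow> cmod (\<psi>' x) \<le> 1"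
    and f: "\<And>x. x \<in> \<Omega> \<Longrightarrow> - L * (1 - (cmod (\<psi>' x))\<^sup>2) \<le> f x"
    and eq: "\<And>x. x \<in> \<Omega> \<Longrightarrow> (\<psi> x - \<psi>' x) / complex_of_real \<tau> + mag_laplacian \<kappa> A \<psi> x
        + complex_of_real (f x) * \<psi> x + complex_of_real S * (\<psi> x - \<psi>' x) = 0"
    and x: "x \<in> closure \<Omega>"
  shows "cmod (\<psi> x) \<le> 1"
proof -
  have op: "open \<Omega>" and bd: "bounded \<Omega>"
    using \<Omega> by (auto simp: smooth_bounded_domain_def)
  have \<Omega>U: "\<Omega> \<subseteq> U" using closure_subset U(2) by (rule order_trans)
  define u where "u x = \<psi> x \<bullet> \<psi> x" for x
  define \<phi> where "\<phi> x = (max 0 (u x - 1))\<^sup>2" for x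
  define \<eta> where "\<eta> x = complex_of_real (\<phi> x) * \<psi> x" for x
  note \<psi>1 = smooth_on_C1_on[OF \<psi>]
  have u1: "C1_on U u"
    unfolding u_def[abs_def] by (rule C1_on_bounded_bilinear[OF bounded_bilinear_inner \<psi>1 \<psi>1])
  have \<phi>1: "C1_on U \<phi>"
    unfolding \<phi>_def[abs_def] by (rule C1_on_max0_power2[OF C1_on_diff[OF u1 C1_on_const]])
  have \<eta>1: "C1_on U \<eta>"
    unfolding \<eta>_def[abs_def] by (rule C1_on_mult[OF C1_on_of_real[OF \<phi>1] \<psi>1])
  let ?g = "\<lambda>x. \<eta> x \<bullet> mag_laplacian \<kappa> A \<psi> x"
  let ?h = "\<lambda>x. mag_grad \<kappa> A \<psi> x \<bullet> mag_grad \<kappa> A \<eta> x"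
  have A0: "continuous_on U A"
    by (rule C1_on_continuous[OF smooth_on_C1_on[OF A]])
  have gc: "continuous_on (closure \<Omega>) ?g"
    by (rule continuous_on_subset[OF _ U(2)])
      (intro continuous_on_inner C1_on_continuous[OF \<eta>1] continuous_on_mag_laplacian[OF U(1) A \<psi>])
  have hc: "continuous_on (closure \<Omega>) ?h"
    by (rule continuous_on_subset[OF _ U(2)])
      (intro continuous_on_inner continuous_on_mag_grad[OF A0] \<eta>1 \<psi>1)
  have h0: "0 \<le> ?h y" if "y \<in> \<Omega>" for y
  proof -
    have y: "y \<in> U" using that \<Omega>U by blast
    note d = C1_on_differentiable[OF _ y]
    have "((\<lambda>t. (max 0 (t - 1))\<^sup>2) has_real_derivative 2 * max 0 (u y - 1) * 1) (at (u y))"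
      by (rule DERIV_chain2[OF has_real_derivative_max0_power2]) (auto intro!: derivative_eq_intros)
    from pderiv_at_chain_real[OF this d[OF u1]]
    have d\<phi>: "pderiv_at j \<phi> y = 2 * max 0 (u y - 1) * pderiv_at j u y" for j
      by (simp add: \<phi>_def[abs_def])
    have du: "pderiv_at j u y = 2 * (\<psi> y \<bullet> pderiv_at j \<psi> y)" for j
      unfolding u_def[abs_def]
      by (simp add: pderiv_at_bounded_bilinear[OF bounded_bilinear_inner d[OF \<psi>1] d[OF \<psi>1]] inner_commute)
    have "0 \<le> mag_grad \<kappa> A \<psi> y $ j \<bullet> mag_grad \<kappa> A \<eta> y $ j" for j
    proof -
      let ?D = "mag_grad \<kappa> A \<psi> y $ j"
      \<comment> \<open>Because i \<psi> is orthogonal to \<psi>, the part of \<open>?D\<close> that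
        contains \<open>A\<close> drops out. What is left is a multiple of half the derivative of
        \<open>u\<close>; with \<open>c\<close> the derivative of \<phi>, itself a nonnegative
        multiple of that of \<open>u\<close>, the cross term becomes a square.\<close>
      have "?D \<bullet> (\<i> / complex_of_real \<kappa> * complex_of_real c * \<psi> y)
          = c / \<kappa>\<^sup>2 * (\<psi> y \<bullet> pderiv_at j \<psi> y)" for c
        using \<kappa> by (simp add: mag_grad_def inner_complex_def power2_eq_square field_simps)
      then have "?D \<bullet> mag_grad \<kappa> A \<eta> y $ j
          = \<phi> y * (?D \<bullet> ?D) + pderiv_at j \<phi> y / \<kappa>\<^sup>2 * (\<psi> y \<bullet> pderiv_at j \<psi> y)"
        unfolding \<eta>_def[abs_def] mag_grad_scale[OF d[OF \<phi>1] d[OF \<psi>1]]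
        by (simp add: inner_add_right scaleR_conv_of_real[symmetric])
      also have "\<dots> = \<phi> y * (?D \<bullet> ?D) + 4 * max 0 (u y - 1) / \<kappa>\<^sup>2 * (\<psi> y \<bullet> pderiv_at j \<psi> y)\<^sup>2"
        by (simp add: d\<phi> du power2_eq_square)
      also have "0 \<le> \<dots>" by (simp add: \<phi>_def)
      finally show ?thesis .
    qed
    then show ?thesis unfolding inner_vec_def by (intro sum_nonneg) auto
  qed
  have g0: "?g y \<le> 0 \<and> (1 < cmod (\<psi> y) \<longrightarrow> ?g y < 0)" if y: "y \<in> \<Omega>" for y
  proof -
    let ?m = "(\<psi> y \<bullet> (\<psi> y - \<psi>' y)) / \<tau> + f y * (\<psi> y \<bullet> \<psi> y) + S * (\<psi> y \<bullet> (\<psi> y - \<psi>' y))"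
    have "?g y = \<phi> y * (\<psi> y \<bullet> mag_laplacian \<kappa> A \<psi> y)"
      by (simp add: \<eta>_def scaleR_conv_of_real[symmetric])
    also have "\<dots> = - (\<phi> y * ?m)"
      unfolding order_parameter_equation_inner[OF eq[OF y]] by (rule mult_minus_right)
    finally have g: "?g y = - (\<phi> y * ?m)" .
    have uM: "u y = (cmod (\<psi> y))\<^sup>2" by (simp add: u_def power2_norm_eq_inner)
    show ?thesis
    proof (cases "1 < cmod (\<psi> y)")
      case True
      have "0 < ((cmod (\<psi> y))\<^sup>2 - \<psi> y \<bullet> \<psi>' y) / \<tau> + f y * (cmod (\<psi> y))\<^sup>2
          + S * ((cmod (\<psi> y))\<^sup>2 - \<psi> y \<bullet> \<psi>' y)"
        by (rule modulus_growth_ineq[where a = "cmod (\<psi>' y)" and L = L])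
          (use True \<psi>'[OF y] f[OF y] par norm_cauchy_schwarz in auto)
      then have "0 < ?m" by (simp add: inner_diff_right power2_norm_eq_inner)
      moreover have "0 < \<phi> y"
        using one_less_power[OF True, of 2] uM by (simp add: \<phi>_def)
      ultimately have "0 < \<phi> y * ?m" by (rule mult_pos_pos[rotated])
      then show ?thesis using g by linarith
    next
      case False
      then have "u y \<le> 1" unfolding uM by (simp add: power_le_one)
      then have "\<phi> y = 0" by (simp add: \<phi>_def)
      then show ?thesis using g False by simp
    qed
  qed
  have gi: "set_integrable lborel \<Omega> ?g" and hi: "set_integrable lborel \<Omega> ?h"
    by (intro set_integrable_bounded_open op bd gc hc)+
  have "(LINT x:\<Omega>|lborel. ?g x) = (LINT x:\<Omega>|lborel. ?h x)"
    using green_identity[OF \<Omega> U A \<psi> \<eta>1 \<kappa> bc] set_integral_diff(2)[OF gi hi] by simp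
  moreover have "0 \<le> (LINT x:\<Omega>|lborel. ?h x)"
    using h0 unfolding set_lebesgue_integral_def
    by (intro Bochner_Integration.integral_nonneg) (simp add: indicator_def)
  \<comment> \<open>Signs clash: by Green's identity the integral of \<open>?g\<close> equals that
    of \<open>?h\<close>, which is nonnegative, while \<open>?g\<close> is nonpositive. So
    \<open>?g\<close> vanishes on \<Omega>, where a modulus above 1 would force it to be
    negative.\<close>
  ultimately have gz: "?g y = 0" if "y \<in> \<Omega>" for y
    using integral_nonneg_nonpos_imp_eq_0[OF op bd gc _ _ that] g0 by simp
  have in\<Omega>: "cmod (\<psi> y) \<le> 1" if "y \<in> \<Omega>" for y
    using g0[OF that] gz[OF that] by (cases "1 < cmod (\<psi> y)") auto
  show ?thesis
  proof (rule continuous_le_on_closure[of \<Omega> "\<lambda>x. cmod (\<psi> x)", OF _ x in\<Omega>])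
    show "continuous_on (closure \<Omega>) (\<lambda>x. cmod (\<psi> x))"
      by (intro continuous_on_norm continuous_on_subset[OF C1_on_continuous[OF \<psi>1] U(2)])
  qed
qed

section \<open>Energy inequality\<close>

text \<open>The right side exceeds the left by half of the squared norm of \<open>a - b\<close>, the
  dissipation that is given away each time the energy telescopes.\<close>

lemma inner_self_diff_ge:
  fixes a b :: "'a::real_inner"
  shows "((norm a)\<^sup>2 - (norm b)\<^sup>2) / 2 \<le> a \<bullet> (a - b)"
proof -
  have "0 \<le> (norm (a - b))\<^sup>2" by simp
  then show ?thesis
    unfolding power2_norm_eq_inner by (simp add: inner_diff_left inner_diff_right inner_commute)
qed

text \<open>For fixed \<psi>, half of |((i/\<kappa>)\<nabla> + A)\<psi>|^2 is a convex quadratic in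
  \<open>A\<close> whose gradient is the supercurrent term of the second equation. This is its
  tangent inequality at the new potential, which is why that equation takes the term at
  \<open>A n\<close>.\<close>

lemma current_inequality:
  fixes A A' :: "real^'d::finite \<Rightarrow> real^'d"
  assumes d: "\<psi> differentiable (at x)" and \<kappa>: "\<kappa> \<noteq> 0"
  shows "((norm (mag_grad \<kappa> A \<psi> x))\<^sup>2 - (norm (mag_grad \<kappa> A' \<psi> x))\<^sup>2) / 2
    \<le> ((1 / \<kappa>) *\<^sub>R im_current \<psi> x + (cmod (\<psi> x))\<^sup>2 *\<^sub>R A x) \<bullet> (A x - A' x)"
proof -
  have cj: "pderiv_at j (\<lambda>y. cnj (\<psi> y)) x = cnj (pderiv_at j \<psi> x)" for j
    by (rule pderiv_at_bounded_linear[OF bounded_linear_cnj d])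
  have "(mag_grad \<kappa> A \<psi> x $ j \<bullet> mag_grad \<kappa> A \<psi> x $ j - mag_grad \<kappa> A' \<psi> x $ j \<bullet> mag_grad \<kappa> A' \<psi> x $ j) / 2
    \<le> ((1 / \<kappa>) *\<^sub>R im_current \<psi> x + (cmod (\<psi> x))\<^sup>2 *\<^sub>R A x) $ j * (A x - A' x) $ j" for j
  proof -
    let ?a = "A x $ j" and ?a' = "A' x $ j"
    have "(mag_grad \<kappa> A \<psi> x $ j \<bullet> mag_grad \<kappa> A \<psi> x $ j - mag_grad \<kappa> A' \<psi> x $ j \<bullet> mag_grad \<kappa> A' \<psi> x $ j) / 2
      = (im_current \<psi> x $ j / \<kappa> * (?a - ?a')) + (cmod (\<psi> x))\<^sup>2 * (?a\<^sup>2 - ?a'\<^sup>2) / 2"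
      using \<kappa> unfolding cmod_power2
      by (simp add: mag_grad_def im_current_def cj inner_complex_def Re_divide_of_real Im_divide_of_real
          power2_eq_square) (simp add: field_simps)
    also have "(cmod (\<psi> x))\<^sup>2 * (?a\<^sup>2 - ?a'\<^sup>2) / 2 = (cmod (\<psi> x))\<^sup>2 * ((?a\<^sup>2 - ?a'\<^sup>2) / 2)"
      by simp
    also have "\<dots> \<le> (cmod (\<psi> x))\<^sup>2 * (?a * (?a - ?a'))"
      using inner_self_diff_ge[of ?a ?a'] by (intro mult_left_mono) auto
    finally show ?thesis by (simp add: algebra_simps)
  qed
  then have "(\<Sum>j\<in>UNIV. (mag_grad \<kappa> A \<psi> x $ j \<bullet> mag_grad \<kappa> A \<psi> x $ j - mag_grad \<kappa> A' \<psi> x $ j \<bullet> mag_grad \<kappa> A' \<psi> x $ j) / 2)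
    \<le> ((1 / \<kappa>) *\<^sub>R im_current \<psi> x + (cmod (\<psi> x))\<^sup>2 *\<^sub>R A x) \<bullet> (A x - A' x)"
    unfolding inner_vec_def inner_real_def by (rule sum_mono)
  then show ?thesis
    unfolding power2_norm_eq_inner inner_vec_def by (simp add: sum_subtractf sum_divide_distrib[symmetric])
qed

text \<open>With D = |z - z'|^2, the identity (z - z') \<bullet> z = (|z|^2 - |z'|^2 + D)/2 produces
  exactly half of the linear term in the bound for \<open>F - F'\<close>. The losses are L D from
  the quadratic term and L D / 2 from f D / 2 with f >= -L; both are paid by S D >= 2 L D.\<close>

lemma potential_inequality:
  fixes z z' :: complex and S L \<tau> :: real
  assumes z: "cmod z \<le> 1" "cmod z' \<le> 1" and par: "0 < \<tau>" "0 \<le> L" "2 * L \<le> S"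
    and f: "- L \<le> f"
    and F: "F - F' \<le> f * ((cmod z)\<^sup>2 - (cmod z')\<^sup>2) + L / 2 * ((cmod z)\<^sup>2 - (cmod z')\<^sup>2)\<^sup>2"
  shows "(F - F') / 2 \<le> ((z - z') \<bullet> (z - z')) / \<tau> + f * ((z - z') \<bullet> z) + S * ((z - z') \<bullet> (z - z'))"
proof -
  define D where "D = (cmod (z - z'))\<^sup>2"
  have D: "(z - z') \<bullet> (z - z') = D" "0 \<le> D" by (simp_all add: D_def power2_norm_eq_inner)
  have zz: "(z - z') \<bullet> z = ((cmod z)\<^sup>2 - (cmod z')\<^sup>2 + D) / 2"
    unfolding D_def power2_norm_eq_inner by (simp add: inner_diff_left inner_diff_right inner_commute)
  have fz: "f * ((z - z') \<bullet> z) = f * ((cmod z)\<^sup>2 - (cmod z')\<^sup>2) / 2 + f * D / 2"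
    unfolding zz by (simp add: field_simps)
  have "\<bar>(cmod z)\<^sup>2 - (cmod z')\<^sup>2\<bar> = \<bar>cmod z - cmod z'\<bar> * (cmod z + cmod z')"
    unfolding power2_eq_square square_diff_square_factored by (simp add: abs_mult)
  also have "\<dots> \<le> cmod (z - z') * 2"
    using z norm_triangle_ineq3[of z z'] by (intro mult_mono) auto
  finally have "((cmod z)\<^sup>2 - (cmod z')\<^sup>2)\<^sup>2 \<le> (cmod (z - z') * 2)\<^sup>2"
    by (intro abs_le_square_iff[THEN iffD1]) simp
  then have "L / 2 * ((cmod z)\<^sup>2 - (cmod z')\<^sup>2)\<^sup>2 \<le> L / 2 * (4 * D)"
    using par by (intro mult_left_mono) (auto simp: D_def power_mult_distrib)
  then have "L / 2 * ((cmod z)\<^sup>2 - (cmod z')\<^sup>2)\<^sup>2 \<le> 2 * (L * D)" by (simp add: mult.commute)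
  moreover have "- (L * D) \<le> f * D" using mult_right_mono[OF f D(2)] by simp
  moreover have "2 * (L * D) \<le> S * D" using mult_right_mono[OF par(3) D(2)] by simp
  moreover have "0 \<le> D / \<tau>" "0 \<le> L * D" using par D by auto
  moreover define X Y where "X = f * ((cmod z)\<^sup>2 - (cmod z')\<^sup>2)"
    and "Y = L / 2 * ((cmod z)\<^sup>2 - (cmod z')\<^sup>2)\<^sup>2"
  moreover have "F - F' \<le> X + Y" using F by (simp add: X_def Y_def)
  ultimately show ?thesis
    unfolding fz D(1) by (simp flip: X_def Y_def)
qed

text \<open>The Lipschitz estimate between \<open>s\<close> and the zero of \<open>f\<close> at
  1.\<close>

lemma gl_f_bounds_on_unit:
  assumes f: "deriv_bounded_on_unit L f" "f 1 = 0" and s: "s \<in> {0..1}"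
  shows "- L * (1 - s) \<le> f s"
  using deriv_bounded_on_unit_Lipschitz[OF f(1) s, of 1] f(2) s by (simp add: abs_if algebra_simps split: if_splits)

text \<open>One time step, free of the dimension: primed letters are the old state, \<open>B\<close>
  stands for the curl of \<open>A\<close>, and \<open>R\<close> for curl curl A - curl H.
  Integration by parts for the curl enters as the hypothesis \<open>R\<close>, so that
  \<open>'h\<close> can be scalar or vector valued.\<close>

lemma scheme_energy_inequality:
  fixes A A' :: "real^'d::finite \<Rightarrow> real^'d" and B B' H H' :: "real^'d \<Rightarrow> 'h::euclidean_space"
  assumes \<Omega>: "smooth_bounded_domain \<Omega>" and U: "open U" "closure \<Omega> \<subseteq> U"
    and A: "smooth_on U A" "smooth_on U A'" and \<psi>: "smooth_on U \<psi>" "smooth_on U \<psi>'"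
    and \<delta>: "continuous_on (closure \<Omega>) \<delta>"
    and BH: "continuous_on (closure \<Omega>) B" "continuous_on (closure \<Omega>) B'"
      "continuous_on (closure \<Omega>) H" "continuous_on (closure \<Omega>) H'"
    and par: "0 < \<kappa>" "0 < \<sigma>" "0 < \<tau>" "0 \<le> L" "2 * L \<le> S" "\<beta> \<noteq> 0"
    and f: "\<And>x. x \<in> \<Omega> \<Longrightarrow> gl_f \<omega> \<beta> \<nu> (\<delta> x) 1 = 0"
      "\<And>x. x \<in> \<Omega> \<Longrightarrow> deriv_bounded_on_unit L (gl_f \<omega> \<beta> \<nu> (\<delta> x))"
    and bc: "\<And>x. x \<in> frontier \<Omega> \<Longrightarrow> rcdot (outer_normal \<Omega> x) (grad \<psi> x) = 0"
      "\<And>x. x \<in> frontier \<Omega> \<Longrightarrow> A' x \<bullet> outer_normal \<Omega> x = 0"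
    and le1: "\<And>x. x \<in> \<Omega> \<Longrightarrow> cmod (\<psi> x) \<le> 1" "\<And>x. x \<in> \<Omega> \<Longrightarrow> cmod (\<psi>' x) \<le> 1"
    and eq: "\<And>x. x \<in> \<Omega> \<Longrightarrow> (\<psi> x - \<psi>' x) / complex_of_real \<tau> + mag_laplacian \<kappa> A' \<psi> x
        + complex_of_real (gl_f \<omega> \<beta> \<nu> (\<delta> x) ((cmod (\<psi>' x))\<^sup>2)) * \<psi> x
        + complex_of_real S * (\<psi> x - \<psi>' x) = 0"
      "\<And>x. x \<in> \<Omega> \<Longrightarrow> (\<sigma> / \<tau>) *\<^sub>R (A x - A' x) + R x
        + (1 / \<kappa>) *\<^sub>R im_current \<psi> x + (cmod (\<psi> x))\<^sup>2 *\<^sub>R A x = 0"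
    and R: "set_integrable lborel \<Omega> (\<lambda>x. R x \<bullet> (A x - A' x))"
      "(LINT x:\<Omega>|lborel. R x \<bullet> (A x - A' x)) = (LINT x:\<Omega>|lborel. (B x - H x) \<bullet> (B x - B' x))"
  shows "gl_energy \<kappa> (\<lambda>x. gl_F \<omega> \<beta> \<nu> (\<delta> x)) \<Omega> \<psi> A B H
      - gl_energy \<kappa> (\<lambda>x. gl_F \<omega> \<beta> \<nu> (\<delta> x)) \<Omega> \<psi>' A' B' H'
    \<le> (LINT x:\<Omega>|lborel. (H x - B x) \<bullet> (H x - H' x))"
proof -
  have op: "open \<Omega>" and bd: "bounded \<Omega>"
    using \<Omega> by (auto simp: smooth_bounded_domain_def)
  have \<Omega>U: "\<Omega> \<subseteq> U" using closure_subset U(2) by (rule order_trans)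
  have \<kappa>: "\<kappa> \<noteq> 0" using par by simp
  note \<psi>1 = smooth_on_C1_on[OF \<psi>(1)] smooth_on_C1_on[OF \<psi>(2)]
  have \<eta>1: "C1_on U (\<lambda>x. \<psi> x - \<psi>' x)" by (rule C1_on_diff[OF \<psi>1])
  have A0: "continuous_on U A" "continuous_on U A'"
    by (rule C1_on_continuous[OF smooth_on_C1_on[OF A(1)]])
      (rule C1_on_continuous[OF smooth_on_C1_on[OF A(2)]])
  note intI = set_integrable_bounded_open[OF op bd]
  define e where "e \<psi> A B H x = (norm (mag_grad \<kappa> A \<psi> x))\<^sup>2 + gl_F \<omega> \<beta> \<nu> (\<delta> x) ((cmod (\<psi> x))\<^sup>2)
      + (norm (B x - H x))\<^sup>2" for \<psi> and A :: "real^'d \<Rightarrow> real^'d" and B H :: "real^'d \<Rightarrow> 'h" and x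
  have ec: "continuous_on (closure \<Omega>) (e \<psi> A B H)"
    if "C1_on U \<psi>" "continuous_on U A" "continuous_on (closure \<Omega>) B" "continuous_on (closure \<Omega>) H"
    for \<psi> A B H
  proof -
    have "continuous_on (closure \<Omega>) (\<lambda>x. (\<delta> x, (cmod (\<psi> x))\<^sup>2))"
      by (intro continuous_on_Pair \<delta> continuous_on_power continuous_on_norm
          continuous_on_subset[OF C1_on_continuous[OF that(1)] U(2)])
    then have "continuous_on (closure \<Omega>) (\<lambda>x. gl_F \<omega> \<beta> \<nu> (\<delta> x) ((cmod (\<psi> x))\<^sup>2))"
      using continuous_on_compose2[OF continuous_on_gl_F[of \<omega> \<beta> \<nu>]] by force
    then show ?thesis
      unfolding e_def[abs_def]
      by (intro continuous_on_add continuous_on_power continuous_on_norm continuous_on_diff that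
          continuous_on_subset[OF continuous_on_mag_grad[OF that(2,1)] U(2)])
  qed
  have ei: "set_integrable lborel \<Omega> (e \<psi> A B H)" "set_integrable lborel \<Omega> (e \<psi>' A' B' H')"
    by (intro intI ec \<psi>1 A0 BH)+
  let ?P = "\<lambda>x. (H x - B x) \<bullet> (H x - H' x)"
  let ?g = "\<lambda>x. (\<psi> x - \<psi>' x) \<bullet> mag_laplacian \<kappa> A' \<psi> x
      - mag_grad \<kappa> A' \<psi> x \<bullet> mag_grad \<kappa> A' (\<lambda>x. \<psi> x - \<psi>' x) x"
  let ?Q = "\<lambda>x. (B x - H x) \<bullet> (B x - B' x)"
  let ?R = "\<lambda>x. R x \<bullet> (A x - A' x)"
  have Pi: "set_integrable lborel \<Omega> ?P" and Qi: "set_integrable lborel \<Omega> ?Q"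
    by (intro intI continuous_on_inner continuous_on_diff BH)+
  have gi: "set_integrable lborel \<Omega> ?g"
    by (intro intI continuous_on_subset[OF _ U(2)] continuous_on_diff continuous_on_inner
        continuous_on_mag_laplacian[OF U(1) A(2) \<psi>(1)] continuous_on_mag_grad[OF A0(2)] \<eta>1 \<psi>1
        C1_on_continuous)
  have g0: "(LINT x:\<Omega>|lborel. ?g x) = 0"
    by (rule green_identity[OF \<Omega> U A(2) \<psi>(1) \<eta>1 \<kappa> bc])
  \<comment> \<open>Besides \<open>?P\<close>, the right side contains only \<open>?g\<close> and
    \<open>?Q - ?R\<close>, which both have integral zero. They collect what must be moved by parts,
    so that the inequality itself holds at each point.\<close>
  have "(e \<psi> A B H x - e \<psi>' A' B' H' x) / 2 \<le> ?P x - ?g x + (?Q x - ?R x)" if x: "x \<in> \<Omega>" for x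
  proof -
    have xU: "x \<in> U" using x \<Omega>U by blast
    note d = C1_on_differentiable[OF \<psi>1(1) xU] C1_on_differentiable[OF \<psi>1(2) xU]
    let ?s = "(cmod (\<psi> x))\<^sup>2" and ?s' = "(cmod (\<psi>' x))\<^sup>2"
    let ?f = "gl_f \<omega> \<beta> \<nu> (\<delta> x) ?s'"
    have s: "?s \<in> {0..1}" "?s' \<in> {0..1}"
      using le1[OF x] by (auto simp: power_le_one)
    have "- L * (1 - ?s') \<le> ?f"
      by (rule gl_f_bounds_on_unit[OF f(2,1)[OF x] s(2)])
    moreover have "L * (1 - ?s') \<le> L" using par s by (simp add: mult_left_le)
    ultimately have fL: "- L \<le> ?f" by simp
    have "(gl_F \<omega> \<beta> \<nu> (\<delta> x) ?s - gl_F \<omega> \<beta> \<nu> (\<delta> x) ?s') / 2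
      \<le> ((\<psi> x - \<psi>' x) \<bullet> (\<psi> x - \<psi>' x)) / \<tau> + ?f * ((\<psi> x - \<psi>' x) \<bullet> \<psi> x)
        + S * ((\<psi> x - \<psi>' x) \<bullet> (\<psi> x - \<psi>' x))"
      by (rule potential_inequality[OF le1[OF x] par(3,4,5) fL])
        (rule gl_F_quadratic_bound[OF par(6) f(2)[OF x] s(2,1)])
    also have "\<dots> = - ((\<psi> x - \<psi>' x) \<bullet> mag_laplacian \<kappa> A' \<psi> x)"
      using order_parameter_equation_inner[OF eq(1)[OF x]] by simp
    finally have 1: "(gl_F \<omega> \<beta> \<nu> (\<delta> x) ?s - gl_F \<omega> \<beta> \<nu> (\<delta> x) ?s') / 2
      \<le> - ((\<psi> x - \<psi>' x) \<bullet> mag_laplacian \<kappa> A' \<psi> x)" .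
    have "mag_grad \<kappa> A' (\<lambda>x. \<psi> x - \<psi>' x) x = mag_grad \<kappa> A' \<psi> x - mag_grad \<kappa> A' \<psi>' x"
      by (simp add: vec_eq_iff mag_grad_def pderiv_at_diff[OF d] right_diff_distrib diff_divide_distrib)
    then have 2: "((norm (mag_grad \<kappa> A' \<psi> x))\<^sup>2 - (norm (mag_grad \<kappa> A' \<psi>' x))\<^sup>2) / 2
        \<le> mag_grad \<kappa> A' \<psi> x \<bullet> mag_grad \<kappa> A' (\<lambda>x. \<psi> x - \<psi>' x) x"
      using inner_self_diff_ge by metis
    have Rx: "R x = - ((\<sigma> / \<tau>) *\<^sub>R (A x - A' x)) - ((1 / \<kappa>) *\<^sub>R im_current \<psi> x + (cmod (\<psi> x))\<^sup>2 *\<^sub>R A x)"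
      using eq(2)[OF x] by (simp add: algebra_simps eq_neg_iff_add_eq_0)
    have "- ((- (c *\<^sub>R v) - w) \<bullet> v) = c * (v \<bullet> v) + w \<bullet> v" for c and v w :: "real^'d"
      by (simp add: inner_diff_left)
    then have "- ?R x = (\<sigma> / \<tau>) * ((A x - A' x) \<bullet> (A x - A' x))
        + ((1 / \<kappa>) *\<^sub>R im_current \<psi> x + (cmod (\<psi> x))\<^sup>2 *\<^sub>R A x) \<bullet> (A x - A' x)"
      unfolding Rx by blast
    moreover have "0 \<le> (\<sigma> / \<tau>) * ((A x - A' x) \<bullet> (A x - A' x))"
      using par by simp
    ultimately have 3: "((norm (mag_grad \<kappa> A \<psi> x))\<^sup>2 - (norm (mag_grad \<kappa> A' \<psi> x))\<^sup>2) / 2 \<le> - ?R x"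
      using current_inequality[OF d(1) \<kappa>, of A A'] by linarith
    \<comment> \<open>The change of B - H splits into the change of \<open>B\<close>, which is
      matched with the equation for \<open>A\<close>, and the change of the applied field, which is
      the source of the right side of the energy law.\<close>
    have "?Q x + ?P x = (B x - H x) \<bullet> ((B x - H x) - (B' x - H' x))"
      by (simp add: inner_diff_left inner_diff_right)
    then have 4: "((norm (B x - H x))\<^sup>2 - (norm (B' x - H' x))\<^sup>2) / 2 \<le> ?Q x + ?P x"
      using inner_self_diff_ge by metis
    from 1 2 3 4 show ?thesis unfolding e_def by (simp add: field_simps)
  qed
  moreover have "set_integrable lborel \<Omega> (\<lambda>x. (e \<psi> A B H x - e \<psi>' A' B' H' x) / 2)"
    by (intro set_integrable_divide set_integral_diff(1) ei)
  moreover have "set_integrable lborel \<Omega> (\<lambda>x. ?P x - ?g x + (?Q x - ?R x))"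
    by (rule set_integral_add(1)[OF set_integral_diff(1)[OF Pi gi] set_integral_diff(1)[OF Qi R(1)]])
  ultimately have "(LINT x:\<Omega>|lborel. (e \<psi> A B H x - e \<psi>' A' B' H' x) / 2)
      \<le> (LINT x:\<Omega>|lborel. ?P x - ?g x + (?Q x - ?R x))"
    by (intro set_integral_mono)
  also have "\<dots> = (LINT x:\<Omega>|lborel. ?P x)"
    unfolding set_integral_add(2)[OF set_integral_diff(1)[OF Pi gi] set_integral_diff(1)[OF Qi R(1)]]
      set_integral_diff(2)[OF Pi gi] set_integral_diff(2)[OF Qi R(1)] g0 R(2) by simp
  also have "(LINT x:\<Omega>|lborel. (e \<psi> A B H x - e \<psi>' A' B' H' x) / 2)
      = gl_energy \<kappa> (\<lambda>x. gl_F \<omega> \<beta> \<nu> (\<delta> x)) \<Omega> \<psi> A B H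
        - gl_energy \<kappa> (\<lambda>x. gl_F \<omega> \<beta> \<nu> (\<delta> x)) \<Omega> \<psi>' A' B' H'"
    unfolding set_integral_divide_zero set_integral_diff(2)[OF ei]
    by (simp add: gl_energy_def e_def[abs_def] diff_divide_distrib)
  finally show ?thesis .
qed

section \<open>Integration by parts for the curl\<close>

lemma C1_on_curl2:
  assumes "open U" "smooth_on U A"
  shows "C1_on U (curl2 A)"
  unfolding curl2_def[abs_def]
  by (intro C1_on_diff smooth_on_C1_on smooth_on_pderiv_at smooth_on_component assms)

lemma C1_on_component: "C1_on U V \<Longrightarrow> C1_on U (\<lambda>x. V x $ j)"
  by (rule C1_on_bounded_linear[OF bounded_linear_vec_nth])

text \<open>The field (-X V_2, X V_1), which is \<open>V\<close> turned by a right angle and scaled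
  by \<open>X\<close>, has divergence curl X \<bullet> V - X curl V. It vanishes on the frontier
  together with \<open>X\<close>, in particular it is tangential.\<close>

lemma curl2_integration_by_parts:
  fixes V :: "real^2 \<Rightarrow> real^2" and X :: "real^2 \<Rightarrow> real"
  assumes \<Omega>: "smooth_bounded_domain \<Omega>" and U: "open U" "closure \<Omega> \<subseteq> U"
    and X: "C1_on U X" and V: "C1_on U V" and bc: "\<And>x. x \<in> frontier \<Omega> \<Longrightarrow> X x = 0"
  shows "set_integrable lborel \<Omega> (\<lambda>x. curl2_scalar X x \<bullet> V x)"
    and "(LINT x:\<Omega>|lborel. curl2_scalar X x \<bullet> V x) = (LINT x:\<Omega>|lborel. X x \<bullet> curl2 V x)"
proof -
  have op: "open \<Omega>" and bd: "bounded \<Omega>"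
    using \<Omega> by (auto simp: smooth_bounded_domain_def)
  have \<Omega>U: "\<Omega> \<subseteq> U" using closure_subset U(2) by (rule order_trans)
  note Vj = C1_on_component[OF V]
  define W :: "real^2 \<Rightarrow> real^2" where "W x = vector [- (X x * V x $ 2), X x * V x $ 1]" for x
  have W: "W x $ 1 = 0 - X x * V x $ 2" "W x $ 2 = X x * V x $ 1" for x
    by (simp_all add: W_def)
  have W1: "C1_on U (\<lambda>x. W x $ j)" for j
  proof -
    have "j = 1 \<or> j = 2" using exhaust_2 by blast
    then show ?thesis
      by (auto simp: W intro!: C1_on_diff C1_on_mult X Vj C1_on_const simp del: diff_0)
  qed
  have div: "divergence W x = curl2_scalar X x \<bullet> V x - X x \<bullet> curl2 V x" if "x \<in> \<Omega>" for x
  proof -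
    have x: "x \<in> U" using that \<Omega>U by blast
    note d = C1_on_differentiable[OF X x] C1_on_differentiable[OF Vj x]
    have m: "pderiv_at i (\<lambda>y. X y * V y $ j) x = X x * pderiv_at i (\<lambda>y. V y $ j) x + pderiv_at i X x * V x $ j" for i j
      by (rule pderiv_at_mult[OF d])
    have "pderiv_at 1 (\<lambda>y. 0 - X y * V y $ 2) x = 0 - pderiv_at 1 (\<lambda>y. X y * V y $ 2) x"
      using pderiv_at_diff[OF differentiable_const differentiable_mult[OF d], of 1 0 2] by simp
    then show ?thesis
      unfolding divergence_def sum_2 W m
      by (simp add: m curl2_scalar_def curl2_def inner_vec_def sum_2 algebra_simps)
  qed
  have c1: "continuous_on (closure \<Omega>) (\<lambda>x. curl2_scalar X x \<bullet> V x)"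
    unfolding curl2_scalar_def inner_vec_def sum_2 vector_2 inner_real_def
    by (intro continuous_on_add continuous_on_mult continuous_on_minus
        continuous_on_subset[OF C1_on_pderiv_continuous[OF X] U(2)] continuous_on_subset[OF C1_on_continuous[OF Vj] U(2)])
  have c2: "continuous_on (closure \<Omega>) (\<lambda>x. X x \<bullet> curl2 V x)"
    unfolding curl2_def
    by (intro continuous_on_inner continuous_on_diff continuous_on_subset[OF C1_on_continuous[OF X] U(2)]
        continuous_on_subset[OF C1_on_pderiv_continuous[OF Vj] U(2)])
  note int = set_integrable_bounded_open[OF op bd c1] set_integrable_bounded_open[OF op bd c2]
  show "set_integrable lborel \<Omega> (\<lambda>x. curl2_scalar X x \<bullet> V x)" by (rule int)
  have "0 = (LINT x:\<Omega>|lborel. divergence W x)"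
    by (rule divergence_theorem_tangential[OF \<Omega> U W1, symmetric])
      (simp add: W_def bc inner_vec_def sum_2)
  also have "\<dots> = (LINT x:\<Omega>|lborel. curl2_scalar X x \<bullet> V x - X x \<bullet> curl2 V x)"
    using op div by (intro set_lebesgue_integral_cong allI impI) auto
  finally show "(LINT x:\<Omega>|lborel. curl2_scalar X x \<bullet> V x) = (LINT x:\<Omega>|lborel. X x \<bullet> curl2 V x)"
    using set_integral_diff(2)[OF int] by simp
qed

lemma C1_on_vec:
  fixes V :: "real^'d::finite \<Rightarrow> real^'n::finite"
  assumes "\<And>i. C1_on U (\<lambda>x. V x $ i)"
  shows "C1_on U V"
proof (rule C1_onI)
  fix x assume x: "x \<in> U"
  have "((\<lambda>x. V x $ i) has_derivative frechet_derivative (\<lambda>x. V x $ i) (at x)) (at x)" for i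
    using C1_on_differentiable[OF assms x] frechet_derivative_works by blast
  then have D: "(V has_derivative (\<lambda>h. \<chi> i. frechet_derivative (\<lambda>x. V x $ i) (at x) h)) (at x)"
    by (subst has_derivative_componentwise_within)
      (auto simp: Basis_vec_def inner_axis)
  then show "V differentiable (at x)" unfolding differentiable_def by blast
  show "pderiv_at j V x = (\<chi> i. pderiv_at j (\<lambda>x. V x $ i) x)" for j
    using pderiv_at_eq[OF D, of j] by (simp add: pderiv_at_def)
next
  show "continuous_on U (\<lambda>x. \<chi> i. pderiv_at j (\<lambda>x. V x $ i) x)" for j
    by (intro continuous_on_vec_lambda C1_on_pderiv_continuous assms)
qed

lemma C1_on_curl3:
  assumes "open U" "smooth_on U A"
  shows "C1_on U (curl3 A)"
proof (rule C1_on_vec)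
  fix i :: 3
  have "i = 1 \<or> i = 2 \<or> i = 3" using exhaust_3 by blast
  then show "C1_on U (\<lambda>x. curl3 A x $ i)"
    by (elim disjE) (simp_all add: curl3_def C1_on_diff smooth_on_C1_on smooth_on_pderiv_at
        smooth_on_component assms)
qed

text \<open>The divergence of the cross product of \<open>X\<close> and \<open>V\<close> is curl X
  \<bullet> V - X \<bullet> curl V. By cyclicity of the triple product its flux is (n \<times> X)
  \<bullet> V, so it is enough that the tangential part of \<open>X\<close> vanishes on the
  frontier.\<close>

lemma curl3_integration_by_parts:
  fixes V X :: "real^3 \<Rightarrow> real^3"
  assumes \<Omega>: "smooth_bounded_domain \<Omega>" and U: "open U" "closure \<Omega> \<subseteq> U"
    and X: "C1_on U X" and V: "C1_on U V"
    and bc: "\<And>x. x \<in> frontier \<Omega> \<Longrightarrow> cross3 (outer_normal \<Omega> x) (X x) = 0"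
  shows "set_integrable lborel \<Omega> (\<lambda>x. curl3 X x \<bullet> V x)"
    and "(LINT x:\<Omega>|lborel. curl3 X x \<bullet> V x) = (LINT x:\<Omega>|lborel. X x \<bullet> curl3 V x)"
proof -
  have op: "open \<Omega>" and bd: "bounded \<Omega>"
    using \<Omega> by (auto simp: smooth_bounded_domain_def)
  have \<Omega>U: "\<Omega> \<subseteq> U" using closure_subset U(2) by (rule order_trans)
  note Xj = C1_on_component[OF X] and Vj = C1_on_component[OF V]
  define W where "W x = cross3 (X x) (V x)" for x
  have W: "W x $ 1 = X x $ 2 * V x $ 3 - X x $ 3 * V x $ 2"
    "W x $ 2 = X x $ 3 * V x $ 1 - X x $ 1 * V x $ 3"
    "W x $ 3 = X x $ 1 * V x $ 2 - X x $ 2 * V x $ 1" for x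
    by (simp_all add: W_def cross3_def)
  have W1: "C1_on U (\<lambda>x. W x $ j)" for j
  proof -
    have "j = 1 \<or> j = 2 \<or> j = 3" using exhaust_3 by blast
    then show ?thesis
      by (auto simp: W intro!: C1_on_diff C1_on_mult Xj Vj)
  qed
  have div: "divergence W x = curl3 X x \<bullet> V x - X x \<bullet> curl3 V x" if "x \<in> \<Omega>" for x
  proof -
    have x: "x \<in> U" using that \<Omega>U by blast
    note d = C1_on_differentiable[OF Xj x] C1_on_differentiable[OF Vj x]
    have m: "pderiv_at k (\<lambda>y. X y $ i * V y $ j - X y $ i' * V y $ j') x
      = (X x $ i * pderiv_at k (\<lambda>y. V y $ j) x + pderiv_at k (\<lambda>y. X y $ i) x * V x $ j)
        - (X x $ i' * pderiv_at k (\<lambda>y. V y $ j') x + pderiv_at k (\<lambda>y. X y $ i') x * V x $ j')" for i i' j j' k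
      unfolding pderiv_at_diff[OF differentiable_mult[OF d] differentiable_mult[OF d]]
        pderiv_at_mult[OF d] ..
    then show ?thesis
      unfolding divergence_def sum_3 W m
      by (simp add: curl3_def inner_vec_def sum_3 algebra_simps)
  qed
  have c1: "continuous_on (closure \<Omega>) (\<lambda>x. curl3 X x \<bullet> V x)"
    unfolding curl3_def inner_vec_def sum_3 vector_3 inner_real_def
    by (intro continuous_on_add continuous_on_mult continuous_on_diff
        continuous_on_subset[OF C1_on_pderiv_continuous[OF Xj] U(2)] continuous_on_subset[OF C1_on_continuous[OF Vj] U(2)])
  have c2: "continuous_on (closure \<Omega>) (\<lambda>x. X x \<bullet> curl3 V x)"
    unfolding curl3_def inner_vec_def sum_3 vector_3 inner_real_def
    by (intro continuous_on_add continuous_on_mult continuous_on_diff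
        continuous_on_subset[OF C1_on_continuous[OF Xj] U(2)] continuous_on_subset[OF C1_on_pderiv_continuous[OF Vj] U(2)])
  note int = set_integrable_bounded_open[OF op bd c1] set_integrable_bounded_open[OF op bd c2]
  show "set_integrable lborel \<Omega> (\<lambda>x. curl3 X x \<bullet> V x)" by (rule int)
  have "0 = (LINT x:\<Omega>|lborel. divergence W x)"
  proof (rule divergence_theorem_tangential[OF \<Omega> U W1, symmetric])
    fix x assume x: "x \<in> frontier \<Omega>"
    have "W x \<bullet> outer_normal \<Omega> x = cross3 (outer_normal \<Omega> x) (X x) \<bullet> V x"
      unfolding W_def by (simp add: cross3_def inner_vec_def sum_3 algebra_simps)
    then show "W x \<bullet> outer_normal \<Omega> x = 0" by (simp add: bc[OF x])
  qed
  also have "\<dots> = (LINT x:\<Omega>|lborel. curl3 X x \<bullet> V x - X x \<bullet> curl3 V x)"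
    using op div by (intro set_lebesgue_integral_cong allI impI) auto
  finally show "(LINT x:\<Omega>|lborel. curl3 X x \<bullet> V x) = (LINT x:\<Omega>|lborel. X x \<bullet> curl3 V x)"
    using set_integral_diff(2)[OF int] by simp
qed

section \<open>The scheme: bound on all iterates and dimension-free energy law\<close>

lemma gl_scheme_modulus_le_1:
  fixes \<psi> :: "nat \<Rightarrow> real^'d::finite \<Rightarrow> complex"
  assumes \<Omega>: "smooth_bounded_domain \<Omega>"
    and par: "\<kappa> \<noteq> 0" "0 < \<tau>" "0 \<le> L" "2 * L \<le> S"
    and f: "\<And>x. x \<in> closure \<Omega> \<Longrightarrow> f x 1 = 0"
      "\<And>x. x \<in> closure \<Omega> \<Longrightarrow> deriv_bounded_on_unit L (f x)"
    and init: "\<And>x. x \<in> closure \<Omega> \<Longrightarrow> cmod (\<psi> 0 x) \<le> 1"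
    and sch: "gl_common \<kappa> \<tau> S f \<Omega> \<psi> A"
    and x: "x \<in> closure \<Omega>"
  shows "cmod (\<psi> n x) \<le> 1"
  using x
proof (induction n arbitrary: x)
  case 0
  then show ?case by (rule init)
next
  case (Suc n)
  obtain U1 U2 where U: "open U1" "closure \<Omega> \<subseteq> U1" "smooth_on U1 (\<psi> (Suc n))"
    "open U2" "closure \<Omega> \<subseteq> U2" "smooth_on U2 (A n)"
    using sch unfolding gl_common_def smooth_up_to_boundary_def by metis
  have n: "1 \<le> Suc n" "Suc n - 1 = n" by simp_all
  have in\<Omega>: "y \<in> closure \<Omega>" if "y \<in> \<Omega>" for y using that closure_subset by blast
  show ?case
  proof (rule scheme_maximum_principle[OF \<Omega>, of "U1 \<inter> U2" "A n" "\<psi> (Suc n)" \<kappa> \<tau> L S "\<psi> n"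
        "\<lambda>x. f x ((cmod (\<psi> n x))\<^sup>2)"])
    show "smooth_on (U1 \<inter> U2) (A n)" "smooth_on (U1 \<inter> U2) (\<psi> (Suc n))"
      by (rule smooth_on_subset[OF U(6)], simp) (rule smooth_on_subset[OF U(3)], simp)
    show "rcdot (outer_normal \<Omega> y) (grad (\<psi> (Suc n)) y) = 0" "A n y \<bullet> outer_normal \<Omega> y = 0"
      if "y \<in> frontier \<Omega>" for y
      using sch that n(1) unfolding gl_common_def by blast+
    show "cmod (\<psi> n y) \<le> 1" if "y \<in> \<Omega>" for y
      by (rule Suc.IH[OF in\<Omega>[OF that]])
    \<comment> \<open>The induction hypothesis places the squared modulus of the previous iterate in
      [0,1], the interval on which \<open>f\<close> is controlled.\<close>
    show "- L * (1 - (cmod (\<psi> n y))\<^sup>2) \<le> f y ((cmod (\<psi> n y))\<^sup>2)" if "y \<in> \<Omega>" for y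
      by (rule gl_f_bounds_on_unit[OF f(2,1)[OF in\<Omega>[OF that]]])
        (use Suc.IH[OF in\<Omega>[OF that]] in \<open>simp add: power_le_one\<close>)
    show "(\<psi> (Suc n) y - \<psi> n y) / complex_of_real \<tau> + mag_laplacian \<kappa> (A n) (\<psi> (Suc n)) y
        + complex_of_real (f y ((cmod (\<psi> n y))\<^sup>2)) * \<psi> (Suc n) y
        + complex_of_real S * (\<psi> (Suc n) y - \<psi> n y) = 0" if "y \<in> \<Omega>" for y
      using sch that n unfolding gl_common_def by metis
  qed (use U par Suc.prems in auto)
qed

text \<open>Each function comes with its own neighbourhood of the closure; shrinking repeatedly
  gives one on which finitely many of them are smooth.\<close>

lemma smooth_up_to_boundary_common_nbhd:
  assumes "smooth_up_to_boundary \<Omega> f" "open U" "closure \<Omega> \<subseteq> U"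
  obtains V where "open V" "closure \<Omega> \<subseteq> V" "V \<subseteq> U" "smooth_on V f"
proof -
  obtain W where "open W" "closure \<Omega> \<subseteq> W" "smooth_on W f"
    using assms(1) by (auto simp: smooth_up_to_boundary_def)
  with assms(2,3) show ?thesis
    by (intro that[of "U \<inter> W"]) (auto intro: smooth_on_subset)
qed

text \<open>The operators are parameters: \<open>curl\<close> sends a potential to its field and
  \<open>curl'\<close> a field to a vector field, so the pair is \<open>curl2\<close>,
  \<open>curl2_scalar\<close> in the plane and \<open>curl3\<close> twice in space. The boundary
  condition on the curl is hidden in \<open>parts\<close>.\<close>

lemma gl_common_energy_inequality:
  fixes \<psi> :: "nat \<Rightarrow> real^'d::finite \<Rightarrow> complex"
    and H :: "nat \<Rightarrow> real^'d \<Rightarrow> 'h::euclidean_space"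
    and curl :: "(real^'d \<Rightarrow> real^'d) \<Rightarrow> real^'d \<Rightarrow> 'h" and curl' :: "(real^'d \<Rightarrow> 'h) \<Rightarrow> real^'d \<Rightarrow> real^'d"
  assumes \<Omega>: "smooth_bounded_domain \<Omega>" and \<delta>: "smooth_up_to_boundary \<Omega> \<delta>"
    and H: "\<And>n. smooth_up_to_boundary \<Omega> (H n)"
    and par: "0 < \<kappa>" "0 < \<sigma>" "0 < \<tau>" "0 \<le> L" "2 * L \<le> S" "\<beta> \<noteq> 0"
    and f: "\<And>x. x \<in> closure \<Omega> \<Longrightarrow> gl_f \<omega> \<beta> \<nu> (\<delta> x) 1 = 0"
      "\<And>x. x \<in> closure \<Omega> \<Longrightarrow> deriv_bounded_on_unit L (gl_f \<omega> \<beta> \<nu> (\<delta> x))"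
    and init: "\<And>x. x \<in> closure \<Omega> \<Longrightarrow> cmod (\<psi> 0 x) \<le> 1"
    and sch: "gl_common \<kappa> \<tau> S (\<lambda>x. gl_f \<omega> \<beta> \<nu> (\<delta> x)) \<Omega> \<psi> A"
    and eq: "\<And>x. x \<in> \<Omega> \<Longrightarrow> (\<sigma> / \<tau>) *\<^sub>R (A n x - A (n - 1) x) + curl' (curl (A n)) x
        + (1 / \<kappa>) *\<^sub>R im_current (\<psi> n) x + (cmod (\<psi> n x))\<^sup>2 *\<^sub>R A n x = curl' (H n) x"
    and C1_curl: "\<And>U A. open U \<Longrightarrow> smooth_on U A \<Longrightarrow> C1_on U (curl A)"
    and curl_diff: "\<And>U A A' x. open U \<Longrightarrow> smooth_on U A \<Longrightarrow> smooth_on U A' \<Longrightarrow> x \<in> U \<Longrightarrow>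
        curl (\<lambda>x. A x - A' x) x = curl A x - curl A' x"
    and curl'_diff: "\<And>U X Y x. C1_on U X \<Longrightarrow> C1_on U Y \<Longrightarrow> x \<in> U \<Longrightarrow>
        curl' (\<lambda>x. X x - Y x) x = curl' X x - curl' Y x"
    and parts: "\<And>U V. open U \<Longrightarrow> closure \<Omega> \<subseteq> U \<Longrightarrow> C1_on U (\<lambda>x. curl (A n) x - H n x) \<Longrightarrow> C1_on U V \<Longrightarrow>
        set_integrable lborel \<Omega> (\<lambda>x. curl' (\<lambda>x. curl (A n) x - H n x) x \<bullet> V x) \<and>
        (LINT x:\<Omega>|lborel. curl' (\<lambda>x. curl (A n) x - H n x) x \<bullet> V x)
          = (LINT x:\<Omega>|lborel. (curl (A n) x - H n x) \<bullet> curl V x)"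
    and n: "1 \<le> n"
  shows "gl_energy \<kappa> (\<lambda>x. gl_F \<omega> \<beta> \<nu> (\<delta> x)) \<Omega> (\<psi> n) (A n) (curl (A n)) (H n)
      - gl_energy \<kappa> (\<lambda>x. gl_F \<omega> \<beta> \<nu> (\<delta> x)) \<Omega> (\<psi> (n - 1)) (A (n - 1)) (curl (A (n - 1))) (H (n - 1))
    \<le> (LINT x:\<Omega>|lborel. (H n x - curl (A n) x) \<bullet> (H n x - H (n - 1) x))"
proof -
  have sm: "smooth_up_to_boundary \<Omega> (\<psi> m)" "smooth_up_to_boundary \<Omega> (A m)" for m
    using sch by (auto simp: gl_common_def)
  obtain U1 where U1: "open U1" "closure \<Omega> \<subseteq> U1" "smooth_on U1 (\<psi> n)"
    using sm(1) by (auto simp: smooth_up_to_boundary_def)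
  obtain U2 where U2: "open U2" "closure \<Omega> \<subseteq> U2" "U2 \<subseteq> U1" "smooth_on U2 (\<psi> (n - 1))"
    by (rule smooth_up_to_boundary_common_nbhd[OF sm(1) U1(1,2)])
  obtain U3 where U3: "open U3" "closure \<Omega> \<subseteq> U3" "U3 \<subseteq> U2" "smooth_on U3 (A n)"
    by (rule smooth_up_to_boundary_common_nbhd[OF sm(2) U2(1,2)])
  obtain U4 where U4: "open U4" "closure \<Omega> \<subseteq> U4" "U4 \<subseteq> U3" "smooth_on U4 (A (n - 1))"
    by (rule smooth_up_to_boundary_common_nbhd[OF sm(2) U3(1,2)])
  obtain U5 where U5: "open U5" "closure \<Omega> \<subseteq> U5" "U5 \<subseteq> U4" "smooth_on U5 (H (n - 1))"
    by (rule smooth_up_to_boundary_common_nbhd[OF H U4(1,2)])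
  obtain U where U: "open U" "closure \<Omega> \<subseteq> U" "U \<subseteq> U5" "smooth_on U (H n)"
    by (rule smooth_up_to_boundary_common_nbhd[OF H U5(1,2)])
  have sub: "U \<subseteq> U1" "U \<subseteq> U2" "U \<subseteq> U3" "U \<subseteq> U4"
    using U2(3) U3(3) U4(3) U5(3) U(3) by blast+
  have \<psi>: "smooth_on U (\<psi> n)" "smooth_on U (\<psi> (n - 1))"
    and A: "smooth_on U (A n)" "smooth_on U (A (n - 1))" and H': "smooth_on U (H (n - 1))"
    using smooth_on_subset U1(3) U2(4) U3(4) U4(4) U5(4) U(3) sub by blast+
  have cont: "continuous_on (closure \<Omega>) g" if "C1_on U g" for g :: "real^'d \<Rightarrow> 'h"
    by (rule continuous_on_subset[OF C1_on_continuous[OF that] U(2)])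
  note B1 = C1_curl[OF U(1) A(1)] C1_curl[OF U(1) A(2)]
    and H1 = smooth_on_C1_on[OF U(4)] smooth_on_C1_on[OF H']
  have closure\<Omega>: "x \<in> closure \<Omega>" "x \<in> U" if "x \<in> \<Omega>" for x
    using that closure_subset U(2) by blast+
  have le1: "cmod (\<psi> m x) \<le> 1" if "x \<in> \<Omega>" for m x
    by (rule gl_scheme_modulus_le_1[OF \<Omega> _ par(3,4,5) f init sch closure\<Omega>(1)[OF that]])
      (use par in auto)
  \<comment> \<open>Moving the curl of \<open>H n\<close> to the left side makes
    \<open>curl'\<close> act on the difference X, for which the boundary condition is
    homogeneous.\<close>
  define X where "X x = curl (A n) x - H n x" for x
  define V where "V x = A n x - A (n - 1) x" for x
  have X1: "C1_on U (\<lambda>x. curl (A n) x - H n x)" and V1: "C1_on U V"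
    unfolding V_def[abs_def] by (intro C1_on_diff B1 H1 smooth_on_C1_on A)+
  note parts' = parts[OF U(1,2) X1 V1, folded X_def]
  have curlV: "curl V x = curl (A n) x - curl (A (n - 1)) x" if "x \<in> U" for x
    unfolding V_def[abs_def] by (rule curl_diff[OF U(1) A that])
  have curl'X: "curl' X x = curl' (curl (A n)) x - curl' (H n) x" if "x \<in> U" for x
    unfolding X_def[abs_def] by (rule curl'_diff[OF B1(1) H1(1) that])
  show ?thesis
  proof (rule scheme_energy_inequality[OF \<Omega> U(1,2) A \<psi>, where R = "curl' X"])
    show "continuous_on (closure \<Omega>) \<delta>"
      using \<delta> unfolding smooth_up_to_boundary_def
      by (meson C1_on_continuous continuous_on_subset smooth_on_C1_on)
    show "rcdot (outer_normal \<Omega> x) (grad (\<psi> n) x) = 0" "A (n - 1) x \<bullet> outer_normal \<Omega> x = 0"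
      if "x \<in> frontier \<Omega>" for x
      using sch n that unfolding gl_common_def by blast+
    show "(\<psi> n x - \<psi> (n - 1) x) / complex_of_real \<tau> + mag_laplacian \<kappa> (A (n - 1)) (\<psi> n) x
        + complex_of_real (gl_f \<omega> \<beta> \<nu> (\<delta> x) ((cmod (\<psi> (n - 1) x))\<^sup>2)) * \<psi> n x
        + complex_of_real S * (\<psi> n x - \<psi> (n - 1) x) = 0" if "x \<in> \<Omega>" for x
      using sch n that unfolding gl_common_def by blast
    show "(\<sigma> / \<tau>) *\<^sub>R (A n x - A (n - 1) x) + curl' X x
        + (1 / \<kappa>) *\<^sub>R im_current (\<psi> n) x + (cmod (\<psi> n x))\<^sup>2 *\<^sub>R A n x = 0" if "x \<in> \<Omega>" for x
      using eq[OF that] unfolding curl'X[OF closure\<Omega>(2)[OF that]] by (simp add: algebra_simps)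
    show "set_integrable lborel \<Omega> (\<lambda>x. curl' X x \<bullet> (A n x - A (n - 1) x))"
      using parts' by (simp add: X_def[abs_def] V_def)
    have "(LINT x:\<Omega>|lborel. curl' X x \<bullet> V x) = (LINT x:\<Omega>|lborel. X x \<bullet> curl V x)"
      using parts' by (simp add: X_def[abs_def])
    also have "\<dots> = (LINT x:\<Omega>|lborel. X x \<bullet> (curl (A n) x - curl (A (n - 1)) x))"
      using \<Omega> curlV[OF closure\<Omega>(2)]
      by (intro set_lebesgue_integral_cong allI impI) (auto simp: smooth_bounded_domain_def)
    finally show "(LINT x:\<Omega>|lborel. curl' X x \<bullet> (A n x - A (n - 1) x))
        = (LINT x:\<Omega>|lborel. (curl (A n) x - H n x) \<bullet> (curl (A n) x - curl (A (n - 1)) x))"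
      by (simp add: X_def V_def)
  qed (use par f le1 closure\<Omega> cont[OF B1(1)] cont[OF B1(2)] cont[OF H1(1)] cont[OF H1(2)] in auto)
qed

section \<open>The planar and the spatial scheme\<close>

lemma curl2_diff:
  assumes "open U" "smooth_on U A" "smooth_on U A'" "x \<in> U"
  shows "curl2 (\<lambda>x. A x - A' x) x = curl2 A x - curl2 A' x"
proof -
  note d = C1_on_differentiable[OF smooth_on_C1_on[OF smooth_on_component[OF assms(1,2)]] assms(4)]
    C1_on_differentiable[OF smooth_on_C1_on[OF smooth_on_component[OF assms(1,3)]] assms(4)]
  show ?thesis by (simp add: curl2_def pderiv_at_diff[OF d])
qed

text \<open>Stated for C^1 fields because \<open>curl3\<close> plays both roles in space: it is
  applied to the smooth potentials and again to curls and applied fields.\<close>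

lemma curl3_diff:
  assumes "C1_on U A" "C1_on U A'" "x \<in> U"
  shows "curl3 (\<lambda>x. A x - A' x) x = curl3 A x - curl3 A' x"
proof -
  note d = C1_on_differentiable[OF C1_on_component[OF assms(1)] assms(3)]
    C1_on_differentiable[OF C1_on_component[OF assms(2)] assms(3)]
  show ?thesis by (simp add: curl3_def pderiv_at_diff[OF d] vec_eq_iff forall_3)
qed

lemma curl2_scalar_diff:
  assumes "C1_on U X" "C1_on U Y" "x \<in> U"
  shows "curl2_scalar (\<lambda>x. X x - Y x) x = curl2_scalar X x - curl2_scalar Y x"
  using pderiv_at_diff[OF C1_on_differentiable[OF assms(1,3)] C1_on_differentiable[OF assms(2,3)]]
  by (simp add: curl2_scalar_def vec_eq_iff forall_2)

theorem theorem3p2: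
  fixes \<kappa> \<sigma> \<tau> S L \<omega> \<beta> \<beta>\<^sub>0 \<nu>\<^sub>0 :: real
  assumes "\<kappa> > 0" "\<sigma> > 0" "\<tau> > 0" "\<omega> > 0" "\<beta> > 0" "\<beta>\<^sub>0 > 0" "L > 0"
    and "\<nu>\<^sub>0 * integral {0..\<omega>} (\<lambda>\<xi>. tanh (\<beta>\<^sub>0 * \<xi>) / (2 * \<xi>)) = 1"
    and "S \<ge> 2 * L"
  shows
    "(\<forall>(\<Omega> :: (real^2) set) (\<delta> :: real^2 \<Rightarrow> real) (Hext :: real^2 \<Rightarrow> real \<Rightarrow> real)
        (\<psi> :: nat \<Rightarrow> real^2 \<Rightarrow> complex) (A :: nat \<Rightarrow> real^2 \<Rightarrow> real^2).
       let f = (\<lambda>x. gl_f \<omega> \<beta> \<nu>\<^sub>0 (\<delta> x));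
           F = (\<lambda>x. gl_F \<omega> \<beta> \<nu>\<^sub>0 (\<delta> x));
           H = (\<lambda>n x. Hext x (real n * \<tau>));
           E = (\<lambda>n. gl_energy \<kappa> F \<Omega> (\<psi> n) (A n) (curl2 (A n)) (H n))
       in smooth_bounded_domain \<Omega> \<longrightarrow>
          smooth_up_to_boundary \<Omega> \<delta> \<longrightarrow>
          (\<forall>n. smooth_up_to_boundary \<Omega> (H n)) \<longrightarrow>
          (\<forall>x\<in>closure \<Omega>. f x 1 = 0) \<longrightarrow>
          (\<forall>x\<in>closure \<Omega>. deriv_bounded_on_unit L (f x)) \<longrightarrow>
          (\<forall>x\<in>closure \<Omega>. cmod (\<psi> 0 x) \<le> 1) \<longrightarrow>
          gl_scheme_2d \<kappa> \<sigma> \<tau> S f \<Omega> H \<psi> A \<longrightarrow>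
          (\<forall>n\<ge>1. E n - E (n - 1)
             \<le> (LINT x:\<Omega>|lborel. (H n x - curl2 (A n) x) * (H n x - H (n - 1) x))))
     \<and>
     (\<forall>(\<Omega> :: (real^3) set) (\<delta> :: real^3 \<Rightarrow> real) (Hext :: real^3 \<Rightarrow> real \<Rightarrow> real^3)
        (\<psi> :: nat \<Rightarrow> real^3 \<Rightarrow> complex) (A :: nat \<Rightarrow> real^3 \<Rightarrow> real^3).
       let f = (\<lambda>x. gl_f \<omega> \<beta> \<nu>\<^sub>0 (\<delta> x));
           F = (\<lambda>x. gl_F \<omega> \<beta> \<nu>\<^sub>0 (\<delta> x));
           H = (\<lambda>n x. Hext x (real n * \<tau>));
           E = (\<lambda>n. gl_energy \<kappa> F \<Omega> (\<psi> n) (A n) (curl3 (A n)) (H n))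
       in smooth_bounded_domain \<Omega> \<longrightarrow>
          smooth_up_to_boundary \<Omega> \<delta> \<longrightarrow>
          (\<forall>n. smooth_up_to_boundary \<Omega> (H n)) \<longrightarrow>
          (\<forall>x\<in>closure \<Omega>. f x 1 = 0) \<longrightarrow>
          (\<forall>x\<in>closure \<Omega>. deriv_bounded_on_unit L (f x)) \<longrightarrow>
          (\<forall>x\<in>closure \<Omega>. cmod (\<psi> 0 x) \<le> 1) \<longrightarrow>
          gl_scheme_3d \<kappa> \<sigma> \<tau> S f \<Omega> H \<psi> A \<longrightarrow>
          (\<forall>n\<ge>1. E n - E (n - 1)
             \<le> (LINT x:\<Omega>|lborel. (H n x - curl3 (A n) x) \<bullet> (H n x - H (n - 1) x))))"
proof (intro conjI allI; unfold Let_def; intro allI impI)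
  have par: "0 \<le> L" "\<beta> \<noteq> 0" using assms by auto
  fix \<Omega> :: "(real^2) set" and \<delta> :: "real^2 \<Rightarrow> real" and Hext :: "real^2 \<Rightarrow> real \<Rightarrow> real"
    and \<psi> :: "nat \<Rightarrow> real^2 \<Rightarrow> complex" and A :: "nat \<Rightarrow> real^2 \<Rightarrow> real^2" and n :: nat
  assume \<Omega>: "smooth_bounded_domain \<Omega>" and \<delta>: "smooth_up_to_boundary \<Omega> \<delta>"
    and H: "\<forall>n. smooth_up_to_boundary \<Omega> (\<lambda>x. Hext x (real n * \<tau>))"
    and f: "\<forall>x\<in>closure \<Omega>. gl_f \<omega> \<beta> \<nu>\<^sub>0 (\<delta> x) 1 = 0"
      "\<forall>x\<in>closure \<Omega>. deriv_bounded_on_unit L (gl_f \<omega> \<beta> \<nu>\<^sub>0 (\<delta> x))"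
    and init: "\<forall>x\<in>closure \<Omega>. cmod (\<psi> 0 x) \<le> 1"
    and sch: "gl_scheme_2d \<kappa> \<sigma> \<tau> S (\<lambda>x. gl_f \<omega> \<beta> \<nu>\<^sub>0 (\<delta> x)) \<Omega> (\<lambda>n x. Hext x (real n * \<tau>)) \<psi> A"
    and n: "1 \<le> n"
  have com: "gl_common \<kappa> \<tau> S (\<lambda>x. gl_f \<omega> \<beta> \<nu>\<^sub>0 (\<delta> x)) \<Omega> \<psi> A"
    and eq: "\<And>x. x \<in> \<Omega> \<Longrightarrow> (\<sigma> / \<tau>) *\<^sub>R (A n x - A (n - 1) x) + curl2_scalar (curl2 (A n)) x
        + (1 / \<kappa>) *\<^sub>R im_current (\<psi> n) x + (cmod (\<psi> n x))\<^sup>2 *\<^sub>R A n x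
        = curl2_scalar (\<lambda>x. Hext x (real n * \<tau>)) x"
    and bc: "\<And>x. x \<in> frontier \<Omega> \<Longrightarrow> curl2 (A n) x = Hext x (real n * \<tau>)"
    using sch n unfolding gl_scheme_2d_def by blast+
  \<comment> \<open>The boundary condition of the scheme says that the scalar curl A - H is zero on
    the frontier, as integration by parts demands.\<close>
  have parts: "set_integrable lborel \<Omega> (\<lambda>x. curl2_scalar (\<lambda>x. curl2 (A n) x - Hext x (real n * \<tau>)) x \<bullet> V x) \<and>
      (LINT x:\<Omega>|lborel. curl2_scalar (\<lambda>x. curl2 (A n) x - Hext x (real n * \<tau>)) x \<bullet> V x)
        = (LINT x:\<Omega>|lborel. (curl2 (A n) x - Hext x (real n * \<tau>)) \<bullet> curl2 V x)"
    if "open U" "closure \<Omega> \<subseteq> U" "C1_on U (\<lambda>x. curl2 (A n) x - Hext x (real n * \<tau>))" "C1_on U V" for U V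
    using curl2_integration_by_parts[OF \<Omega> that] bc by simp
  have "gl_energy \<kappa> (\<lambda>x. gl_F \<omega> \<beta> \<nu>\<^sub>0 (\<delta> x)) \<Omega> (\<psi> n) (A n) (curl2 (A n)) (\<lambda>x. Hext x (real n * \<tau>))
      - gl_energy \<kappa> (\<lambda>x. gl_F \<omega> \<beta> \<nu>\<^sub>0 (\<delta> x)) \<Omega> (\<psi> (n - 1)) (A (n - 1)) (curl2 (A (n - 1)))
          (\<lambda>x. Hext x (real (n - 1) * \<tau>))
    \<le> (LINT x:\<Omega>|lborel. (Hext x (real n * \<tau>) - curl2 (A n) x)
        \<bullet> (Hext x (real n * \<tau>) - Hext x (real (n - 1) * \<tau>)))"
    by (rule gl_common_energy_inequality[where H = "\<lambda>n x. Hext x (real n * \<tau>)" and L = L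
          and curl = curl2 and curl' = curl2_scalar, OF \<Omega> \<delta>])
      (fact assms par com eq parts n H[rule_format] f[rule_format] init[rule_format] C1_on_curl2 curl2_diff curl2_scalar_diff)+
  then show "gl_energy \<kappa> (\<lambda>x. gl_F \<omega> \<beta> \<nu>\<^sub>0 (\<delta> x)) \<Omega> (\<psi> n) (A n) (curl2 (A n)) (\<lambda>x. Hext x (real n * \<tau>))
      - gl_energy \<kappa> (\<lambda>x. gl_F \<omega> \<beta> \<nu>\<^sub>0 (\<delta> x)) \<Omega> (\<psi> (n - 1)) (A (n - 1)) (curl2 (A (n - 1)))
          (\<lambda>x. Hext x (real (n - 1) * \<tau>))
    \<le> (LINT x:\<Omega>|lborel. (Hext x (real n * \<tau>) - curl2 (A n) x)
        * (Hext x (real n * \<tau>) - Hext x (real (n - 1) * \<tau>)))"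
    unfolding inner_real_def .
next
  have par: "0 \<le> L" "\<beta> \<noteq> 0" using assms by auto
  fix \<Omega> :: "(real^3) set" and \<delta> :: "real^3 \<Rightarrow> real" and Hext :: "real^3 \<Rightarrow> real \<Rightarrow> real^3"
    and \<psi> :: "nat \<Rightarrow> real^3 \<Rightarrow> complex" and A :: "nat \<Rightarrow> real^3 \<Rightarrow> real^3" and n :: nat
  assume \<Omega>: "smooth_bounded_domain \<Omega>" and \<delta>: "smooth_up_to_boundary \<Omega> \<delta>"
    and H: "\<forall>n. smooth_up_to_boundary \<Omega> (\<lambda>x. Hext x (real n * \<tau>))"
    and f: "\<forall>x\<in>closure \<Omega>. gl_f \<omega> \<beta> \<nu>\<^sub>0 (\<delta> x) 1 = 0"
      "\<forall>x\<in>closure \<Omega>. deriv_bounded_on_unit L (gl_f \<omega> \<beta> \<nu>\<^sub>0 (\<delta> x))"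
    and init: "\<forall>x\<in>closure \<Omega>. cmod (\<psi> 0 x) \<le> 1"
    and sch: "gl_scheme_3d \<kappa> \<sigma> \<tau> S (\<lambda>x. gl_f \<omega> \<beta> \<nu>\<^sub>0 (\<delta> x)) \<Omega> (\<lambda>n x. Hext x (real n * \<tau>)) \<psi> A"
    and n: "1 \<le> n"
  have com: "gl_common \<kappa> \<tau> S (\<lambda>x. gl_f \<omega> \<beta> \<nu>\<^sub>0 (\<delta> x)) \<Omega> \<psi> A"
    and eq: "\<And>x. x \<in> \<Omega> \<Longrightarrow> (\<sigma> / \<tau>) *\<^sub>R (A n x - A (n - 1) x) + curl3 (curl3 (A n)) x
        + (1 / \<kappa>) *\<^sub>R im_current (\<psi> n) x + (cmod (\<psi> n x))\<^sup>2 *\<^sub>R A n x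
        = curl3 (\<lambda>x. Hext x (real n * \<tau>)) x"
    and bc: "\<And>x. x \<in> frontier \<Omega> \<Longrightarrow>
        cross3 (outer_normal \<Omega> x) (curl3 (A n) x) = cross3 (outer_normal \<Omega> x) (Hext x (real n * \<tau>))"
    using sch n unfolding gl_scheme_3d_def by blast+
  have diff: "curl3 (\<lambda>x. A x - A' x) x = curl3 A x - curl3 A' x"
    if "open U" "smooth_on U A" "smooth_on U A'" "x \<in> U" for U A A' x
    by (rule curl3_diff[OF smooth_on_C1_on[OF that(2)] smooth_on_C1_on[OF that(3)] that(4)])
  \<comment> \<open>By linearity of the cross product, equality of the tangential parts of curl A
    and H is the vanishing of n \<times> (curl A - H).\<close>
  have parts: "set_integrable lborel \<Omega> (\<lambda>x. curl3 (\<lambda>x. curl3 (A n) x - Hext x (real n * \<tau>)) x \<bullet> V x) \<and>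
      (LINT x:\<Omega>|lborel. curl3 (\<lambda>x. curl3 (A n) x - Hext x (real n * \<tau>)) x \<bullet> V x)
        = (LINT x:\<Omega>|lborel. (curl3 (A n) x - Hext x (real n * \<tau>)) \<bullet> curl3 V x)"
    if "open U" "closure \<Omega> \<subseteq> U" "C1_on U (\<lambda>x. curl3 (A n) x - Hext x (real n * \<tau>))" "C1_on U V" for U V
    using curl3_integration_by_parts[OF \<Omega> that] bc by (simp add: Cross3.right_diff_distrib)
  show "gl_energy \<kappa> (\<lambda>x. gl_F \<omega> \<beta> \<nu>\<^sub>0 (\<delta> x)) \<Omega> (\<psi> n) (A n) (curl3 (A n)) (\<lambda>x. Hext x (real n * \<tau>))
      - gl_energy \<kappa> (\<lambda>x. gl_F \<omega> \<beta> \<nu>\<^sub>0 (\<delta> x)) \<Omega> (\<psi> (n - 1)) (A (n - 1)) (curl3 (A (n - 1)))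
          (\<lambda>x. Hext x (real (n - 1) * \<tau>))
    \<le> (LINT x:\<Omega>|lborel. (Hext x (real n * \<tau>) - curl3 (A n) x)
        \<bullet> (Hext x (real n * \<tau>) - Hext x (real (n - 1) * \<tau>)))"
    by (rule gl_common_energy_inequality[where H = "\<lambda>n x. Hext x (real n * \<tau>)" and L = L
          and curl = curl3 and curl' = curl3, OF \<Omega> \<delta>])
      (fact assms par com eq parts n H[rule_format] f[rule_format] init[rule_format] C1_on_curl3 diff curl3_diff)+
qed

end
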